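(* Let $\ell\ge 1$, $0<q<1$, and let $\underline p_{\ell+1}=(p_{\ell+1,1},\ldots,p_{\ell+1,\ell+1})\in\mathbb Z^{\ell+1}$ satisfy $p_{\ell+1,1}\ge\cdots\ge p_{\ell+1,\ell+1}$. Then the normalized $q$-deformed $\mathfrak{gl}_{\ell+1}$-Whittaker function coincides with the $t=0$ specialization of the Macdonald polynomial: $$\widetilde\Psi^{\mathfrak{gl}_{\ell+1}}_{z_1,\ldots,z_{\ell+1}}(\underline p_{\ell+1})=P_\lambda(z_1,\ldots,z_{\ell+1};q,t=0),\qquad \lambda=(p_{\ell+1,1},\ldots,p_{\ell+1,\ell+1}).$$
   Context: Notation: $(n)_q!=(1-q)(1-q^2)\cdots(1-q^n)$ for $n\ge 0$, with $(0)_q!=1$. The $q$-deformed $\mathfrak{gl}_{\ell+1}$-Whittaker function. For $p_{\ell+1,1}\ge\cdots\ge p_{\ell+1,\ell+1}$, $$\Psi^{\mathfrak{gl}_{\ell+1}}_{z_1,\ldots,z_{\ell+1}}(\underline p_{\ell+1})=\sum_{(p_{k,i})}\ \prod_{k=1}^{\ell+1}z_k^{\sum_i p_{k,i}-\sum_i p_{k-1,i}}\ \frac{\prod_{k=2}^{\ell}\prod_{i=1}^{k-1}(p_{k,i}-p_{k,i+1})_q!}{\prod_{k=1}^{\ell}\prod_{i=1}^{k}(p_{k+1,i}-p_{k,i})_q!\,(p_{k,i}-p_{k+1,i+1})_q!},$$ where the sum is over all integers $p_{k,i}$, $1\le i\le k\le\ell$, with $p_{k+1,i}\ge p_{k,i}\ge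 p_{k+1,i+1}$ (Gelfand–Zetlin conditions), and $\sum_i p_{0,i}=0$. The normalized function is $$\widetilde\Psi^{\mathfrak{gl}_{\ell+1}}_{z}(\underline p_{\ell+1})=\prod_{i=1}^{\ell}(p_{\ell+1,i}-p_{\ell+1,i+1})_q!\ \Psi^{\mathfrak{gl}_{\ell+1}}_{z}(\underline p_{\ell+1}).$$ Macdonald polynomials. For a partition $\lambda=(\lambda_1\ge\cdots\ge\lambda_{\ell+1}\ge0)$, $P_\lambda(x;q,t)$ is the Macdonald symmetric polynomial in $x_1,\ldots,x_{\ell+1}$ over $\mathbb Q(q,t)$: the unique symmetric polynomial of the form $m_\lambda+\sum_{\mu<\lambda}u_{\lambda\mu}m_\mu$ ($m_\mu$ the monomial symmetric polynomials, $<$ the dominance order) satisfying $H_rP_\lambda=\Big(\sum_{|I|=r}\prod_{i\in I}q^{\lambda_i}t^{\ell+1-i}\Big)P_\lambda$ for $r=1,\ldots,\ell+1$, where the sum is over $r$-element subsets $I\subset\{1,\ldots,\ell+1\}$, $$H_r=\sum_{|I|=r}t^{r(r-1)/2}\prod_{i\in I,\,j\notin I}\frac{tx_i-x_j}{x_i-x_j}\prod_{i\in I}T_{x_i},$$ and $T_{x_i}$ replaces $x_i$ by $qx_i$. For $\lambda\in\mathbb Z^{\ell+1}$ with $\lambda_1\ge\cdots\ge\lambda_{\ell+1}$, one sets $P_\lambda=\big(\prod_j x_j^{\lambda_{\ell+1}}\big)P_{(\lambda_1-\lambda_{\ell+1},\ldots,\lambda_\ell-\lambda_{\ell+1},0)}$.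 The coefficients of $P_\lambda$ are regular at $t=0$, and $P_\lambda(x;q,t=0)$ is the resulting specialization. *)

theory Defs
  imports
    Complex_Main
    "HOL-Library.Poly_Mapping"
    "HOL-Computational_Algebra.Computational_Algebra"
    "HOL-Computational_Algebra.Field_as_Ring"
    "HOL-Combinatorics.Permutations"
begin

text \<open>
  Sequences such as \<open>\<lambda>\<close>, \<open>x\<close> or \<open>z\<close> are functions on \<^typ>\<open>nat\<close>, read at the indices \<open>1, \<dots>, n\<close>.
  Throughout, \<open>n = l + 1\<close>.
\<close>

section \<open>The \<open>q\<close>-deformed Whittaker function\<close>

definition qfac :: "real \<Rightarrow> nat \<Rightarrow> real" where
  "qfac q n = (\<Prod>k = 1..n. 1 - q ^ k)"

text \<open>
  Gelfand--Zetlin arrays \<open>P k i\<close>, \<open>1 \<le> i \<le> k \<le> l + 1\<close>, with top row \<open>p\<close>. Entries outside the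
  triangle are pinned to 0, so that each array is represented by exactly one function.
\<close>

definition GZ :: "nat \<Rightarrow> (nat \<Rightarrow> int) \<Rightarrow> (nat \<Rightarrow> nat \<Rightarrow> int) set" where
  "GZ l p = {P.
     (\<forall>i\<in>{1..l + 1}. P (l + 1) i = p i) \<and>
     (\<forall>k\<in>{1..l}. \<forall>i\<in>{1..k}. P (k + 1) i \<ge> P k i \<and> P k i \<ge> P (k + 1) (i + 1)) \<and>
     (\<forall>k i. \<not> (1 \<le> i \<and> i \<le> k \<and> k \<le> l + 1) \<longrightarrow> P k i = 0)}"

definition whittaker :: "nat \<Rightarrow> real \<Rightarrow> (nat \<Rightarrow> complex) \<Rightarrow> (nat \<Rightarrow> int) \<Rightarrow> complex" where
  "whittaker l q z p = (\<Sum>P\<in>GZ l p.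
     (\<Prod>k = 1..l + 1. z k powi ((\<Sum>i = 1..k. P k i) - (\<Sum>i = 1..k - 1. P (k - 1) i))) *
     complex_of_real
       ((\<Prod>k = 2..l. \<Prod>i = 1..k - 1. qfac q (nat (P k i - P k (i + 1)))) /
        (\<Prod>k = 1..l. \<Prod>i = 1..k. qfac q (nat (P (k + 1) i - P k i)) *
                             qfac q (nat (P k i - P (k + 1) (i + 1))))))"

definition whittaker_normalized ::
    "nat \<Rightarrow> real \<Rightarrow> (nat \<Rightarrow> complex) \<Rightarrow> (nat \<Rightarrow> int) \<Rightarrow> complex" where
  "whittaker_normalized l q z p =
     complex_of_real (\<Prod>i = 1..l. qfac q (nat (p i - p (i + 1)))) * whittaker l q z p"

section \<open>Macdonald polynomials\<close>

text \<open>
  The field \<open>\<rat>(q,t)\<close> is the fraction field of \<open>\<rat>[q][t]\<close>: the inner polynomial variable is \<open>q\<close>,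
  the outer one is \<open>t\<close>. A monomial \<open>x\<^sup>\<alpha>\<close> is given by its finitely supported exponent vector \<open>\<alpha>\<close>.
\<close>

type_synonym Qqt = "rat poly poly fract"
type_synonym 'a mpol = "(nat \<Rightarrow>\<^sub>0 nat) \<Rightarrow>\<^sub>0 'a"

definition qK :: Qqt where "qK = Fract [:[:0, 1:]:] 1"
definition tK :: Qqt where "tK = Fract [:0, 1:] 1"

definition cst :: "'a::zero \<Rightarrow> 'a mpol" where
  "cst c = Poly_Mapping.single 0 c"

definition X :: "nat \<Rightarrow> Qqt mpol" where
  "X i = Poly_Mapping.single (Poly_Mapping.single i 1) 1"

text \<open>Apply \<open>h\<close> to the coefficients and substitute \<open>v i\<close> for the variable \<open>x\<^sub>i\<close>.\<close>

definition subst :: "('a::zero \<Rightarrow> 'b::comm_semiring_1) \<Rightarrow> (nat \<Rightarrow> 'b) \<Rightarrow> 'a mpol \<Rightarrow> 'b" where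
  "subst h v f = (\<Sum>\<alpha>\<in>Poly_Mapping.keys f. h (Poly_Mapping.lookup f \<alpha>) *
      (\<Prod>i\<in>Poly_Mapping.keys \<alpha>. v i ^ Poly_Mapping.lookup \<alpha> i))"

text \<open>\<open>qshift I\<close> is the product of the commuting operators \<open>T\<close> in the variables \<open>x\<^sub>i\<close>, \<open>i \<in> I\<close>.\<close>

definition qshift :: "nat set \<Rightarrow> Qqt mpol \<Rightarrow> Qqt mpol" where
  "qshift I f = subst cst (\<lambda>i. if i \<in> I then cst qK * X i else X i) f"

definition emb :: "Qqt mpol \<Rightarrow> Qqt mpol fract" where
  "emb f = Fract f 1"

text \<open>The coefficients of \<open>H\<^sub>r\<close> are rational functions of the \<open>x\<^sub>i\<close>, so \<open>H\<^sub>r f\<close> is formed in the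
  field of rational functions.\<close>

definition Hop :: "nat \<Rightarrow> nat \<Rightarrow> Qqt mpol \<Rightarrow> Qqt mpol fract" where
  "Hop n r f = (\<Sum>I | I \<subseteq> {1..n} \<and> card I = r.
     emb (cst (tK ^ (r * (r - 1) div 2))) *
     (\<Prod>i\<in>I. \<Prod>j\<in>{1..n} - I. emb (cst tK * X i - X j) / emb (X i - X j)) *
     emb (qshift I f))"

definition eigval :: "nat \<Rightarrow> nat \<Rightarrow> (nat \<Rightarrow> nat) \<Rightarrow> Qqt" where
  "eigval n r lam = (\<Sum>I | I \<subseteq> {1..n} \<and> card I = r. \<Prod>i\<in>I. qK ^ lam i * tK ^ (n - i))"

definition is_partition :: "nat \<Rightarrow> (nat \<Rightarrow> nat) \<Rightarrow> bool" where
  "is_partition n \<mu> \<longleftrightarrow> (\<forall>i\<in>{1..<n}. \<mu> (i + 1) \<le> \<mu> i) \<and> (\<forall>i. i \<notin> {1..n} \<longrightarrow> \<mu> i = 0)"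

definition dom_less :: "nat \<Rightarrow> (nat \<Rightarrow> nat) \<Rightarrow> (nat \<Rightarrow> nat) \<Rightarrow> bool" where
  "dom_less n \<mu> lam \<longleftrightarrow> \<mu> \<noteq> lam \<and> (\<Sum>i = 1..n. \<mu> i) = (\<Sum>i = 1..n. lam i) \<and>
     (\<forall>k\<in>{1..n}. (\<Sum>i = 1..k. \<mu> i) \<le> (\<Sum>i = 1..k. lam i))"

text \<open>Monomial symmetric polynomial: the sum of the distinct monomials whose exponent vector is a
  rearrangement of \<open>\<mu>\<close>.\<close>

definition msym :: "nat \<Rightarrow> (nat \<Rightarrow> nat) \<Rightarrow> Qqt mpol" where
  "msym n \<mu> = (\<Sum>\<alpha> | Poly_Mapping.keys \<alpha> \<subseteq> {1..n} \<and>
      (\<exists>\<pi>. \<pi> permutes {1..n} \<and> (\<forall>i\<in>{1..n}. Poly_Mapping.lookup \<alpha> i = \<mu> (\<pi> i))).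
    Poly_Mapping.single \<alpha> 1)"

text \<open>Symmetry need not be demanded separately: it is contained in the expansion into the
  \<open>m\<^sub>\<mu>\<close>.\<close>

definition is_macdonald :: "nat \<Rightarrow> (nat \<Rightarrow> nat) \<Rightarrow> Qqt mpol \<Rightarrow> bool" where
  "is_macdonald n lam P \<longleftrightarrow>
     (\<exists>u. P = msym n lam + (\<Sum>\<mu> | is_partition n \<mu> \<and> dom_less n \<mu> lam. cst (u \<mu>) * msym n \<mu>)) \<and>
     (\<forall>r\<in>{1..n}. Hop n r P = emb (cst (eigval n r lam)) * emb P)"

definition macdonald :: "nat \<Rightarrow> (nat \<Rightarrow> nat) \<Rightarrow> Qqt mpol" where
  "macdonald n lam = (THE P. is_macdonald n lam P)"

section \<open>Specialization at \<open>t = 0\<close>\<close>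

text \<open>
  Both maps below use the reduced representation of a fraction: an element of \<open>\<rat>(q,t)\<close> is regular
  at \<open>t = 0\<close> iff its reduced denominator does not vanish there, and likewise for evaluating an
  element of \<open>\<rat>(q)\<close> at a real number \<open>q\<close>.
\<close>

definition at_t0 :: "Qqt \<Rightarrow> rat poly fract" where
  "at_t0 c = (case quot_of_fract c of (a, b) \<Rightarrow> Fract (poly a 0) (poly b 0))"

definition at_q :: "real \<Rightarrow> rat poly fract \<Rightarrow> real" where
  "at_q q c = (case quot_of_fract c of (a, b) \<Rightarrow>
     poly (map_poly of_rat a) q / poly (map_poly of_rat b) q)"

text \<open>
  The value \<open>P\<^sub>\<lambda>(z; q, t = 0)\<close> for a non-increasing integer sequence \<open>\<lambda>\<close>. If \<open>\<lambda>\<^sub>n\<close> is negative this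
  is a Laurent polynomial, to be evaluated at nonzero \<open>z\<^sub>j\<close>.
\<close>

definition macdonald_t0 ::
    "nat \<Rightarrow> real \<Rightarrow> (nat \<Rightarrow> int) \<Rightarrow> (nat \<Rightarrow> complex) \<Rightarrow> complex" where
  "macdonald_t0 n q lam z =
     (\<Prod>j = 1..n. z j powi lam n) *
     subst (\<lambda>c. complex_of_real (at_q q (at_t0 c))) z
       (macdonald n (\<lambda>i. if i \<in> {1..n} then nat (lam i - lam n) else 0))"

end

theory Submission
  imports Defs
begin

text \<open>
  At \<open>t = 0\<close> the operators \<open>H\<^sub>r\<close>, divided by \<open>t\<close> to the power \<open>r (r - 1) / 2\<close>, become
  \<open>D\<^sub>r = \<Sum>\<^bsub>|I| = r\<^esub> \<Prod>\<^bsub>i \<in> I, j \<notin> I\<^esub> x\<^sub>j / (x\<^sub>j - x\<^sub>i) T\<^sub>I\<close>. They are triangular for the dominance order and their joint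
  eigenvalues, \<open>q\<close> to the sum of the last \<open>r\<close> parts, separate partitions. Hence the Macdonald
  polynomials are regular at \<open>t = 0\<close>, and the limits \<open>E\<^sub>\<lambda>\<close> are the unique monic joint eigenfunctions of
  the \<open>D\<^sub>r\<close>.

  The operator \<open>B = \<Sum>\<^sub>i x\<^sub>i \<Prod>\<^bsub>j \<noteq> i\<^esub> x\<^sub>j / (x\<^sub>j - x\<^sub>i) T\<^sub>i\<close> satisfies \<open>D\<^sub>r B = q B D\<^sub>r\<close>, so \<open>B E\<^sub>\<lambda>\<close> is a multiple of
  \<open>E\<close> for \<open>\<lambda>\<close> with its last part raised by one (zero if that is no partition). On the other hand
  \<open>B = x\<^sub>n (D\<^sub>1 - D\<^sub>1')\<close>, where \<open>D\<^sub>1'\<close> is \<open>D\<^sub>1\<close> in the first \<open>n - 1\<close> variables. Comparing the coefficients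
  \<open>c\<^bsub>\<lambda>\<nu>\<^esub>\<close> of \<open>E\<^sub>\<lambda> = \<Sum>\<^sub>\<nu> c\<^bsub>\<lambda>\<nu>\<^esub> x\<^sub>n\<^bsup>|\<lambda>| - |\<nu>|\<^esup> E\<^sub>\<nu>\<close> yields a two-term recursion in \<open>\<lambda>\<^sub>n\<close>. It allows one to raise
  \<open>\<lambda>\<^sub>n\<close> to \<open>\<nu>\<^bsub>n - 1\<^esub>\<close>; dividing by the product of the variables both become 0, and then exchanging
  \<open>x\<^bsub>n - 1\<^esub>\<close> with \<open>x\<^sub>n\<close> and setting \<open>x\<^bsub>n - 1\<^esub> = 0\<close> leads to \<open>n - 1\<close> variables. So \<open>c\<^bsub>\<lambda>\<nu>\<^esub>\<close> is the product of the
  \<open>q\<close>-binomial coefficients with arguments \<open>\<lambda>\<^sub>i - \<lambda>\<^bsub>i + 1\<^esub>\<close> and \<open>\<lambda>\<^sub>i - \<nu>\<^sub>i\<close>, which is the weight of one row of the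
  Gelfand--Zetlin sum.
\<close>

section \<open>Alternants and monomial symmetric functions\<close>

text \<open>At t = 0 the eigenvalue of D_r sees only the sum of the last r parts, so a single
  operator does not separate partitions in general, and triangularity of one operator does not give
  joint eigenfunctions. They are obtained from indeterminate t, where H_1 alone has distinct
  eigenvalues: back substitution yields its eigenvectors, commutation with H_1 makes them
  eigenvectors of every H_r, and regularity at t = 0 is proved coefficient by coefficient, each time
  with an H_r whose two relevant eigenvalues still differ at t = 0. The multiple that relates B E to
  the next E is not computed directly. The branching coefficient of \<lambda> without its last part
  is always 1, and comparing it on both sides gives the multiple as a difference of two powers of q,
  with the last two parts of \<lambda> as exponents. If these parts are equal, the multiple is 0;
  this is where the bound of \<nu> by \<lambda> comes from. The operators divide by x_i - x_j.
  Symmetric polynomials are therefore handled through their values at points with distinct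
  coordinates, and coefficients are recovered by evaluating at the variables themselves, taken as
  elements of the field of rational functions.\<close>

instance fract :: ("{idom,ring_char_0}") field_char_0
proof
  show "inj (of_nat :: nat \<Rightarrow> 'a fract)"
    by (rule injI) (simp add: of_nat_fract eq_fract)
qed

text \<open>A value at a point y of an arbitrary commutative ring, not a formal monomial: the same
  functions are evaluated at the generic point, at its q-shifts and at complex numbers.\<close>

definition mon :: "nat \<Rightarrow> (nat \<Rightarrow> nat) \<Rightarrow> (nat \<Rightarrow> 'a::comm_ring_1) \<Rightarrow> 'a" where
  "mon n \<alpha> y = (\<Prod>i = 1..n. y i ^ \<alpha> i)"

text \<open>Vanishing outside \<open>{1..n}\<close> makes equality of exponents equality of
  functions, and it makes \<open>evec m d\<close> the part of \<open>evec (Suc m) d\<close> with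
  last entry 0.\<close>

definition evec :: "nat \<Rightarrow> nat \<Rightarrow> (nat \<Rightarrow> nat) set" where
  "evec n d = {\<alpha>. (\<forall>i. i \<notin> {1..n} \<longrightarrow> \<alpha> i = 0) \<and> (\<Sum>i = 1..n. \<alpha> i) = d}"

definition par :: "nat \<Rightarrow> nat \<Rightarrow> (nat \<Rightarrow> nat) set" where
  "par n d = {\<mu>\<in>evec n d. \<forall>i\<in>{1..<n}. \<mu> (i + 1) \<le> \<mu> i}"

text \<open>A set of vectors instead of a family indexed by permutations, so that \<open>msf\<close>
  counts each distinct monomial once when \<mu> has equal parts.\<close>

definition orb :: "nat \<Rightarrow> (nat \<Rightarrow> nat) \<Rightarrow> (nat \<Rightarrow> nat) set" where
  "orb n \<mu> = (\<lambda>\<pi>. \<mu> \<circ> \<pi>) ` {\<pi>. \<pi> permutes {1..n}}"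

definition msf :: "nat \<Rightarrow> (nat \<Rightarrow> nat) \<Rightarrow> (nat \<Rightarrow> 'a::comm_ring_1) \<Rightarrow> 'a" where
  "msf n \<mu> y = (\<Sum>\<alpha>\<in>orb n \<mu>. mon n \<alpha> y)"

definition alt :: "nat \<Rightarrow> (nat \<Rightarrow> nat) \<Rightarrow> (nat \<Rightarrow> 'a::comm_ring_1) \<Rightarrow> 'a" where
  "alt n \<beta> y = (\<Sum>\<pi> | \<pi> permutes {1..n}. of_int (sign \<pi>) * mon n (\<beta> \<circ> \<pi>) y)"

definition stair :: "nat \<Rightarrow> nat \<Rightarrow> nat" where
  "stair n i = n - i"

lemma finite_orb [simp]: "finite (orb n \<mu>)"
  by (simp add: orb_def finite_permutations)

lemma finite_evec [simp]: "finite (evec n d)"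
proof (rule finite_subset)
  show "evec n d \<subseteq> {f. \<forall>i. (i \<in> {1..n} \<longrightarrow> f i \<in> {..d}) \<and> (i \<notin> {1..n} \<longrightarrow> f i = 0)}"
    unfolding evec_def by (auto intro: member_le_sum)
qed (rule finite_set_of_finite_funs; simp)

lemma finite_par [simp]: "finite (par n d)"
  by (rule finite_subset[OF _ finite_evec]) (auto simp: par_def)

lemma sum_permutations_compose_left:
  assumes "q permutes S"
  shows "sum f {p. p permutes S} = (\<Sum>p | p permutes S. f (q \<circ> p))"
proof (rule sum.reindex_bij_witness[of _ "\<lambda>p. q \<circ> p" "\<lambda>p. inv q \<circ> p"])
qed (use assms in \<open>auto simp: permutes_compose permutes_inv o_assoc permutes_inv_o\<close>)

lemma sign_compose_permutes:
  assumes "finite S" "p permutes S" "q permutes S"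
  shows "sign (p \<circ> q) = sign p * sign q"
  using assms by (meson permutation_permutes sign_compose)

lemma mon_mult: "mon n \<alpha> y * mon n \<beta> y = mon n (\<lambda>i. \<alpha> i + \<beta> i) y"
  by (simp add: mon_def power_add prod.distrib)

lemma mon_permute:
  assumes "\<pi> permutes {1..n}"
  shows "mon n (\<alpha> \<circ> \<pi>) (y \<circ> \<pi>) = mon n \<alpha> y"
  unfolding mon_def using prod.permute[OF assms, of "\<lambda>i. y i ^ \<alpha> i"] by (simp add: o_def)

lemma alt_compose:
  assumes "\<sigma> permutes {1..n}"
  shows "alt n (\<beta> \<circ> \<sigma>) y = of_int (sign \<sigma>) * alt n \<beta> y"
proof -
  have s: "sign \<sigma> * sign (\<sigma> \<circ> p) = sign p" if "p permutes {1..n}" for p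
    using sign_compose_permutes[OF _ assms that] by (simp add: sign_def)
  have "alt n \<beta> y = (\<Sum>p | p permutes {1..n}. of_int (sign (\<sigma> \<circ> p)) * mon n (\<beta> \<circ> (\<sigma> \<circ> p)) y)"
    unfolding alt_def by (rule sum_permutations_compose_left[OF assms])
  then have "of_int (sign \<sigma>) * alt n \<beta> y =
      (\<Sum>p | p permutes {1..n}. of_int (sign \<sigma> * sign (\<sigma> \<circ> p)) * mon n (\<beta> \<circ> (\<sigma> \<circ> p)) y)"
    by (simp add: sum_distrib_left mult.assoc)
  also have "\<dots> = alt n (\<beta> \<circ> \<sigma>) y"
    unfolding alt_def by (rule sum.cong) (auto simp: s o_assoc)
  finally show ?thesis by simp
qed

lemma alt_eq_0:
  fixes y :: "nat \<Rightarrow> 'a::field_char_0"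
  assumes "i \<in> {1..n}" "j \<in> {1..n}" "i \<noteq> j" "\<beta> i = \<beta> j"
  shows "alt n \<beta> y = 0"
proof -
  have "\<beta> \<circ> transpose i j = \<beta>"
    using assms by (auto simp: fun_eq_iff transpose_def)
  then have "alt n \<beta> y = - alt n \<beta> y"
    using alt_compose[OF permutes_swap_id[OF assms(1,2)], of \<beta> y] assms(3)
    by (simp add: sign_swap_id)
  then show ?thesis by simp
qed

text \<open>Rearranging exponents permutes the orbit. In the term of the alternant with permutation
  \<pi>, the monomial symmetric function can therefore be summed over \<alpha> composed with \<pi>,
  which matches the exponent \<beta> composed with \<pi>.\<close>

lemma alt_mult_msf:
  "alt n \<beta> y * msf n \<mu> y = (\<Sum>\<alpha>\<in>orb n \<mu>. alt n (\<lambda>i. \<beta> i + \<alpha> i) y)"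
proof -
  have r: "msf n \<mu> y = (\<Sum>\<alpha>\<in>orb n \<mu>. mon n (\<alpha> \<circ> \<pi>) y)" if p: "\<pi> permutes {1..n}" for \<pi>
    unfolding msf_def
  proof (rule sum.reindex_bij_witness[of _ "\<lambda>\<alpha>. \<alpha> \<circ> \<pi>" "\<lambda>\<alpha>. \<alpha> \<circ> inv \<pi>"])
    fix \<alpha> assume "\<alpha> \<in> orb n \<mu>"
    then show "\<alpha> \<circ> inv \<pi> \<in> orb n \<mu>" "\<alpha> \<circ> \<pi> \<in> orb n \<mu>"
      using p by (auto simp: orb_def o_assoc[symmetric] intro!: imageI permutes_compose permutes_inv)
  qed (use p in \<open>auto simp: o_assoc[symmetric] permutes_inv_o\<close>)
  have "alt n \<beta> y * msf n \<mu> y =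
      (\<Sum>\<pi> | \<pi> permutes {1..n}. of_int (sign \<pi>) * mon n (\<beta> \<circ> \<pi>) y * (\<Sum>\<alpha>\<in>orb n \<mu>. mon n (\<alpha> \<circ> \<pi>) y))"
    unfolding alt_def sum_distrib_right by (rule sum.cong) (auto simp: r)
  also have "\<dots> = (\<Sum>\<pi> | \<pi> permutes {1..n}. \<Sum>\<alpha>\<in>orb n \<mu>. of_int (sign \<pi>) * mon n ((\<lambda>i. \<beta> i + \<alpha> i) \<circ> \<pi>) y)"
    by (simp add: sum_distrib_left mult.assoc mon_mult o_def)
  also have "\<dots> = (\<Sum>\<alpha>\<in>orb n \<mu>. alt n (\<lambda>i. \<beta> i + \<alpha> i) y)"
    unfolding alt_def by (rule sum.swap)
  finally show ?thesis .
qed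

section \<open>Partial sums and sorting\<close>

lemma par_antimono:
  assumes "\<mu> \<in> par n d" "i \<in> {1..n}" "i \<le> j" "j \<in> {1..n}"
  shows "\<mu> j \<le> \<mu> i"
proof -
  have "k \<le> n \<longrightarrow> \<mu> k \<le> \<mu> i" if "i \<le> k" for k
    using that
  proof (induction k rule: dec_induct)
    case (step k)
    show ?case
    proof
      assume "Suc k \<le> n"
      then have "\<mu> (k + 1) \<le> \<mu> k" using assms step unfolding par_def by auto
      with step \<open>Suc k \<le> n\<close> show "\<mu> (Suc k) \<le> \<mu> i" by simp
    qed
  qed auto
  then show ?thesis using assms by auto
qed

text \<open>The largest element b of S is at least the cardinality of S, so replacing f b by the
  value of f at that cardinality does not decrease the sum; the other elements follow by
  induction.\<close>

lemma sum_le_initial: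
  fixes f :: "nat \<Rightarrow> nat"
  assumes anti: "\<And>i j. i \<in> {1..n} \<Longrightarrow> j \<in> {1..n} \<Longrightarrow> i \<le> j \<Longrightarrow> f j \<le> f i"
    and S: "S \<subseteq> {1..n}"
  shows "sum f S \<le> sum f {1..card S}"
proof -
  have "finite S" using S finite_subset by blast
  from this S show ?thesis
  proof (induction S rule: finite_linorder_max_induct)
    case (insert b A)
    have "A \<subseteq> {1..<b}" using insert by auto
    then have "card A \<le> b - 1" using card_mono[of "{1..<b}" A] by simp
    moreover have "1 \<le> b" "b \<le> n" using insert by auto
    ultimately have "f b \<le> f (Suc (card A))" by (intro anti) auto
    moreover have "b \<notin> A" using insert by auto
    ultimately show ?case using insert by simp
  qed simp
qed

lemma sum_permute_le_initial:
  fixes f :: "nat \<Rightarrow> nat"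
  assumes anti: "\<And>i j. i \<in> {1..n} \<Longrightarrow> j \<in> {1..n} \<Longrightarrow> i \<le> j \<Longrightarrow> f j \<le> f i"
    and p: "\<pi> permutes {1..n}" and k: "k \<le> n"
  shows "(\<Sum>i = 1..k. f (\<pi> i)) \<le> (\<Sum>i = 1..k. f i)"
proof -
  have inj: "inj_on \<pi> {1..k}" using p by (meson inj_on_subset permutes_inj subset_UNIV)
  have "(\<Sum>i = 1..k. f (\<pi> i)) = sum f (\<pi> ` {1..k})" using sum.reindex[OF inj, of f] by (simp add: o_def)
  also have "\<pi> ` {1..k} \<subseteq> {1..n}"
    using k permutes_image[OF p] by (metis atLeastatMost_subset_iff image_mono le_refl)
  then have "sum f (\<pi> ` {1..k}) \<le> sum f {1..card (\<pi> ` {1..k})}"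
    by (rule sum_le_initial[of n, rotated]) (rule anti)
  also have "card (\<pi> ` {1..k}) = k" using card_image[OF inj] by simp
  finally show ?thesis .
qed

text \<open>A permutation that maximizes the sum with the strictly decreasing weights n - i has no
  ascent, since exchanging the two values at an ascent would increase the sum.\<close>

lemma ex_sorting_permutation:
  fixes \<alpha> :: "nat \<Rightarrow> nat"
  obtains \<pi> where "\<pi> permutes {1..n}" "\<forall>i\<in>{1..<n}. \<alpha> (\<pi> (i + 1)) \<le> \<alpha> (\<pi> i)"
proof -
  define w where "w \<pi> = (\<Sum>i = 1..n. (n - i) * \<alpha> (\<pi> i))" for \<pi>
  let ?P = "{\<pi>. \<pi> permutes {1..n}}"
  have fin: "finite (w ` ?P)" by (simp add: finite_permutations)
  have "Max (w ` ?P) \<in> w ` ?P" using fin permutes_id[of "{1..n}"] by (intro Max_in) blast+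
  then obtain \<pi> where p: "\<pi> permutes {1..n}" and M: "Max (w ` ?P) = w \<pi>" by auto
  have "\<alpha> (\<pi> (i + 1)) \<le> \<alpha> (\<pi> i)" if i: "i \<in> {1..<n}" for i
  proof (rule ccontr)
    assume less: "\<not> ?thesis"
    let ?t = "transpose i (i + 1)"
    have t: "?t permutes {1..n}" using i by (intro permutes_swap_id) auto
    have le: "w (\<pi> \<circ> ?t) \<le> w \<pi>"
      using Max_ge[OF fin, of "w (\<pi> \<circ> ?t)"] M permutes_compose[OF t p] by auto
    have split: "{1..n} = insert i (insert (i + 1) ({1..n} - {i, i + 1}))" using i by auto
    have dec: "w \<rho> = (n - i) * \<alpha> (\<rho> i) + (n - (i + 1)) * \<alpha> (\<rho> (i + 1)) +
        (\<Sum>k\<in>{1..n} - {i, i + 1}. (n - k) * \<alpha> (\<rho> k))" for \<rho>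
      unfolding w_def by (subst split) simp
    have "(\<Sum>k\<in>{1..n} - {i, i + 1}. (n - k) * \<alpha> ((\<pi> \<circ> ?t) k)) =
        (\<Sum>k\<in>{1..n} - {i, i + 1}. (n - k) * \<alpha> (\<pi> k))"
      by (rule sum.cong) (auto simp: transpose_def)
    then have "(n - i) * \<alpha> (\<pi> (i + 1)) + (n - (i + 1)) * \<alpha> (\<pi> i) \<le>
        (n - i) * \<alpha> (\<pi> i) + (n - (i + 1)) * \<alpha> (\<pi> (i + 1))"
      using le dec[of \<pi>] dec[of "\<pi> \<circ> ?t"] by simp
    moreover obtain m where "n - i = Suc m" "n - (i + 1) = m" using i by (metis Suc_diff_Suc Suc_eq_plus1 atLeastLessThan_iff)
    ultimately show False using less by simp
  qed
  with p that show thesis by blast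
qed


section \<open>Dominance order and orbits of exponent vectors\<close>

definition dom_le :: "nat \<Rightarrow> (nat \<Rightarrow> nat) \<Rightarrow> (nat \<Rightarrow> nat) \<Rightarrow> bool" where
  "dom_le n \<mu> lam \<longleftrightarrow> \<mu> = lam \<or> dom_less n \<mu> lam"

text \<open>Strictly increasing along the dominance order by \<open>height_less\<close>, so that
  inductions along the order, and the choice of maximal elements, can be carried out with natural
  numbers.\<close>

definition height :: "nat \<Rightarrow> (nat \<Rightarrow> nat) \<Rightarrow> nat" where
  "height n \<mu> = (\<Sum>k = 1..n. \<Sum>i = 1..k. \<mu> i)"

lemma eq_of_partial_sums:
  fixes \<mu> \<nu> :: "nat \<Rightarrow> nat"
  assumes "\<And>k. k \<le> n \<Longrightarrow> (\<Sum>i = 1..k. \<mu> i) = (\<Sum>i = 1..k. \<nu> i)" and "i \<in> {1..n}"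
  shows "\<mu> i = \<nu> i"
proof -
  obtain k where "i = Suc k" using assms(2) by (cases i) auto
  then show ?thesis using assms(1)[of k] assms(1)[of i] assms(2) by simp
qed

lemma evec_eqI:
  assumes "\<alpha> \<in> evec n d" "\<beta> \<in> evec n d'" "\<And>i. i \<in> {1..n} \<Longrightarrow> \<alpha> i = \<beta> i"
  shows "\<alpha> = \<beta>"
  using assms unfolding evec_def by (intro ext) (metis (mono_tags, lifting) mem_Collect_eq)

lemma par_evec: "\<mu> \<in> par n d \<Longrightarrow> \<mu> \<in> evec n d"
  by (simp add: par_def)

lemma height_less:
  assumes "dom_less n \<mu> lam" "\<mu> \<in> evec n d" "lam \<in> evec n d"
  shows "height n \<mu> < height n lam"
proof -
  have le: "(\<Sum>i = 1..k. \<mu> i) \<le> (\<Sum>i = 1..k. lam i)" if "k \<in> {1..n}" for k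
    using assms(1) that by (auto simp: dom_less_def)
  have "\<exists>k\<in>{1..n}. (\<Sum>i = 1..k. \<mu> i) < (\<Sum>i = 1..k. lam i)"
  proof (rule ccontr)
    assume not: "\<not> ?thesis"
    have "(\<Sum>i = 1..k. \<mu> i) = (\<Sum>i = 1..k. lam i)" if "k \<le> n" for k
    proof (cases "k = 0")
      case False
      then have k: "k \<in> {1..n}" using that by simp
      with not have "\<not> (\<Sum>i = 1..k. \<mu> i) < (\<Sum>i = 1..k. lam i)" by blast
      with le[OF k] show ?thesis by linarith
    qed simp
    then have "\<mu> = lam" using evec_eqI[OF assms(2,3)] eq_of_partial_sums by blast
    then show False using assms(1) by (simp add: dom_less_def)
  qed
  then show ?thesis unfolding height_def using le by (intro sum_strict_mono_ex1) auto
qed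

lemma dom_less_trans:
  assumes "dom_less n \<mu> \<nu>" "dom_less n \<nu> \<rho>" "\<mu> \<in> evec n d" "\<nu> \<in> evec n d" "\<rho> \<in> evec n d"
  shows "dom_less n \<mu> \<rho>"
proof -
  have "height n \<mu> < height n \<rho>" using assms height_less by (meson less_trans)
  then have "\<mu> \<noteq> \<rho>" by auto
  then show ?thesis using assms(1,2) unfolding dom_less_def by (auto intro: le_trans)
qed

lemma dom_less_irrefl [simp]: "\<not> dom_less n \<mu> \<mu>"
  by (simp add: dom_less_def)

lemma dom_le_less_trans:
  assumes "dom_le n \<mu> \<nu>" "dom_less n \<nu> \<rho>" "\<mu> \<in> evec n d" "\<nu> \<in> evec n d" "\<rho> \<in> evec n d"
  shows "dom_less n \<mu> \<rho>"
  using assms dom_less_trans unfolding dom_le_def by blast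

lemma evec_compose:
  assumes "\<alpha> \<in> evec n d" "\<pi> permutes {1..n}"
  shows "\<alpha> \<circ> \<pi> \<in> evec n d"
proof -
  have "(\<Sum>i = 1..n. \<alpha> (\<pi> i)) = (\<Sum>i = 1..n. \<alpha> i)"
    using sum.permute[OF assms(2), of \<alpha>] by (simp add: o_def)
  moreover have "\<alpha> (\<pi> i) = 0" if "i \<notin> {1..n}" for i
    using that assms permutes_not_in[OF assms(2) that] by (auto simp: evec_def)
  ultimately show ?thesis using assms(1) by (auto simp: evec_def)
qed

lemma orb_subset_evec: "\<mu> \<in> evec n d \<Longrightarrow> orb n \<mu> \<subseteq> evec n d"
  by (auto simp: orb_def intro: evec_compose)

lemma self_in_orb: "\<mu> \<in> orb n \<mu>"
  unfolding orb_def by (rule image_eqI[of _ _ id]) (auto simp: permutes_id)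

text \<open>Each of the two decreasing vectors has the largest partial sums in the common orbit, so
  all partial sums agree.\<close>

lemma par_orb_unique:
  assumes "\<mu> \<in> par n d" "\<nu> \<in> par n d" "\<nu> \<in> orb n \<mu>"
  shows "\<nu> = \<mu>"
proof -
  obtain \<pi> where p: "\<pi> permutes {1..n}" and nu: "\<nu> = \<mu> \<circ> \<pi>" using assms(3) by (auto simp: orb_def)
  have mu: "\<mu> = \<nu> \<circ> inv \<pi>" using p by (simp add: nu o_assoc[symmetric] permutes_inv_o)
  have "(\<Sum>i = 1..k. \<nu> i) = (\<Sum>i = 1..k. \<mu> i)" if "k \<le> n" for k
  proof (rule le_antisym)
    show "(\<Sum>i = 1..k. \<nu> i) \<le> (\<Sum>i = 1..k. \<mu> i)"
      using sum_permute_le_initial[of n \<mu>, OF par_antimono[OF assms(1)] p that] by (simp add: nu)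
    show "(\<Sum>i = 1..k. \<mu> i) \<le> (\<Sum>i = 1..k. \<nu> i)"
      using sum_permute_le_initial[of n \<nu>, OF par_antimono[OF assms(2)] permutes_inv[OF p] that]
        fun_cong[OF mu] by simp
  qed
  then show ?thesis using evec_eqI eq_of_partial_sums par_evec assms(1,2) by metis
qed

lemma ex_par_orb:
  assumes "\<alpha> \<in> evec n d"
  obtains \<mu> where "\<mu> \<in> par n d" "\<alpha> \<in> orb n \<mu>"
proof -
  obtain \<pi> where p: "\<pi> permutes {1..n}" and a: "\<forall>i\<in>{1..<n}. \<alpha> (\<pi> (i + 1)) \<le> \<alpha> (\<pi> i)"
    by (rule ex_sorting_permutation)
  have "\<alpha> \<circ> \<pi> \<in> par n d" using a evec_compose[OF assms p] by (auto simp: par_def)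
  moreover have "\<alpha> \<in> orb n (\<alpha> \<circ> \<pi>)" unfolding orb_def
    by (rule image_eqI[of _ _ "inv \<pi>"]) (use p in \<open>auto simp: o_assoc[symmetric] permutes_inv_o permutes_inv\<close>)
  ultimately show thesis by (rule that)
qed

lemma sum_evec_orb: "(\<Sum>\<alpha>\<in>evec n d. g \<alpha>) = (\<Sum>\<mu>\<in>par n d. \<Sum>\<alpha>\<in>orb n \<mu>. g \<alpha>)"
proof -
  have "evec n d = (\<Union>\<mu>\<in>par n d. orb n \<mu>)"
    using orb_subset_evec par_evec by (fastforce elim: ex_par_orb)
  moreover have "orb n \<mu> \<inter> orb n \<nu> = {}" if mn: "\<mu> \<in> par n d" "\<nu> \<in> par n d" "\<mu> \<noteq> \<nu>" for \<mu> \<nu>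
  proof (rule ccontr)
    assume "\<not> ?thesis"
    then obtain \<pi> \<rho> where p: "\<pi> permutes {1..n}" "\<rho> permutes {1..n}" "\<mu> \<circ> \<pi> = \<nu> \<circ> \<rho>"
      by (auto simp: orb_def)
    then have "\<nu> = \<mu> \<circ> (\<pi> \<circ> inv \<rho>)" by (simp add: o_assoc) (simp add: o_assoc[symmetric] permutes_inv_o)
    then have "\<nu> \<in> orb n \<mu>" using p by (auto simp: orb_def intro!: imageI permutes_compose permutes_inv)
    then show False using par_orb_unique mn by blast
  qed
  ultimately show ?thesis by (simp add: sum.UNION_disjoint)
qed

lemma sum_evec_symmetric:
  assumes "\<And>\<pi> \<alpha>. \<pi> permutes {1..n} \<Longrightarrow> \<alpha> \<in> evec n d \<Longrightarrow> G (\<alpha> \<circ> \<pi>) = G \<alpha>"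
  shows "(\<Sum>\<alpha>\<in>evec n d. G \<alpha> * mon n \<alpha> y) = (\<Sum>\<mu>\<in>par n d. G \<mu> * msf n \<mu> y)"
proof -
  have "(\<Sum>\<alpha>\<in>orb n \<mu>. G \<alpha> * mon n \<alpha> y) = G \<mu> * msf n \<mu> y" if "\<mu> \<in> par n d" for \<mu>
    unfolding msf_def sum_distrib_left
    by (rule sum.cong) (use assms par_evec[OF that] in \<open>auto simp: orb_def\<close>)
  then show ?thesis by (simp add: sum_evec_orb)
qed

lemma mon_cong: "(\<And>i. i \<in> {1..n} \<Longrightarrow> \<alpha> i = \<beta> i) \<Longrightarrow> mon n \<alpha> y = mon n \<beta> y"
  by (simp add: mon_def)

lemma alt_cong:
  assumes "\<And>i. i \<in> {1..n} \<Longrightarrow> \<alpha> i = \<beta> i"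
  shows "alt n \<alpha> y = alt n \<beta> y"
  unfolding alt_def
proof (intro sum.cong refl arg_cong2[of _ _ _ _ "(*)"] mon_cong)
  fix \<pi> i assume "\<pi> \<in> {\<pi>. \<pi> permutes {1..n}}" "i \<in> {1..n}"
  then have "\<pi> i \<in> {1..n}" using permutes_in_image[of \<pi> "{1..n}" i] by simp
  then show "(\<alpha> \<circ> \<pi>) i = (\<beta> \<circ> \<pi>) i" using assms by simp
qed

text \<open>
  Schur functions are reached without dividing alternants: in \<open>alt \<delta> \<cdot> m\<^sub>\<mu> = \<Sum>\<^sub>\<alpha> alt (\<delta> + \<alpha>)\<close> every
  \<open>\<alpha> \<noteq> \<mu>\<close> straightens to a strictly smaller partition, so the relation can be inverted by induction.
\<close>
lemma alt_straighten:
  assumes mu: "\<mu> \<in> par n d" and al: "\<alpha> \<in> orb n \<mu>" "\<alpha> \<noteq> \<mu>"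
  obtains (zero) "\<And>y::nat \<Rightarrow> 'a::field_char_0. alt n (\<lambda>i. stair n i + \<alpha> i) y = 0"
  | (lower) \<nu> s where "\<nu> \<in> par n d" "dom_less n \<nu> \<mu>"
      "\<And>y::nat \<Rightarrow> 'a. alt n (\<lambda>i. stair n i + \<alpha> i) y = of_int s * alt n (\<lambda>i. stair n i + \<nu> i) y"
proof -
  define \<beta> where "\<beta> = (\<lambda>i. stair n i + \<alpha> i)"
  have ae: "\<alpha> \<in> evec n d" using orb_subset_evec par_evec mu al by blast
  show thesis
  proof (cases "inj_on \<beta> {1..n}")
    case False
    then obtain i j where "i \<in> {1..n}" "j \<in> {1..n}" "i \<noteq> j" "\<beta> i = \<beta> j" by (auto simp: inj_on_def)
    then show thesis using zero alt_eq_0[of i n j \<beta>] unfolding \<beta>_def by blast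
  next
    case True
    obtain \<sigma> where s: "\<sigma> permutes {1..n}" and dec: "\<forall>i\<in>{1..<n}. \<beta> (\<sigma> (i + 1)) \<le> \<beta> (\<sigma> i)"
      by (rule ex_sorting_permutation)
    have sin: "\<sigma> i \<in> {1..n} \<longleftrightarrow> i \<in> {1..n}" for i by (rule permutes_in_image[OF s])
    have sdec: "\<beta> (\<sigma> (i + 1)) < \<beta> (\<sigma> i)" if "i \<in> {1..<n}" for i
    proof -
      have "\<sigma> (i + 1) \<noteq> \<sigma> i" using permutes_inj[OF s] by (metis injD add_eq_self_zero one_neq_zero)
      then have "\<beta> (\<sigma> (i + 1)) \<noteq> \<beta> (\<sigma> i)"
        using inj_onD[OF True] sin[of i] sin[of "i + 1"] that by fastforce
      then show ?thesis using dec that by (meson le_neq_implies_less)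
    qed
    have lb: "n - i \<le> \<beta> (\<sigma> i)" if "1 \<le> i" "i \<le> n" for i
      using that(2,1)
    proof (induction i rule: inc_induct)
      case (step i)
      then show ?case using sdec[of i] by fastforce
    qed simp
    \<comment> \<open>The sorted exponents minus the staircase. The subtraction does not truncate,
      by \<open>lb\<close>: a strictly decreasing sequence of natural numbers lies above the
      staircase.\<close>
    define \<nu> where "\<nu> i = (if i \<in> {1..n} then \<beta> (\<sigma> i) - (n - i) else 0)" for i
    have nu: "stair n i + \<nu> i = \<beta> (\<sigma> i)" if "i \<in> {1..n}" for i
      using lb[of i] that by (simp add: \<nu>_def stair_def)
    obtain \<pi> where p: "\<pi> permutes {1..n}" and al_eq: "\<alpha> = \<mu> \<circ> \<pi>" using al by (auto simp: orb_def)
    \<comment> \<open>The two sums on the right are at most the partial sums of the staircase and of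
      \<mu>. This gives dominance; equality throughout would force \<sigma> to be the identity and
      hence \<open>\<alpha> = \<mu>\<close>.\<close>
    have part: "(\<Sum>i = 1..k. stair n i) + (\<Sum>i = 1..k. \<nu> i) =
        (\<Sum>i = 1..k. stair n (\<sigma> i)) + (\<Sum>i = 1..k. \<mu> ((\<pi> \<circ> \<sigma>) i))" if "k \<le> n" for k
    proof -
      have "(\<Sum>i = 1..k. stair n i + \<nu> i) = (\<Sum>i = 1..k. stair n (\<sigma> i) + \<mu> ((\<pi> \<circ> \<sigma>) i))"
        by (rule sum.cong) (use that in \<open>auto simp: nu \<beta>_def al_eq\<close>)
      then show ?thesis by (simp add: sum.distrib)
    qed
    have le1: "(\<Sum>i = 1..k. stair n (\<sigma> i)) \<le> (\<Sum>i = 1..k. stair n i)" if "k \<le> n" for k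
      by (rule sum_permute_le_initial[OF _ s that]) (simp add: stair_def)
    have le2: "(\<Sum>i = 1..k. \<mu> ((\<pi> \<circ> \<sigma>) i)) \<le> (\<Sum>i = 1..k. \<mu> i)" if "k \<le> n" for k
      by (rule sum_permute_le_initial[OF par_antimono[OF mu] permutes_compose[OF s p] that])
    have "(\<Sum>i = 1..n. stair n (\<sigma> i)) = (\<Sum>i = 1..n. stair n i)"
      using sum.permute[OF s, of "stair n"] by (simp add: o_def)
    moreover have "(\<Sum>i = 1..n. \<mu> ((\<pi> \<circ> \<sigma>) i)) = d"
      using evec_compose[OF par_evec[OF mu] permutes_compose[OF s p]] by (simp add: evec_def)
    ultimately have sum_nu: "(\<Sum>i = 1..n. \<nu> i) = d" using part[of n] by simp
    have "\<nu> (i + 1) \<le> \<nu> i" if "i \<in> {1..<n}" for i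
      using sdec[OF that] that nu[of i] nu[of "i + 1"] by (simp add: stair_def)
    then have nupar: "\<nu> \<in> par n d"
      using sum_nu by (auto simp: par_def evec_def \<nu>_def)
    have "\<nu> \<noteq> \<mu>"
    proof
      assume eq: "\<nu> = \<mu>"
      have "(\<Sum>i = 1..k. stair n (\<sigma> i)) = (\<Sum>i = 1..k. stair n i)" if "k \<le> n" for k
        using part[OF that] le1[OF that] le2[OF that] unfolding eq by simp
      then have st: "stair n (\<sigma> i) = stair n i" if "i \<in> {1..n}" for i
        using that by (rule eq_of_partial_sums)
      have "\<sigma> i = i" if "i \<in> {1..n}" for i
        using st[OF that] sin[of i] that by (auto simp: stair_def)
      then have "\<alpha> i = \<mu> i" if "i \<in> {1..n}" for i
        using nu[OF that] that by (simp add: \<beta>_def eq)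
      then show False using evec_eqI[OF ae par_evec[OF mu]] al(2) by blast
    qed
    then have dl: "dom_less n \<nu> \<mu>"
      unfolding dom_less_def using sum_nu mu le1 le2 part
      by (auto simp: par_def evec_def) (smt (verit) add_le_cancel_left add_le_mono le_trans)
    have "alt n \<beta> y = of_int (sign \<sigma>) * alt n (\<lambda>i. stair n i + \<nu> i) y" for y :: "nat \<Rightarrow> 'a"
    proof -
      have "alt n (\<lambda>i. stair n i + \<nu> i) y = alt n (\<beta> \<circ> \<sigma>) y" by (rule alt_cong) (simp add: nu)
      also have "\<dots> = of_int (sign \<sigma>) * alt n \<beta> y" by (rule alt_compose[OF s])
      finally show ?thesis by (simp add: sign_def)
    qed
    then show thesis using lower nupar dl unfolding \<beta>_def by blast
  qed
qed

text \<open>For \<open>\<alpha> = \<mu>\<close> this is the expansion of a Schur function with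
  Kostka numbers as coefficients. The integers k are chosen before the point y, so one family of
  coefficients serves all points.\<close>

lemma alt_expansion:
  assumes "\<mu> \<in> par n d" "\<alpha> \<in> orb n \<mu>"
  shows "\<exists>k :: (nat \<Rightarrow> nat) \<Rightarrow> int. k \<mu> = (if \<alpha> = \<mu> then 1 else 0) \<and>
    (\<forall>\<nu>. k \<nu> \<noteq> 0 \<longrightarrow> \<nu> \<in> par n d \<and> dom_le n \<nu> \<mu>) \<and>
    (\<forall>y :: nat \<Rightarrow> 'a::field_char_0. alt n (\<lambda>i. stair n i + \<alpha> i) y =
       alt n (stair n) y * (\<Sum>\<nu>\<in>par n d. of_int (k \<nu>) * msf n \<nu> y))"
  using assms
proof (induction "height n \<mu>" arbitrary: \<mu> \<alpha> rule: less_induct)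
  case less
  note mu = less.prems(1)
  define good :: "(nat \<Rightarrow> nat) \<Rightarrow> ((nat \<Rightarrow> nat) \<Rightarrow> int) \<Rightarrow> bool" where
    "good \<alpha> k \<longleftrightarrow> (\<forall>\<nu>. k \<nu> \<noteq> 0 \<longrightarrow> \<nu> \<in> par n d \<and> dom_less n \<nu> \<mu>) \<and>
      (\<forall>y :: nat \<Rightarrow> 'a. alt n (\<lambda>i. stair n i + \<alpha> i) y =
         alt n (stair n) y * (\<Sum>\<nu>\<in>par n d. of_int (k \<nu>) * msf n \<nu> y))" for \<alpha> k
  have "\<exists>k. good \<alpha> k" if al: "\<alpha> \<in> orb n \<mu>" "\<alpha> \<noteq> \<mu>" for \<alpha>
  proof (rule alt_straighten[OF mu al, where 'a = 'a])
    assume "\<And>y::nat \<Rightarrow> 'a. alt n (\<lambda>i. stair n i + \<alpha> i) y = 0"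
    then show ?thesis unfolding good_def by (intro exI[of _ "\<lambda>_. 0"]) simp
  next
    fix \<nu> s assume nu: "\<nu> \<in> par n d" "dom_less n \<nu> \<mu>"
      and eq: "\<And>y::nat \<Rightarrow> 'a. alt n (\<lambda>i. stair n i + \<alpha> i) y = of_int s * alt n (\<lambda>i. stair n i + \<nu> i) y"
    have "height n \<nu> < height n \<mu>" using height_less nu par_evec mu by blast
    from less.hyps[OF this nu(1) self_in_orb] obtain k :: "(nat \<Rightarrow> nat) \<Rightarrow> int" where
      k: "\<forall>\<rho>. k \<rho> \<noteq> 0 \<longrightarrow> \<rho> \<in> par n d \<and> dom_le n \<rho> \<nu>"
      and ky: "\<forall>y :: nat \<Rightarrow> 'a. alt n (\<lambda>i. stair n i + \<nu> i) y =
       alt n (stair n) y * (\<Sum>\<rho>\<in>par n d. of_int (k \<rho>) * msf n \<rho> y)" by blast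
    have "good \<alpha> (\<lambda>\<rho>. s * k \<rho>)"
      unfolding good_def
    proof (intro conjI allI impI)
      fix \<rho> assume "s * k \<rho> \<noteq> 0"
      then have "\<rho> \<in> par n d" "dom_le n \<rho> \<nu>" using k by auto
      then show "\<rho> \<in> par n d" "dom_less n \<rho> \<mu>" using dom_le_less_trans nu mu par_evec by blast+
    qed (simp add: eq ky sum_distrib_left mult_ac)
    then show ?thesis by blast
  qed
  then obtain K where K: "good \<alpha> (K \<alpha>)" if "\<alpha> \<in> orb n \<mu>" "\<alpha> \<noteq> \<mu>" for \<alpha> by metis
  show ?case
  proof (cases "\<alpha> = \<mu>")
    case False
    then have g: "good \<alpha> (K \<alpha>)" using K less.prems by blast
    then have "K \<alpha> \<mu> = 0" unfolding good_def using dom_less_irrefl by blast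
    then show ?thesis using g False unfolding good_def dom_le_def by (intro exI[of _ "K \<alpha>"]) auto
  next
    case True
    \<comment> \<open>The relation \<open>alt_mult_msf\<close> with \<beta> the staircase, solved
      for its term \<open>\<alpha> = \<mu>\<close>.\<close>
    define k where "k \<nu> = (if \<nu> = \<mu> then 1 else 0) - (\<Sum>\<alpha>\<in>orb n \<mu> - {\<mu>}. K \<alpha> \<nu>)" for \<nu>
    have kmu: "k \<mu> = 1"
    proof -
      have "K \<alpha> \<mu> = 0" if "\<alpha> \<in> orb n \<mu> - {\<mu>}" for \<alpha>
        using K[of \<alpha>] that dom_less_irrefl unfolding good_def by blast
      then show ?thesis by (simp add: k_def)
    qed
    have ksupp: "\<nu> \<in> par n d \<and> dom_le n \<nu> \<mu>" if "k \<nu> \<noteq> 0" for \<nu>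
    proof (cases "\<nu> = \<mu>")
      case False
      with that have "(\<Sum>\<alpha>\<in>orb n \<mu> - {\<mu>}. K \<alpha> \<nu>) \<noteq> 0" by (simp add: k_def)
      then obtain \<alpha> where "\<alpha> \<in> orb n \<mu> - {\<mu>}" "K \<alpha> \<nu> \<noteq> 0" by (meson sum.not_neutral_contains_not_neutral)
      then show ?thesis using K[of \<alpha>] unfolding good_def dom_le_def by blast
    qed (use mu in \<open>simp add: dom_le_def\<close>)
    have "alt n (\<lambda>i. stair n i + \<mu> i) y =
       alt n (stair n) y * (\<Sum>\<nu>\<in>par n d. of_int (k \<nu>) * msf n \<nu> y)" for y :: "nat \<Rightarrow> 'a"
    proof -
      have "alt n (stair n) y * msf n \<mu> y = alt n (\<lambda>i. stair n i + \<mu> i) y +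
          (\<Sum>\<alpha>\<in>orb n \<mu> - {\<mu>}. alt n (\<lambda>i. stair n i + \<alpha> i) y)"
        unfolding alt_mult_msf by (rule sum.remove) (auto simp: self_in_orb)
      also have "(\<Sum>\<alpha>\<in>orb n \<mu> - {\<mu>}. alt n (\<lambda>i. stair n i + \<alpha> i) y) =
          (\<Sum>\<alpha>\<in>orb n \<mu> - {\<mu>}. alt n (stair n) y * (\<Sum>\<nu>\<in>par n d. of_int (K \<alpha> \<nu>) * msf n \<nu> y))"
        by (rule sum.cong) (use K in \<open>auto simp: good_def\<close>)
      also have "\<dots> = alt n (stair n) y * (\<Sum>\<nu>\<in>par n d. of_int (\<Sum>\<alpha>\<in>orb n \<mu> - {\<mu>}. K \<alpha> \<nu>) * msf n \<nu> y)"
        by (simp add: sum_distrib_left[symmetric] sum_distrib_right sum.swap[of _ _ "par n d"])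
      finally have "alt n (\<lambda>i. stair n i + \<mu> i) y = alt n (stair n) y *
          (msf n \<mu> y - (\<Sum>\<nu>\<in>par n d. of_int (\<Sum>\<alpha>\<in>orb n \<mu> - {\<mu>}. K \<alpha> \<nu>) * msf n \<nu> y))"
        by (simp add: algebra_simps)
      also have "msf n \<mu> y = (\<Sum>\<nu>\<in>par n d. of_int (if \<nu> = \<mu> then 1 else 0) * msf n \<nu> y)"
        using mu by (subst sum.remove[of _ \<mu>]) (auto intro!: sum.neutral)
      finally show ?thesis by (simp add: k_def sum_subtractf left_diff_distrib)
    qed
    with kmu ksupp True show ?thesis by (intro exI[of _ k]) auto
  qed
qed

section \<open>The Macdonald operators on monomial symmetric functions\<close>

lemma poly_eq_smult_prod_roots:
  fixes p :: "'a::idom poly"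
  assumes deg: "degree p \<le> card A" and A: "finite A" and root: "\<And>a. a \<in> A \<Longrightarrow> poly p a = 0"
  shows "p = smult (coeff p (card A)) (\<Prod>a\<in>A. [:- a, 1:])"
proof -
  let ?P = "\<Prod>a\<in>A. [:- a, 1:]" and ?n = "card A"
  let ?r = "p - smult (coeff p ?n) ?P"
  have dP: "degree ?P = ?n" by (simp add: degree_prod_eq_sum_degree)
  have "lead_coeff ?P = 1" by (simp add: lead_coeff_prod)
  then have c: "coeff ?P ?n = 1" by (simp add: dP)
  have "?r = 0"
  proof (rule ccontr)
    assume nz: "?r \<noteq> 0"
    have "A \<subseteq> {x. poly ?r x = 0}" using root A by (auto simp: poly_prod)
    then have "?n \<le> card {x. poly ?r x = 0}" using card_mono poly_roots_finite[OF nz] by blast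
    also have "\<dots> \<le> degree ?r" by (rule card_poly_roots_bound[OF nz])
    finally have "?n \<le> degree ?r" .
    moreover have "degree ?r \<le> ?n"
      using deg dP by (intro degree_diff_le) (auto intro: order_trans[OF degree_smult_le])
    ultimately have "degree ?r = ?n" by simp
    moreover have "coeff ?r ?n = 0" using c by simp
    ultimately have "lead_coeff ?r = 0" by metis
    then show False using nz by (simp only: leading_coeff_0_iff)
  qed
  then show ?thesis by simp
qed

text \<open>Lagrange interpolation of p at the nodes Z, compared in the coefficient of degree
  \<open>card Z - 1\<close>. This replaces the residue theorem in the exchange identities.\<close>

lemma sum_div_prod_diff:
  fixes p :: "'a::field poly"
  assumes Z: "finite Z" and deg: "degree p < card Z"
  shows "(\<Sum>z\<in>Z. poly p z / (\<Prod>w\<in>Z - {z}. z - w)) = coeff p (card Z - 1)"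
proof -
  define L where "L z = (\<Prod>w\<in>Z - {z}. [:- w, 1:])" for z
  define c where "c z = poly p z / (\<Prod>w\<in>Z - {z}. z - w)" for z
  let ?r = "p - (\<Sum>z\<in>Z. smult (c z) (L z))"
  have dL: "degree (L z) = card Z - 1" if "z \<in> Z" for z
    using that Z by (simp add: L_def degree_prod_eq_sum_degree)
  have "lead_coeff (L z) = 1" for z by (simp add: L_def lead_coeff_prod)
  then have cL: "coeff (L z) (card Z - 1) = 1" if "z \<in> Z" for z using dL[OF that] by metis
  have dr: "degree ?r < card Z"
  proof -
    have "degree (\<Sum>z\<in>Z. smult (c z) (L z)) \<le> card Z - 1"
      by (intro degree_sum_le Z order_trans[OF degree_smult_le]) (simp add: dL)
    then have "degree ?r \<le> card Z - 1" using deg by (intro degree_diff_le) auto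
    then show ?thesis using deg by linarith
  qed
  have "?r = 0"
  proof (rule poly_eqI_degree[of Z])
    fix x assume x: "x \<in> Z"
    have "poly (L z) x = 0" if "z \<in> Z" "z \<noteq> x" for z
      using x that Z by (auto simp: L_def poly_prod)
    then have "(\<Sum>z\<in>Z. c z * poly (L z) x) = c x * poly (L x) x"
      using sum.remove[OF Z x, of "\<lambda>z. c z * poly (L z) x"] by (auto simp: sum.neutral)
    moreover have "poly (L x) x = (\<Prod>w\<in>Z - {x}. x - w)" by (simp add: L_def poly_prod)
    moreover have "(\<Prod>w\<in>Z - {x}. x - w) \<noteq> 0" using Z by auto
    ultimately show "poly ?r x = poly 0 x" by (simp add: poly_sum c_def)
  qed (use dr in auto)
  then have "coeff p (card Z - 1) = (\<Sum>z\<in>Z. c z * coeff (L z) (card Z - 1))"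
    by (metis (no_types, lifting) coeff_smult coeff_sum right_minus_eq sum.cong)
  also have "\<dots> = (\<Sum>z\<in>Z. c z)" by (rule sum.cong) (use cL in auto)
  finally show ?thesis by (simp add: c_def)
qed

section \<open>The Vandermonde product and its behaviour under scaling\<close>

definition vand :: "nat \<Rightarrow> (nat \<Rightarrow> 'a::comm_ring_1) \<Rightarrow> 'a" where
  "vand n y = (\<Prod>j = 1..n. \<Prod>i = 1..<j. y j - y i)"

lemma vand_Suc: "vand (Suc n) y = vand n y * (\<Prod>i = 1..n. y (Suc n) - y i)"
  by (simp add: vand_def atLeastLessThanSuc_atLeastAtMost)

lemma mon_Suc: "mon (Suc n) \<alpha> y = mon n \<alpha> y * y (Suc n) ^ \<alpha> (Suc n)"
  by (simp add: mon_def)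

lemma alt_eq_0_arg:
  fixes y :: "nat \<Rightarrow> 'a::field_char_0"
  assumes "i \<in> {1..n}" "j \<in> {1..n}" "i \<noteq> j" "y i = y j"
  shows "alt n \<beta> y = 0"
proof -
  let ?t = "transpose i j"
  have t: "?t permutes {1..n}" by (rule permutes_swap_id[OF assms(1,2)])
  have yt: "y \<circ> ?t = y" using assms by (auto simp: fun_eq_iff transpose_def)
  have "alt n \<beta> y = (\<Sum>\<pi> | \<pi> permutes {1..n}. of_int (sign (\<pi> \<circ> ?t)) * mon n (\<beta> \<circ> (\<pi> \<circ> ?t)) y)"
    unfolding alt_def by (rule sum_permutations_compose_right[OF t])
  also have "\<dots> = (\<Sum>\<pi> | \<pi> permutes {1..n}. - (of_int (sign \<pi>) * mon n (\<beta> \<circ> \<pi>) y))"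
  proof (rule sum.cong)
    fix \<pi> assume "\<pi> \<in> {\<pi>. \<pi> permutes {1..n}}"
    then have "sign (\<pi> \<circ> ?t) = - sign \<pi>"
      using sign_compose_permutes[of "{1..n}" \<pi> ?t] t assms(3) by (simp add: sign_swap_id)
    moreover have "mon n (\<beta> \<circ> (\<pi> \<circ> ?t)) y = mon n (\<beta> \<circ> \<pi>) y"
      using mon_permute[OF t, of "\<beta> \<circ> \<pi>" y] by (simp add: yt o_assoc)
    ultimately show "of_int (sign (\<pi> \<circ> ?t)) * mon n (\<beta> \<circ> (\<pi> \<circ> ?t)) y =
      - (of_int (sign \<pi>) * mon n (\<beta> \<circ> \<pi>) y)" by simp
  qed simp
  also have "\<dots> = - alt n \<beta> y" by (simp add: alt_def sum_negf)
  finally show ?thesis by simp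
qed

text \<open>As a polynomial in the last coordinate the alternant has degree at most n, vanishes at
  the other n coordinates and has the smaller alternant as its coefficient of degree n. If those n
  coordinates are not distinct, both sides are 0. The exponents i - 1, in contrast to the staircase
  n - i, do not change when n grows.\<close>

lemma alt_pred_eq_vand:
  fixes y :: "nat \<Rightarrow> 'a::field_char_0"
  shows "alt n (\<lambda>i. i - 1) y = vand n y"
proof (induction n)
  case 0
  then show ?case by (simp add: alt_def vand_def mon_def)
next
  case (Suc n)
  show ?case
  proof (cases "inj_on y {1..n}")
    case False
    then obtain i j where ij: "i \<in> {1..n}" "j \<in> {1..n}" "i < j" "y i = y j"
      unfolding inj_on_def by (metis nat_neq_iff)
    have "(\<Prod>i = 1..<j. y j - y i) = 0" using ij by (intro prod_zero bexI[of _ i]) auto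
    then have "vand n y = 0" unfolding vand_def using ij(2) by (intro prod_zero) blast+
    moreover have "alt (Suc n) (\<lambda>i. i - 1) y = 0" using ij by (intro alt_eq_0_arg[of i _ j]) auto
    ultimately show ?thesis by (simp add: vand_Suc)
  next
    case True
    let ?P = "{\<pi>. \<pi> permutes {1..Suc n}}"
    let ?e = "\<lambda>i::nat. i - 1"
    define p where "p = (\<Sum>\<pi>\<in>?P. smult (of_int (sign \<pi>) * mon n (?e \<circ> \<pi>) y) (monom 1 (\<pi> (Suc n) - 1)))"
    define A where "A = y ` {1..n}"
    have cA: "card A = n" using card_image[OF True] by (simp add: A_def)
    have pw: "poly p w = alt (Suc n) ?e (y(Suc n := w))" for w
    proof -
      have "mon n \<alpha> (y(Suc n := w)) = mon n \<alpha> y" for \<alpha> by (simp add: mon_def)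
      then show ?thesis by (simp add: p_def alt_def poly_sum mon_Suc poly_monom mult.assoc)
    qed
    have im: "\<pi> (Suc n) \<in> {1..Suc n}" if "\<pi> permutes {1..Suc n}" for \<pi>
      using permutes_in_image[OF that, of "Suc n"] by simp
    have deg: "degree p \<le> card A"
      unfolding p_def cA
    proof (intro degree_sum_le finite_permutations order_trans[OF degree_smult_le])
      fix \<pi> assume "\<pi> \<in> ?P"
      then show "degree (monom (1::'a) (\<pi> (Suc n) - 1)) \<le> n"
        using im[of \<pi>] by (auto intro: order_trans[OF degree_monom_le])
    qed simp
    \<comment> \<open>The power n arises only from permutations that fix the last index, and these
      are the permutations of the first n indices.\<close>
    have co: "coeff p n = alt n ?e y"
    proof -
      have eq: "{\<pi>\<in>?P. \<pi> (Suc n) = Suc n} = {\<pi>. \<pi> permutes {1..n}}"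
      proof (intro equalityI subsetI)
        fix \<pi> assume "\<pi> \<in> {\<pi>\<in>?P. \<pi> (Suc n) = Suc n}"
        then have p: "\<pi> permutes {1..Suc n}" and "\<pi> (Suc n) = Suc n" by auto
        then have "\<pi> x = x" if "x \<in> {1..Suc n} - {1..n}" for x
          using that le_less_Suc_eq[of "Suc n" x] by (cases "x = Suc n") auto
        then have "\<pi> permutes {1..n}" by (rule permutes_superset[OF p])
        then show "\<pi> \<in> {\<pi>. \<pi> permutes {1..n}}" by simp
      next
        fix \<pi> assume "\<pi> \<in> {\<pi>. \<pi> permutes {1..n}}"
        then have p: "\<pi> permutes {1..n}" by simp
        have "\<pi> permutes {1..Suc n}" by (rule permutes_subset[OF p]) auto
        moreover have "\<pi> (Suc n) = Suc n" by (rule permutes_not_in[OF p]) simp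
        ultimately show "\<pi> \<in> {\<pi>\<in>?P. \<pi> (Suc n) = Suc n}" by simp
      qed
      have "coeff p n = (\<Sum>\<pi>\<in>?P. if \<pi> (Suc n) = Suc n then of_int (sign \<pi>) * mon n (?e \<circ> \<pi>) y else 0)"
        unfolding p_def coeff_sum
      proof (rule sum.cong[OF refl])
        fix \<pi> assume "\<pi> \<in> ?P"
        then have "\<pi> (Suc n) - 1 = n \<longleftrightarrow> \<pi> (Suc n) = Suc n" using im[of \<pi>] by auto
        then show "coeff (smult (of_int (sign \<pi>) * mon n (?e \<circ> \<pi>) y) (monom 1 (\<pi> (Suc n) - 1))) n =
          (if \<pi> (Suc n) = Suc n then of_int (sign \<pi>) * mon n (?e \<circ> \<pi>) y else 0)"
          by (simp add: coeff_monom)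
      qed
      also have "\<dots> = (\<Sum>\<pi>\<in>{\<pi>\<in>?P. \<pi> (Suc n) = Suc n}. of_int (sign \<pi>) * mon n (?e \<circ> \<pi>) y)"
        by (rule sum.inter_filter[symmetric]) (simp add: finite_permutations)
      finally show ?thesis by (simp only: eq alt_def)
    qed
    have "p = smult (coeff p (card A)) (\<Prod>a\<in>A. [:- a, 1:])"
    proof (rule poly_eq_smult_prod_roots[OF deg])
      fix a assume "a \<in> A"
      then obtain i where "i \<in> {1..n}" "a = y i" by (auto simp: A_def)
      then show "poly p a = 0" unfolding pw by (intro alt_eq_0_arg[of i _ "Suc n"]) auto
    qed (simp add: A_def)
    then have "poly p (y (Suc n)) = coeff p n * (\<Prod>a\<in>A. y (Suc n) - a)"
      by (metis (no_types, lifting) cA poly_smult poly_prod poly_pCons poly_0 mult_zero_right add_0_right mult_1_right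
          prod.cong uminus_add_conv_diff)
    also have "(\<Prod>a\<in>A. y (Suc n) - a) = (\<Prod>i = 1..n. y (Suc n) - y i)"
      unfolding A_def using prod.reindex[OF True, of "\<lambda>a. y (Suc n) - a"] by (simp add: o_def)
    finally show ?thesis unfolding pw co Suc vand_Suc by simp
  qed
qed

text \<open>The constant c is the sign of the reversal of the indices; what matters later is that it
  is nonzero and the same for all points.\<close>

lemma alt_stair_eq_vand:
  obtains c :: int where "c \<noteq> 0" "\<And>y :: nat \<Rightarrow> 'a::field_char_0. alt n (stair n) y = of_int c * vand n y"
proof -
  define \<rho> where "\<rho> i = (if i \<in> {1..n} then n + 1 - i else i)" for i
  have r: "\<rho> permutes {1..n}"
    by (rule bij_imp_permutes, rule bij_betw_byWitness[of _ \<rho>]) (auto simp: \<rho>_def)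
  have "alt n (stair n) y = of_int (sign \<rho>) * vand n y" for y :: "nat \<Rightarrow> 'a"
  proof -
    have "alt n (stair n) y = alt n ((\<lambda>i. i - 1) \<circ> \<rho>) y"
      by (rule alt_cong) (simp add: stair_def \<rho>_def)
    then show ?thesis by (simp only: alt_compose[OF r] alt_pred_eq_vand)
  qed
  then show thesis by (intro that[of "sign \<rho>"]) (auto simp: sign_def)
qed

lemma vand_nonzero:
  fixes y :: "nat \<Rightarrow> 'a::field"
  assumes "inj_on y {1..n}"
  shows "vand n y \<noteq> 0"
  using assms by (fastforce simp: vand_def inj_on_def)

lemma alt_stair_nonzero:
  fixes y :: "nat \<Rightarrow> 'a::field_char_0"
  assumes "inj_on y {1..n}"
  shows "alt n (stair n) y \<noteq> 0"
  by (rule alt_stair_eq_vand[where 'a = 'a, of n]) (simp add: vand_nonzero[OF assms])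

definition scale :: "'a::times \<Rightarrow> nat set \<Rightarrow> (nat \<Rightarrow> 'a) \<Rightarrow> nat \<Rightarrow> 'a" where
  "scale c I y i = (if i \<in> I then c * y i else y i)"

lemma mon_scale:
  assumes "I \<subseteq> {1..n}"
  shows "mon n \<alpha> (scale c I y) = c ^ sum \<alpha> I * mon n \<alpha> y"
proof -
  have "mon n \<alpha> (scale c I y) = (\<Prod>i = 1..n. (if i \<in> I then c ^ \<alpha> i else 1) * y i ^ \<alpha> i)"
    unfolding mon_def by (rule prod.cong) (auto simp: scale_def power_mult_distrib)
  also have "\<dots> = (\<Prod>i\<in>I. c ^ \<alpha> i) * mon n \<alpha> y"
    using assms by (simp add: mon_def prod.distrib prod.inter_restrict[symmetric] Int_absorb1)
  finally show ?thesis by (simp add: power_sum)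
qed

lemma rearrange:
  fixes a b c e f p q r v :: "'a::comm_ring_1"
  assumes "a * b = e * v * c"
  shows "a * (f * p * q) * (r * b) = (e * f) * (v * (p * r)) * (q * c)"
proof -
  have "a * (f * p * q) * (r * b) = (a * b) * (f * p * q * r)" by (simp only: mult_ac)
  then show ?thesis by (simp only: assms) (simp only: mult_ac)
qed

text \<open>A factor with both indices in I acquires a factor t, one with no index in I is
  unchanged, and a mixed one becomes \<open>t * y i - y j\<close> up to a sign that occurs on both
  sides. The exponent of t counts the pairs inside I. Both sides are multiplied out, because no
  division is available in a commutative ring.\<close>

lemma vand_scale:
  fixes y :: "nat \<Rightarrow> 'a::comm_ring_1"
  assumes "I \<subseteq> {1..n}"
  shows "vand n (scale t I y) * (\<Prod>i\<in>I. \<Prod>j\<in>{1..n} - I. y i - y j) =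
    t ^ (card I * (card I - 1) div 2) * vand n y * (\<Prod>i\<in>I. \<Prod>j\<in>{1..n} - I. t * y i - y j)"
  using assms
proof (induction n arbitrary: I)
  case 0
  then show ?case by (simp add: vand_def)
next
  case (Suc n)
  show ?case
  proof (cases "Suc n \<in> I")
    case True
    define J where "J = I - {Suc n}"
    have J: "J \<subseteq> {1..n}" "finite J" "Suc n \<notin> J" "I = insert (Suc n) J"
      using Suc.prems True finite_subset[OF Suc.prems] by (auto simp: J_def atLeastAtMostSuc_conv)
    have O: "{1..Suc n} - I = {1..n} - J" using J by (auto simp: atLeastAtMostSuc_conv)
    have sc: "scale t I y i = scale t J y i" if "i \<noteq> Suc n" for i using that J by (auto simp: scale_def)
    have v: "vand n (scale t I y) = vand n (scale t J y)"
      unfolding vand_def by (intro prod.cong refl) (auto simp: sc)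
    have sp: "(\<Prod>i = 1..n. g i) = (\<Prod>i\<in>J. g i) * (\<Prod>i\<in>{1..n} - J. g i)" for g :: "nat \<Rightarrow> 'a"
      using prod.subset_diff[OF J(1), of g] by (simp add: mult.commute)
    have "(\<Prod>i = 1..n. scale t I y (Suc n) - scale t I y i) =
        (\<Prod>i\<in>J. t * (y (Suc n) - y i)) * (\<Prod>i\<in>{1..n} - J. t * y (Suc n) - y i)"
      unfolding sp by (intro arg_cong2[of _ _ _ _ "(*)"] prod.cong)
        (use J in \<open>auto simp: scale_def right_diff_distrib\<close>)
    also have "\<dots> = t ^ card J * (\<Prod>i\<in>J. y (Suc n) - y i) * (\<Prod>i\<in>{1..n} - J. t * y (Suc n) - y i)"
      by (simp add: prod.distrib)
    finally have V: "vand (Suc n) (scale t I y) = vand n (scale t J y) *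
        (t ^ card J * (\<Prod>i\<in>J. y (Suc n) - y i) * (\<Prod>i\<in>{1..n} - J. t * y (Suc n) - y i))"
      by (simp add: vand_Suc v)
    have e: "card I * (card I - 1) div 2 = card J * (card J - 1) div 2 + card J"
      using J by (cases "card J") (auto simp: algebra_simps)
    have W: "vand (Suc n) y = vand n y * ((\<Prod>i\<in>J. y (Suc n) - y i) * (\<Prod>i\<in>{1..n} - J. y (Suc n) - y i))"
      by (simp only: vand_Suc sp)
    have P: "(\<Prod>i\<in>I. \<Prod>j\<in>{1..Suc n} - I. g i j) = (\<Prod>j\<in>{1..n} - J. g (Suc n) j) * (\<Prod>i\<in>J. \<Prod>j\<in>{1..n} - J. g i j)"
      for g :: "nat \<Rightarrow> nat \<Rightarrow> 'a" unfolding O using J by simp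
    show ?thesis
      unfolding V W P e power_add by (rule rearrange[OF Suc.IH[OF J(1)]])
  next
    case False
    then have I: "I \<subseteq> {1..n}" "finite I" using Suc.prems finite_subset[OF Suc.prems] by (auto simp: atLeastAtMostSuc_conv)
    have O: "{1..Suc n} - I = insert (Suc n) ({1..n} - I)" using I by (auto simp: atLeastAtMostSuc_conv)
    have sp: "(\<Prod>i = 1..n. g i) = (\<Prod>i\<in>I. g i) * (\<Prod>i\<in>{1..n} - I. g i)" for g :: "nat \<Rightarrow> 'a"
      using prod.subset_diff[OF I(1), of g] by (simp add: mult.commute)
    have "(\<Prod>i = 1..n. scale t I y (Suc n) - scale t I y i) =
        (\<Prod>i\<in>I. - (t * y i - y (Suc n))) * (\<Prod>i\<in>{1..n} - I. y (Suc n) - y i)"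
      unfolding sp by (intro arg_cong2[of _ _ _ _ "(*)"] prod.cong) (use False in \<open>auto simp: scale_def\<close>)
    then have V: "vand (Suc n) (scale t I y) = vand n (scale t I y) *
        ((\<Prod>i\<in>I. - (t * y i - y (Suc n))) * (\<Prod>i\<in>{1..n} - I. y (Suc n) - y i))"
      by (simp add: vand_Suc)
    have W: "vand (Suc n) y = vand n y * ((\<Prod>i\<in>I. - (y i - y (Suc n))) * (\<Prod>i\<in>{1..n} - I. y (Suc n) - y i))"
      by (simp only: vand_Suc sp minus_diff_eq)
    have P: "(\<Prod>i\<in>I. \<Prod>j\<in>{1..Suc n} - I. g i j) = (\<Prod>i\<in>I. g i (Suc n)) * (\<Prod>i\<in>I. \<Prod>j\<in>{1..n} - I. g i j)"
      for g :: "nat \<Rightarrow> nat \<Rightarrow> 'a" unfolding O by (simp add: prod.distrib)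
    have m: "(\<Prod>i\<in>I. - g i) = (- 1) ^ card I * (\<Prod>i\<in>I. g i)" for g :: "nat \<Rightarrow> 'a"
      by (rule prod_uminus)
    show ?thesis
      unfolding V W P m
      using rearrange[OF Suc.IH[OF I(1)], of "(- 1) ^ card I"
          "(\<Prod>i\<in>I. t * y i - y (Suc n)) * (\<Prod>i\<in>{1..n} - I. y (Suc n) - y i)" 1
          "\<Prod>i\<in>I. y i - y (Suc n)"] by (simp only: mult_ac mult_1_right mult_1_left)
  qed
qed


section \<open>The operators without their leading power of t\<close>

definition choose_two :: "nat \<Rightarrow> nat" where
  "choose_two r = r * (r - 1) div 2"

lemma choose_two_Suc: "choose_two (Suc r) = choose_two r + r"
  by (cases r) (auto simp: choose_two_def algebra_simps)

lemma choose_two_le_sum: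
  assumes "finite A"
  shows "choose_two (card A) \<le> \<Sum>A"
  using assms
proof (induction A rule: finite_linorder_max_induct)
  case (insert b A)
  have "A \<subseteq> {..<b}" using insert by auto
  then have "card A \<le> b" using card_mono[of "{..<b}" A] by simp
  moreover have "b \<notin> A" using insert by auto
  ultimately show ?case using insert by (simp add: choose_two_Suc)
qed (simp add: choose_two_def)

text \<open>The staircase is injective on S, so its values there are \<open>card S\<close> distinct
  natural numbers, whose sum is at least 0 + 1 + ... + (card S - 1).\<close>

lemma choose_two_le_sum_stair:
  assumes "S \<subseteq> {1..n}"
  shows "choose_two (card S) \<le> sum (stair n) S"
proof -
  have inj: "inj_on (stair n) S" using assms by (auto simp: inj_on_def stair_def subset_iff) (metis diff_diff_cancel)
  have "choose_two (card (stair n ` S)) \<le> \<Sum>(stair n ` S)"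
    using assms by (intro choose_two_le_sum) (auto intro: finite_subset)
  then show ?thesis by (simp add: card_image[OF inj] sum.reindex[OF inj])
qed

definition rsets :: "nat \<Rightarrow> nat \<Rightarrow> nat set set" where
  "rsets n r = {I. I \<subseteq> {1..n} \<and> card I = r}"

text \<open>
  \<open>mac_op\<close> is \<open>H\<^sub>r\<close> without its factor \<open>t\<close> to the power \<open>choose_two r\<close>, acting on functions of a point, so
  that \<open>t = 0\<close> is allowed; \<open>eig\<close> is its eigenvalue, where the subtraction in the exponent does not
  truncate by \<open>choose_two_le_sum_stair\<close>.
\<close>
definition mac_coeff :: "nat \<Rightarrow> 'a::field \<Rightarrow> nat set \<Rightarrow> (nat \<Rightarrow> 'a) \<Rightarrow> 'a" where
  "mac_coeff n t I y = (\<Prod>i\<in>I. \<Prod>j\<in>{1..n} - I. (t * y i - y j) / (y i - y j))"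

definition mac_op :: "nat \<Rightarrow> nat \<Rightarrow> 'a::field \<Rightarrow> 'a \<Rightarrow> ((nat \<Rightarrow> 'a) \<Rightarrow> 'a) \<Rightarrow> (nat \<Rightarrow> 'a) \<Rightarrow> 'a" where
  "mac_op n r q t f y = (\<Sum>I\<in>rsets n r. mac_coeff n t I y * f (scale q I y))"

definition eig :: "nat \<Rightarrow> nat \<Rightarrow> 'a::comm_ring_1 \<Rightarrow> 'a \<Rightarrow> (nat \<Rightarrow> nat) \<Rightarrow> 'a" where
  "eig n r q t \<alpha> = (\<Sum>S\<in>rsets n r. q ^ sum \<alpha> S * t ^ (sum (stair n) S - choose_two r))"

lemma finite_rsets [simp]: "finite (rsets n r)"
  by (rule finite_subset[of _ "Pow {1..n}"]) (auto simp: rsets_def)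

text \<open>
  For \<open>t \<noteq> 0\<close> both sides are the alternant of the staircase at the point with \<open>x\<^sub>i\<close> scaled by \<open>t\<close> for
  \<open>i \<in> I\<close>. As polynomials in \<open>t\<close> they then agree at \<open>t = 0\<close> as well.
\<close>
lemma alt_stair_mult_mac_coeff:
  fixes y :: "nat \<Rightarrow> 'a::field_char_0"
  assumes inj: "inj_on y {1..n}" and I: "I \<subseteq> {1..n}"
  shows "alt n (stair n) y * mac_coeff n t I y =
    (\<Sum>\<pi> | \<pi> permutes {1..n}. of_int (sign \<pi>) * mon n (stair n \<circ> \<pi>) y *
       t ^ (sum (stair n \<circ> \<pi>) I - choose_two (card I)))"
proof -
  let ?N = "choose_two (card I)"
  let ?D = "\<Prod>i\<in>I. \<Prod>j\<in>{1..n} - I. y i - y j"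
  have finI: "finite I" using I finite_subset by blast
  have D: "?D \<noteq> 0" using inj I finI by (fastforce simp: inj_on_def)
  define P where "P = smult (alt n (stair n) y / ?D) (\<Prod>i\<in>I. \<Prod>j\<in>{1..n} - I. [:- y j, y i:])"
  define Q where "Q = (\<Sum>\<pi> | \<pi> permutes {1..n}.
    smult (of_int (sign \<pi>) * mon n (stair n \<circ> \<pi>) y) (monom 1 (sum (stair n \<circ> \<pi>) I - ?N)))"
  have le: "?N \<le> sum (stair n \<circ> \<pi>) I" if "\<pi> permutes {1..n}" for \<pi>
  proof -
    have injp: "inj_on \<pi> I" using that by (meson inj_on_subset permutes_inj subset_UNIV)
    have "\<pi> ` I \<subseteq> {1..n}" using I permutes_image[OF that] by (metis image_mono)
    from choose_two_le_sum_stair[OF this] show ?thesis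
      by (simp add: card_image[OF injp] sum.reindex[OF injp])
  qed
  have PP: "poly P s = alt n (stair n) y / ?D * (\<Prod>i\<in>I. \<Prod>j\<in>{1..n} - I. s * y i - y j)" for s
    by (simp add: P_def poly_prod)
  \<comment> \<open>The factor t to the power N is needed to reach the alternant at the scaled
    point. It is cancelled between polynomials, not between values, and so it does no harm at t =
    0.\<close>
  have "monom 1 ?N * P = monom 1 ?N * Q"
  proof (rule poly_eq_poly_eq_iff[THEN iffD1], rule ext)
    fix s
    obtain c :: int where c: "\<And>y :: nat \<Rightarrow> 'a. alt n (stair n) y = of_int c * vand n y"
      using alt_stair_eq_vand[where 'a = 'a] by metis
    have "poly (monom 1 ?N * P) s = s ^ ?N * (alt n (stair n) y / ?D) * (\<Prod>i\<in>I. \<Prod>j\<in>{1..n} - I. s * y i - y j)"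
      by (simp add: PP poly_monom)
    also have "\<dots> = of_int c * (s ^ ?N * vand n y * (\<Prod>i\<in>I. \<Prod>j\<in>{1..n} - I. s * y i - y j)) / ?D"
      by (simp add: c)
    also have "\<dots> = alt n (stair n) (scale s I y)"
      using D by (simp only: choose_two_def vand_scale[OF I, symmetric] c) simp
    also have "\<dots> = (\<Sum>\<pi> | \<pi> permutes {1..n}. s ^ ?N * (of_int (sign \<pi>) * mon n (stair n \<circ> \<pi>) y *
       s ^ (sum (stair n \<circ> \<pi>) I - ?N)))"
      unfolding alt_def
    proof (rule sum.cong)
      fix \<pi> assume "\<pi> \<in> {\<pi>. \<pi> permutes {1..n}}"
      then have "s ^ sum (stair n \<circ> \<pi>) I = s ^ ?N * s ^ (sum (stair n \<circ> \<pi>) I - ?N)"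
        using le by (simp add: power_add[symmetric])
      then show "of_int (sign \<pi>) * mon n (stair n \<circ> \<pi>) (scale s I y) =
        s ^ ?N * (of_int (sign \<pi>) * mon n (stair n \<circ> \<pi>) y * s ^ (sum (stair n \<circ> \<pi>) I - ?N))"
        by (simp add: mon_scale[OF I])
    qed simp
    also have "\<dots> = poly (monom 1 ?N * Q) s"
      by (simp add: Q_def poly_monom poly_sum sum_distrib_left mult_ac)
    finally show "poly (monom 1 ?N * P) s = poly (monom 1 ?N * Q) s" .
  qed
  then have "P = Q" by (simp add: mult_cancel_left monom_eq_0_iff)
  then have "poly P t = poly Q t" by simp
  moreover have "poly P t = alt n (stair n) y * mac_coeff n t I y"
    by (simp add: PP mac_coeff_def prod_dividef)
  ultimately show ?thesis by (simp add: Q_def poly_sum poly_monom)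
qed

lemma sum_rsets_permute:
  assumes p: "\<pi> permutes {1..n}"
  shows "(\<Sum>I\<in>rsets n r. g (\<pi> ` I)) = (\<Sum>S\<in>rsets n r. g S)"
proof (rule sum.reindex_bij_witness[of _ "\<lambda>S. inv \<pi> ` S" "\<lambda>I. \<pi> ` I"])
  have img: "\<rho> ` I \<in> rsets n r" if "\<rho> permutes {1..n}" "I \<in> rsets n r" for \<rho> I
  proof -
    have "inj_on \<rho> I" using that(1) by (meson inj_on_subset permutes_inj subset_UNIV)
    from card_image[OF this] have "card (\<rho> ` I) = r" using that(2) by (simp add: rsets_def)
    moreover have "\<rho> ` I \<subseteq> {1..n}" using that(2) permutes_image[OF that(1)] image_mono[of I "{1..n}" \<rho>] by (simp add: rsets_def)
    ultimately show ?thesis by (simp add: rsets_def)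
  qed
  fix I assume "I \<in> rsets n r"
  then show "\<pi> ` I \<in> rsets n r" "inv \<pi> ` I \<in> rsets n r" using img p permutes_inv by blast+
qed (use p in \<open>auto simp: image_image permutes_inverses\<close>)

lemma mon_orb_reindex:
  assumes "\<pi> permutes {1..n}"
  shows "(\<Sum>\<alpha>\<in>orb n \<mu>. g (\<alpha> \<circ> \<pi>)) = (\<Sum>\<alpha>\<in>orb n \<mu>. g \<alpha>)"
proof (rule sum.reindex_bij_witness[of _ "\<lambda>\<alpha>. \<alpha> \<circ> inv \<pi>" "\<lambda>\<alpha>. \<alpha> \<circ> \<pi>"])
  fix \<alpha> assume "\<alpha> \<in> orb n \<mu>"
  then show "\<alpha> \<circ> inv \<pi> \<in> orb n \<mu>" "\<alpha> \<circ> \<pi> \<in> orb n \<mu>"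
    using assms by (auto simp: orb_def o_assoc[symmetric] intro!: imageI permutes_compose permutes_inv)
qed (use assms in \<open>auto simp: o_assoc[symmetric] permutes_inv_o\<close>)

text \<open>The orbit and the family of index sets are both stable under relabelling. In the term of
  the alternant with permutation \<pi>, relabelling \<alpha> by \<pi> makes the powers of q and t
  depend on I only through its image under \<pi>. The sum over I then yields \<open>eig\<close> for
  each \<pi> alike, and the alternants reassemble.\<close>

lemma alt_stair_mult_mac_op_msf:
  fixes y :: "nat \<Rightarrow> 'a::field_char_0"
  assumes inj: "inj_on y {1..n}"
  shows "alt n (stair n) y * mac_op n r q t (msf n \<mu>) y =
    (\<Sum>\<alpha>\<in>orb n \<mu>. eig n r q t \<alpha> * alt n (\<lambda>i. stair n i + \<alpha> i) y)"
proof -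
  let ?P = "{\<pi>. \<pi> permutes {1..n}}"
  let ?c = "\<lambda>S. t ^ (sum (stair n) S - choose_two r)"
  have "alt n (stair n) y * mac_op n r q t (msf n \<mu>) y =
      (\<Sum>I\<in>rsets n r. (alt n (stair n) y * mac_coeff n t I y) * (\<Sum>\<alpha>\<in>orb n \<mu>. q ^ sum \<alpha> I * mon n \<alpha> y))"
    unfolding mac_op_def sum_distrib_left msf_def by (rule sum.cong) (auto simp: rsets_def mon_scale mult_ac)
  also have "\<dots> = (\<Sum>I\<in>rsets n r. \<Sum>\<pi>\<in>?P. of_int (sign \<pi>) * mon n (stair n \<circ> \<pi>) y * ?c (\<pi> ` I) *
      (\<Sum>\<alpha>\<in>orb n \<mu>. q ^ sum \<alpha> (\<pi> ` I) * mon n (\<alpha> \<circ> \<pi>) y))"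
  proof (rule sum.cong[OF refl])
    fix I assume I: "I \<in> rsets n r"
    have injp: "inj_on \<pi> I" if "\<pi> permutes {1..n}" for \<pi>
      using that by (meson inj_on_subset permutes_inj subset_UNIV)
    have "(\<Sum>\<alpha>\<in>orb n \<mu>. q ^ sum \<alpha> (\<pi> ` I) * mon n (\<alpha> \<circ> \<pi>) y) = (\<Sum>\<alpha>\<in>orb n \<mu>. q ^ sum \<alpha> I * mon n \<alpha> y)"
      if p: "\<pi> permutes {1..n}" for \<pi>
      using mon_orb_reindex[OF p, of "\<lambda>\<alpha>. q ^ sum \<alpha> I * mon n \<alpha> y" \<mu>]
      by (simp add: sum.reindex[OF injp[OF p]] o_def)
    moreover have "sum (stair n \<circ> \<pi>) I = sum (stair n) (\<pi> ` I)" if p: "\<pi> permutes {1..n}" for \<pi>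
      by (simp add: sum.reindex[OF injp[OF p]])
    ultimately show "(alt n (stair n) y * mac_coeff n t I y) * (\<Sum>\<alpha>\<in>orb n \<mu>. q ^ sum \<alpha> I * mon n \<alpha> y) =
      (\<Sum>\<pi>\<in>?P. of_int (sign \<pi>) * mon n (stair n \<circ> \<pi>) y * ?c (\<pi> ` I) *
        (\<Sum>\<alpha>\<in>orb n \<mu>. q ^ sum \<alpha> (\<pi> ` I) * mon n (\<alpha> \<circ> \<pi>) y))"
      using I unfolding rsets_def by (simp add: alt_stair_mult_mac_coeff[OF inj] sum_distrib_right)
  qed
  also have "\<dots> = (\<Sum>\<pi>\<in>?P. of_int (sign \<pi>) * mon n (stair n \<circ> \<pi>) y * (\<Sum>I\<in>rsets n r. ?c (\<pi> ` I) *
      (\<Sum>\<alpha>\<in>orb n \<mu>. q ^ sum \<alpha> (\<pi> ` I) * mon n (\<alpha> \<circ> \<pi>) y)))"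
    by (subst sum.swap) (simp add: sum_distrib_left mult.assoc)
  also have "\<dots> = (\<Sum>\<pi>\<in>?P. of_int (sign \<pi>) * mon n (stair n \<circ> \<pi>) y * (\<Sum>S\<in>rsets n r. ?c S *
      (\<Sum>\<alpha>\<in>orb n \<mu>. q ^ sum \<alpha> S * mon n (\<alpha> \<circ> \<pi>) y)))"
  proof (rule sum.cong[OF refl])
    fix \<pi> assume "\<pi> \<in> ?P"
    then have "\<pi> permutes {1..n}" by simp
    from sum_rsets_permute[OF this, of "\<lambda>S. ?c S * (\<Sum>\<alpha>\<in>orb n \<mu>. q ^ sum \<alpha> S * mon n (\<alpha> \<circ> \<pi>) y)"]
    show "of_int (sign \<pi>) * mon n (stair n \<circ> \<pi>) y * (\<Sum>I\<in>rsets n r. ?c (\<pi> ` I) *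
      (\<Sum>\<alpha>\<in>orb n \<mu>. q ^ sum \<alpha> (\<pi> ` I) * mon n (\<alpha> \<circ> \<pi>) y)) =
      of_int (sign \<pi>) * mon n (stair n \<circ> \<pi>) y * (\<Sum>S\<in>rsets n r. ?c S *
      (\<Sum>\<alpha>\<in>orb n \<mu>. q ^ sum \<alpha> S * mon n (\<alpha> \<circ> \<pi>) y))" by simp
  qed
  also have "\<dots> = (\<Sum>\<pi>\<in>?P. \<Sum>\<alpha>\<in>orb n \<mu>. eig n r q t \<alpha> *
      (of_int (sign \<pi>) * mon n ((\<lambda>i. stair n i + \<alpha> i) \<circ> \<pi>) y))"
  proof (rule sum.cong[OF refl])
    fix \<pi> assume "\<pi> \<in> ?P"
    have "(\<Sum>S\<in>rsets n r. ?c S * (\<Sum>\<alpha>\<in>orb n \<mu>. q ^ sum \<alpha> S * mon n (\<alpha> \<circ> \<pi>) y)) =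
        (\<Sum>\<alpha>\<in>orb n \<mu>. eig n r q t \<alpha> * mon n (\<alpha> \<circ> \<pi>) y)"
      unfolding eig_def sum_distrib_left sum_distrib_right
      by (subst sum.swap) (simp add: mult_ac)
    then show "of_int (sign \<pi>) * mon n (stair n \<circ> \<pi>) y * (\<Sum>S\<in>rsets n r. ?c S *
      (\<Sum>\<alpha>\<in>orb n \<mu>. q ^ sum \<alpha> S * mon n (\<alpha> \<circ> \<pi>) y)) = (\<Sum>\<alpha>\<in>orb n \<mu>. eig n r q t \<alpha> *
      (of_int (sign \<pi>) * mon n ((\<lambda>i. stair n i + \<alpha> i) \<circ> \<pi>) y))"
      by (simp add: sum_distrib_left o_def mon_mult[symmetric] mult_ac)
  qed
  also have "\<dots> = (\<Sum>\<alpha>\<in>orb n \<mu>. eig n r q t \<alpha> * alt n (\<lambda>i. stair n i + \<alpha> i) y)"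
    unfolding alt_def by (subst sum.swap) (simp add: sum_distrib_left)
  finally show ?thesis .
qed

section \<open>Exchange identities\<close>

lemma coeff_mult_top:
  assumes "degree a \<le> m" "degree b \<le> n"
  shows "coeff (a * b) (m + n) = coeff a m * coeff b n"
proof (cases "degree a = m \<and> degree b = n")
  case True
  then show ?thesis using coeff_mult_degree_sum by blast
next
  case False
  then have "degree a < m \<or> degree b < n" using assms by auto
  moreover from this have "degree (a * b) < m + n"
    using degree_mult_le[of a b] assms by linarith
  ultimately show ?thesis by (auto simp: coeff_eq_0)
qed

text \<open>This is \<open>sum_div_prod_diff\<close> for the 2 card K + 1 nodes 0,
  \<open>y i\<close> and \<open>y i / q\<close>; the hypotheses on y and q make these nodes
  distinct. Node 0 stands for the pole of dw / w.\<close>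

lemma partial_fraction_identity:
  fixes y :: "nat \<Rightarrow> 'a::field"
  assumes K: "finite K" and inj: "inj_on y K" and q: "q \<noteq> 0" "q \<noteq> 1"
    and y0: "\<And>i. i \<in> K \<Longrightarrow> y i \<noteq> 0"
    and yq: "\<And>i k. i \<in> K \<Longrightarrow> k \<in> K \<Longrightarrow> i \<noteq> k \<Longrightarrow> y i \<noteq> q * y k"
    and deg: "degree p \<le> 2 * card K"
  shows "poly p 0 / (\<Prod>k\<in>K. y k * (y k / q)) +
    ((\<Sum>i\<in>K. poly p (y i) / (y i * (y i - y i / q) * (\<Prod>k\<in>K - {i}. (y i - y k) * (y i - y k / q)))) +
     (\<Sum>i\<in>K. poly p (y i / q) / (y i / q * (y i / q - y i) *
        (\<Prod>k\<in>K - {i}. (y i / q - y k) * (y i / q - y k / q))))) = coeff p (2 * card K)"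
proof -
  define z where "z i = y i / q" for i
  have injz: "inj_on z K" using inj q by (auto simp: inj_on_def z_def)
  let ?A = "y ` K" and ?B = "z ` K"
  have ne: "y i \<noteq> z k" if "i \<in> K" "k \<in> K" for i k
  proof (cases "i = k")
    case True
    then show ?thesis using y0[OF that(1)] q by (simp add: z_def field_simps)
  next
    case False
    then show ?thesis using yq[OF that(2,1)] q by (auto simp: z_def field_simps)
  qed
  have z0: "z i \<noteq> 0" if "i \<in> K" for i using y0[OF that] q by (simp add: z_def)
  have AB: "?A \<inter> ?B = {}" using ne by auto
  have no0: "0 \<notin> ?A \<union> ?B" using y0 z0 by auto
  let ?Z = "insert 0 (?A \<union> ?B)"
  have cZ: "card ?Z = 2 * card K + 1"
    using K no0 AB by (simp add: card_Un_disjoint card_image inj injz)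
  have rem: "Z - {z} = W" if "Z = insert z W" "z \<notin> W" for Z W :: "'a set" and z using that by auto
  have reA: "(\<Prod>w\<in>y ` J. g w) = (\<Prod>k\<in>J. g (y k))" if "J \<subseteq> K" for J and g :: "'a \<Rightarrow> 'a"
    using prod.reindex[OF inj_on_subset[OF inj that], of g] by simp
  have reB: "(\<Prod>w\<in>z ` J. g w) = (\<Prod>k\<in>J. g (z k))" if "J \<subseteq> K" for J and g :: "'a \<Rightarrow> 'a"
    using prod.reindex[OF inj_on_subset[OF injz that], of g] by simp
  have P0: "(\<Prod>w\<in>?Z - {0}. 0 - w) = (\<Prod>k\<in>K. y k * z k)"
  proof -
    have "?Z - {0} = ?A \<union> ?B" using no0 by auto
    then have "(\<Prod>w\<in>?Z - {0}. 0 - w) = (\<Prod>k\<in>K. - y k) * (\<Prod>k\<in>K. - z k)"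
      using K AB by (simp add: prod.union_disjoint reA reB)
    then show ?thesis by (simp add: prod.distrib[symmetric])
  qed
  have PA: "(\<Prod>w\<in>?Z - {y i}. y i - w) = y i * (y i - z i) * (\<Prod>k\<in>K - {i}. (y i - y k) * (y i - z k))"
    if i: "i \<in> K" for i
  proof -
    have "?Z - {y i} = insert 0 (y ` (K - {i}) \<union> ?B)"
      using i y0[OF i] ne[OF i] inj by (auto simp: inj_on_def)
    moreover have "0 \<notin> y ` (K - {i}) \<union> ?B" "y ` (K - {i}) \<inter> ?B = {}" using no0 AB by auto
    ultimately have "(\<Prod>w\<in>?Z - {y i}. y i - w) = y i * ((\<Prod>k\<in>K - {i}. y i - y k) * (\<Prod>k\<in>K. y i - z k))"
      using K by (simp add: prod.union_disjoint reA reB)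
    also have "(\<Prod>k\<in>K. y i - z k) = (y i - z i) * (\<Prod>k\<in>K - {i}. y i - z k)" by (rule prod.remove[OF K i])
    finally show ?thesis by (simp add: prod.distrib mult_ac)
  qed
  have PB: "(\<Prod>w\<in>?Z - {z i}. z i - w) = z i * (z i - y i) * (\<Prod>k\<in>K - {i}. (z i - y k) * (z i - z k))"
    if i: "i \<in> K" for i
  proof -
    have "?Z - {z i} = insert 0 (?A \<union> z ` (K - {i}))"
      using i z0[OF i] ne[OF _ i] ne[OF _ i, symmetric] injz by (auto simp: inj_on_def)
    moreover have "0 \<notin> ?A \<union> z ` (K - {i})" "?A \<inter> z ` (K - {i}) = {}" using no0 AB by auto
    ultimately have "(\<Prod>w\<in>?Z - {z i}. z i - w) = z i * ((\<Prod>k\<in>K. z i - y k) * (\<Prod>k\<in>K - {i}. z i - z k))"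
      using K by (simp add: prod.union_disjoint reA reB)
    also have "(\<Prod>k\<in>K. z i - y k) = (z i - y i) * (\<Prod>k\<in>K - {i}. z i - y k)" by (rule prod.remove[OF K i])
    finally show ?thesis by (simp add: prod.distrib mult_ac)
  qed
  let ?f = "\<lambda>z. poly p z / (\<Prod>w\<in>?Z - {z}. z - w)"
  have "coeff p (2 * card K) = (\<Sum>z\<in>?Z. ?f z)"
    using sum_div_prod_diff[of ?Z p] deg K cZ by simp
  also have "\<dots> = ?f 0 + ((\<Sum>w\<in>?A. ?f w) + (\<Sum>w\<in>?B. ?f w))"
    using K no0 AB by (simp add: sum.union_disjoint)
  also have "(\<Sum>w\<in>?A. ?f w) = (\<Sum>i\<in>K. ?f (y i))" using sum.reindex[OF inj, of ?f] by simp
  also have "(\<Sum>w\<in>?B. ?f w) = (\<Sum>i\<in>K. ?f (z i))" using sum.reindex[OF injz, of ?f] by simp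
  finally show ?thesis unfolding P0 using PA PB by (simp add: z_def)
qed

definition cfac :: "'a::field \<Rightarrow> 'a \<Rightarrow> 'a \<Rightarrow> 'a" where
  "cfac t a b = (t * a - b) / (a - b)"

lemma cfac_scale: "q \<noteq> 0 \<Longrightarrow> cfac t (q * a) (q * b) = cfac t a b"
proof -
  assume "q \<noteq> 0"
  moreover have "cfac t (q * a) (q * b) = (q * (t * a - b)) / (q * (a - b))"
    by (simp add: cfac_def algebra_simps)
  ultimately show ?thesis by (simp add: cfac_def)
qed

text \<open>
  The two sums are, up to sign and a common factor, the residues at \<open>w = y\<^sub>i / q\<close> and at \<open>w = y\<^sub>i\<close> of
  \<open>\<Prod>\<^sub>k (t w - y\<^sub>k) (t y\<^sub>k - q w) / ((w - y\<^sub>k) (y\<^sub>k - q w))\<close> with respect to \<open>dw / w\<close>; the residues at \<open>0\<close> and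
  \<open>\<infinity>\<close> cancel.
\<close>
lemma exchange_identity:
  fixes y :: "nat \<Rightarrow> 'a::field"
  assumes K: "finite K" and inj: "inj_on y K" and q: "q \<noteq> 0" "q \<noteq> 1"
    and y0: "\<And>i. i \<in> K \<Longrightarrow> y i \<noteq> 0"
    and yq: "\<And>i k. i \<in> K \<Longrightarrow> k \<in> K \<Longrightarrow> i \<noteq> k \<Longrightarrow> y i \<noteq> q * y k"
    and t: "t \<noteq> 1" "t \<noteq> q"
  shows "(\<Sum>i\<in>K. \<Prod>k\<in>K - {i}. cfac t (y k) (y i) * cfac t (y i) (q * y k)) =
    (\<Sum>i\<in>K. \<Prod>k\<in>K - {i}. cfac t (y i) (y k) * cfac t (y k) (q * y i))"
proof -
  let ?m = "card K"
  define p where "p = (\<Prod>k\<in>K. [:- y k, t:] * [:t * y k, - q:])"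
  \<comment> \<open>The factor k = i of the term at node \<open>y i\<close>; the corresponding
    factor at \<open>y i / q\<close> is -C. It is nonzero because t differs from 1 and q, so that it
    can be cancelled at the end.\<close>
  define C where "C = q * (t - 1) * (t - q) / (q - 1)"
  have C: "C \<noteq> 0" using q t by (simp add: C_def)
  have pw: "poly p w = (\<Prod>k\<in>K. (t * w - y k) * (t * y k - q * w))" for w
    unfolding p_def poly_prod by (rule prod.cong) (auto simp: algebra_simps)
  have d2: "degree ([:- y k, t:] * [:t * y k, - q:]) \<le> 2" for k
    by (rule order_trans[OF degree_mult_le]) (simp add: degree_pCons_le)
  have c2: "coeff ([:- y k, t:] * [:t * y k, - q:]) 2 = - (t * q)" for k
    by (simp add: numeral_2_eq_2)
  have "degree p \<le> 2 * ?m \<and> coeff p (2 * ?m) = (- (t * q)) ^ ?m"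
    unfolding p_def using K
  proof (induction K rule: finite_induct)
    case (insert k K)
    let ?a = "[:- y k, t:] * [:t * y k, - q:]" and ?b = "\<Prod>k\<in>K. [:- y k, t:] * [:t * y k, - q:]"
    have "degree (?a * ?b) \<le> 2 + 2 * card K"
      using insert d2[of k] by (intro order_trans[OF degree_mult_le] add_mono) auto
    moreover have "coeff (?a * ?b) (2 + 2 * card K) = coeff ?a 2 * coeff ?b (2 * card K)"
      using insert d2[of k] by (intro coeff_mult_top) auto
    ultimately show ?case using insert c2[of k] by (simp del: mult_pCons_left mult_pCons_right)
  qed simp
  then have deg: "degree p \<le> 2 * ?m" and co: "coeff p (2 * ?m) = (- (t * q)) ^ ?m" by auto
  have p0: "poly p 0 / (\<Prod>k\<in>K. y k * (y k / q)) = (- (t * q)) ^ ?m"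
  proof -
    have "poly p 0 / (\<Prod>k\<in>K. y k * (y k / q)) = (\<Prod>k\<in>K. (- y k * (t * y k)) / (y k * (y k / q)))"
      unfolding pw prod_dividef[symmetric] by (rule prod.cong) auto
    also have "\<dots> = (\<Prod>k\<in>K. - (t * q))" by (rule prod.cong) (use y0 q in \<open>auto simp: field_simps\<close>)
    finally show ?thesis by simp
  qed
  have tA: "poly p (y i) / (y i * (y i - y i / q) * (\<Prod>k\<in>K - {i}. (y i - y k) * (y i - y k / q))) =
      C * (- q) ^ (?m - 1) * (\<Prod>k\<in>K - {i}. cfac t (y i) (y k) * cfac t (y k) (q * y i))" if i: "i \<in> K" for i
  proof -
    have "poly p (y i) = (t * y i - y i) * (t * y i - q * y i) * (\<Prod>k\<in>K - {i}. (t * y i - y k) * (t * y k - q * y i))"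
      unfolding pw by (rule prod.remove[OF K i])
    then have "poly p (y i) / (y i * (y i - y i / q) * (\<Prod>k\<in>K - {i}. (y i - y k) * (y i - y k / q))) =
        (t * y i - y i) * (t * y i - q * y i) / (y i * (y i - y i / q)) *
        (\<Prod>k\<in>K - {i}. ((t * y i - y k) * (t * y k - q * y i)) / ((y i - y k) * (y i - y k / q)))"
      by (simp add: prod_dividef)
    also have "(t * y i - y i) * (t * y i - q * y i) / (y i * (y i - y i / q)) = C"
    proof -
      have "(t * y i - y i) * (t * y i - q * y i) = (y i * y i) * ((t - 1) * (t - q))" by algebra
      moreover have "y i * (y i - y i / q) = (y i * y i) * ((q - 1) / q)" using q by (simp add: field_simps)
      ultimately show ?thesis using y0[OF i] by (simp add: C_def)
    qed
    also have "(\<Prod>k\<in>K - {i}. ((t * y i - y k) * (t * y k - q * y i)) / ((y i - y k) * (y i - y k / q))) =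
        (\<Prod>k\<in>K - {i}. (- q) * (cfac t (y i) (y k) * cfac t (y k) (q * y i)))"
    proof (rule prod.cong[OF refl])
      fix k assume "k \<in> K - {i}"
      have "y i - y k / q = (y k - q * y i) / (- q)" using q by (simp add: field_simps)
      then show "((t * y i - y k) * (t * y k - q * y i)) / ((y i - y k) * (y i - y k / q)) =
        (- q) * (cfac t (y i) (y k) * cfac t (y k) (q * y i))" by (simp add: cfac_def)
    qed
    also have "\<dots> = (- q) ^ (?m - 1) * (\<Prod>k\<in>K - {i}. cfac t (y i) (y k) * cfac t (y k) (q * y i))"
      unfolding prod.distrib[of "\<lambda>_. - q"] using i by simp
    finally show ?thesis by (simp add: mult.assoc)
  qed
  have tB: "poly p (y i / q) / (y i / q * (y i / q - y i) *
        (\<Prod>k\<in>K - {i}. (y i / q - y k) * (y i / q - y k / q))) =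
      - (C * (- q) ^ (?m - 1) * (\<Prod>k\<in>K - {i}. cfac t (y k) (y i) * cfac t (y i) (q * y k)))" if i: "i \<in> K" for i
  proof -
    have "poly p (y i / q) = (t * (y i / q) - y i) * (t * y i - q * (y i / q)) *
        (\<Prod>k\<in>K - {i}. (t * (y i / q) - y k) * (t * y k - q * (y i / q)))"
      unfolding pw by (rule prod.remove[OF K i])
    then have "poly p (y i / q) / (y i / q * (y i / q - y i) *
        (\<Prod>k\<in>K - {i}. (y i / q - y k) * (y i / q - y k / q))) =
        (t * (y i / q) - y i) * (t * y i - q * (y i / q)) / (y i / q * (y i / q - y i)) *
        (\<Prod>k\<in>K - {i}. ((t * (y i / q) - y k) * (t * y k - q * (y i / q))) / ((y i / q - y k) * (y i / q - y k / q)))"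
      by (simp add: prod_dividef)
    also have "(t * (y i / q) - y i) * (t * y i - q * (y i / q)) / (y i / q * (y i / q - y i)) = - C"
    proof -
      have "(t * (y i / q) - y i) * (t * y i - q * (y i / q)) = (y i * y i) * ((t - q) * (t - 1) / q)"
        using q by (simp add: field_simps)
      moreover have "y i / q * (y i / q - y i) = (y i * y i) * ((1 - q) / (q * q))" using q by (simp add: field_simps)
      ultimately have "(t * (y i / q) - y i) * (t * y i - q * (y i / q)) / (y i / q * (y i / q - y i)) =
          ((t - q) * (t - 1) / q) / ((1 - q) / (q * q))" using y0[OF i] by simp
      also have "\<dots> = - C" using q unfolding C_def by (simp add: divide_simps) algebra
      finally show ?thesis .
    qed
    also have "(\<Prod>k\<in>K - {i}. ((t * (y i / q) - y k) * (t * y k - q * (y i / q))) / ((y i / q - y k) * (y i / q - y k / q))) =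
        (\<Prod>k\<in>K - {i}. (- q) * (cfac t (y k) (y i) * cfac t (y i) (q * y k)))"
    proof (rule prod.cong[OF refl])
      fix k assume "k \<in> K - {i}"
      have "t * (y i / q) - y k = (t * y i - q * y k) / q" "y i / q - y k = (y i - q * y k) / q"
        "y i / q - y k / q = (y k - y i) / (- q)" "q * (y i / q) = y i" using q by (auto simp: field_simps)
      then show "((t * (y i / q) - y k) * (t * y k - q * (y i / q))) / ((y i / q - y k) * (y i / q - y k / q)) =
        (- q) * (cfac t (y k) (y i) * cfac t (y i) (q * y k))" using q by (simp add: cfac_def mult_ac)
    qed
    also have "\<dots> = (- q) ^ (?m - 1) * (\<Prod>k\<in>K - {i}. cfac t (y k) (y i) * cfac t (y i) (q * y k))"
      unfolding prod.distrib[of "\<lambda>_. - q"] using i by simp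
    finally show ?thesis by (simp add: mult.assoc)
  qed
  have "(\<Sum>i\<in>K. poly p (y i) / (y i * (y i - y i / q) * (\<Prod>k\<in>K - {i}. (y i - y k) * (y i - y k / q)))) +
     (\<Sum>i\<in>K. poly p (y i / q) / (y i / q * (y i / q - y i) *
        (\<Prod>k\<in>K - {i}. (y i / q - y k) * (y i / q - y k / q)))) = 0"
    using partial_fraction_identity[OF K inj q y0 yq deg] by (simp only: p0 co) simp
  moreover have "(\<Sum>i\<in>K. poly p (y i) / (y i * (y i - y i / q) * (\<Prod>k\<in>K - {i}. (y i - y k) * (y i - y k / q)))) =
      C * (- q) ^ (?m - 1) * (\<Sum>i\<in>K. \<Prod>k\<in>K - {i}. cfac t (y i) (y k) * cfac t (y k) (q * y i))"
    unfolding sum_distrib_left by (rule sum.cong[OF refl tA])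
  moreover have "(\<Sum>i\<in>K. poly p (y i / q) / (y i / q * (y i / q - y i) *
        (\<Prod>k\<in>K - {i}. (y i / q - y k) * (y i / q - y k / q)))) =
      - (C * (- q) ^ (?m - 1) * (\<Sum>i\<in>K. \<Prod>k\<in>K - {i}. cfac t (y k) (y i) * cfac t (y i) (q * y k)))"
    unfolding sum_distrib_left sum_negf[symmetric] by (rule sum.cong[OF refl tB])
  ultimately have "C * (- q) ^ (?m - 1) * (\<Sum>i\<in>K. \<Prod>k\<in>K - {i}. cfac t (y i) (y k) * cfac t (y k) (q * y i)) =
      C * (- q) ^ (?m - 1) * (\<Sum>i\<in>K. \<Prod>k\<in>K - {i}. cfac t (y k) (y i) * cfac t (y i) (q * y k))"
    by (simp only: add_eq_0_iff2 minus_minus)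
  then show ?thesis using C q by simp
qed

text \<open>
  The same argument for \<open>\<Prod>\<^sub>k w / ((w - y\<^sub>k) (w - y\<^sub>k / q)) dw\<close>, which has no residue at \<open>\<infinity>\<close> if there are at least
  two factors.
\<close>
lemma exchange_identity_t0:
  fixes y :: "nat \<Rightarrow> 'a::field"
  assumes K: "finite K" and inj: "inj_on y K" and q: "q \<noteq> 0" "q \<noteq> 1"
    and y0: "\<And>i. i \<in> K \<Longrightarrow> y i \<noteq> 0"
    and yq: "\<And>i k. i \<in> K \<Longrightarrow> k \<in> K \<Longrightarrow> i \<noteq> k \<Longrightarrow> y i \<noteq> q * y k"
    and two: "2 \<le> card K"
  shows "(\<Sum>i\<in>K. y i * (\<Prod>k\<in>K - {i}. cfac 0 (y k) (y i) * cfac 0 (y i) (q * y k))) =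
    q * (\<Sum>i\<in>K. y i * (\<Prod>k\<in>K - {i}. cfac 0 (y i) (y k) * cfac 0 (y k) (q * y i)))"
proof -
  obtain m where m: "card K = Suc m" using two by (cases "card K") auto
  \<comment> \<open>One factor w for each element of K, and one more to cancel node 0. The top
    coefficient in \<open>partial_fraction_identity\<close> is 0 because K has at least two
    elements, that is, m is positive.\<close>
  define p :: "'a poly" where "p = monom 1 (Suc (Suc m))"
  have deg: "degree p \<le> 2 * card K" using two by (auto simp: p_def m intro: order_trans[OF degree_monom_le])
  have co: "coeff p (2 * card K) = 0" using two by (simp add: p_def m)
  \<comment> \<open>\<open>cfac 0 a b\<close> has numerator -b. Y completes the product of the
    numerators over \<open>K - {i}\<close> to a product over K, which no longer depends on
    i.\<close>
  define Y where "Y = (\<Prod>k\<in>K. - y k)"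
  have Y: "Y \<noteq> 0" using y0 K by (simp add: Y_def)
  have Yi: "Y = - y i * (\<Prod>k\<in>K - {i}. - y k)" if "i \<in> K" for i
    unfolding Y_def by (rule prod.remove[OF K that])
  have cK: "card (K - {i}) = m" if "i \<in> K" for i using that m by simp
  have tA: "y i * (\<Prod>k\<in>K - {i}. cfac 0 (y i) (y k) * cfac 0 (y k) (q * y i)) =
      - Y * ((q - 1) / q) *
      (poly p (y i) / (y i * (y i - y i / q) * (\<Prod>k\<in>K - {i}. (y i - y k) * (y i - y k / q))))" if i: "i \<in> K" for i
  proof -
    have "(\<Prod>k\<in>K - {i}. cfac 0 (y i) (y k) * cfac 0 (y k) (q * y i)) =
        (\<Prod>k\<in>K - {i}. y i * (- y k) / ((y i - y k) * (y i - y k / q)))"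
    proof (rule prod.cong[OF refl])
      fix k assume "k \<in> K - {i}"
      have "y i - y k / q = (y k - q * y i) / (- q)" using q by (simp add: field_simps)
      then show "cfac 0 (y i) (y k) * cfac 0 (y k) (q * y i) = y i * (- y k) / ((y i - y k) * (y i - y k / q))"
        by (simp add: cfac_def)
    qed
    also have "\<dots> = y i ^ m * (\<Prod>k\<in>K - {i}. - y k) / (\<Prod>k\<in>K - {i}. (y i - y k) * (y i - y k / q))"
      unfolding prod_dividef prod.distrib[of "\<lambda>_. y i"] using cK[OF i] by simp
    finally have E: "(\<Prod>k\<in>K - {i}. cfac 0 (y i) (y k) * cfac 0 (y k) (q * y i)) =
      y i ^ m * (\<Prod>k\<in>K - {i}. - y k) / (\<Prod>k\<in>K - {i}. (y i - y k) * (y i - y k / q))" .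
    have F: "y i * (y i - y i / q) = y i * y i * ((q - 1) / q)" using q by (simp add: field_simps)
    show ?thesis unfolding E F Yi[OF i] p_def poly_monom using y0[OF i] q by (simp add: divide_simps)
  qed
  have tB: "y i * (\<Prod>k\<in>K - {i}. cfac 0 (y k) (y i) * cfac 0 (y i) (q * y k)) =
      - Y * (1 - q) *
      (poly p (y i / q) / (y i / q * (y i / q - y i) *
        (\<Prod>k\<in>K - {i}. (y i / q - y k) * (y i / q - y k / q))))" if i: "i \<in> K" for i
  proof -
    have "(\<Prod>k\<in>K - {i}. cfac 0 (y k) (y i) * cfac 0 (y i) (q * y k)) =
        (\<Prod>k\<in>K - {i}. (y i / q) * (- y k) / ((y i / q - y k) * (y i / q - y k / q)))"
    proof (rule prod.cong[OF refl])
      fix k assume "k \<in> K - {i}"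
      have "y i / q - y k = (y i - q * y k) / q" "y i / q - y k / q = (y k - y i) / (- q)"
        using q by (auto simp: field_simps)
      then show "cfac 0 (y k) (y i) * cfac 0 (y i) (q * y k) =
          (y i / q) * (- y k) / ((y i / q - y k) * (y i / q - y k / q))"
        using q by (simp add: cfac_def mult_ac)
    qed
    also have "\<dots> = (y i / q) ^ m * (\<Prod>k\<in>K - {i}. - y k) / (\<Prod>k\<in>K - {i}. (y i / q - y k) * (y i / q - y k / q))"
      unfolding prod_dividef prod.distrib[of "\<lambda>_. y i / q"] prod_constant cK[OF i] power_divide ..
    finally have E: "(\<Prod>k\<in>K - {i}. cfac 0 (y k) (y i) * cfac 0 (y i) (q * y k)) =
      (y i / q) ^ m * (\<Prod>k\<in>K - {i}. - y k) / (\<Prod>k\<in>K - {i}. (y i / q - y k) * (y i / q - y k / q))" .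
    have F: "y i / q * (y i / q - y i) = (y i / q) * (y i / q) * (1 - q)" using q by (simp add: field_simps)
    show ?thesis unfolding E F Yi[OF i] p_def poly_monom using y0[OF i] q by (simp add: divide_simps)
  qed
  let ?SA = "\<Sum>i\<in>K. poly p (y i) / (y i * (y i - y i / q) * (\<Prod>k\<in>K - {i}. (y i - y k) * (y i - y k / q)))"
  let ?SB = "\<Sum>i\<in>K. poly p (y i / q) / (y i / q * (y i / q - y i) *
        (\<Prod>k\<in>K - {i}. (y i / q - y k) * (y i / q - y k / q)))"
  have "?SA + ?SB = 0"
    using partial_fraction_identity[OF K inj q y0 yq deg] by (simp only: co) (simp add: p_def poly_monom)
  then have SB: "?SB = - ?SA" by (simp add: eq_neg_iff_add_eq_0 add.commute)
  have "(\<Sum>i\<in>K. y i * (\<Prod>k\<in>K - {i}. cfac 0 (y k) (y i) * cfac 0 (y i) (q * y k))) = - Y * (1 - q) * ?SB"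
    by (simp add: tB sum_distrib_left)
  also have "\<dots> = q * (- Y * ((q - 1) / q) * ?SA)" unfolding SB using q by (simp add: field_simps)
  also have "- Y * ((q - 1) / q) * ?SA =
      (\<Sum>i\<in>K. y i * (\<Prod>k\<in>K - {i}. cfac 0 (y i) (y k) * cfac 0 (y k) (q * y i)))"
    by (simp add: tA sum_distrib_left)
  finally show ?thesis .
qed


lemma mac_coeff_cfac: "mac_coeff n t I y = (\<Prod>i\<in>I. \<Prod>j\<in>{1..n} - I. cfac t (y i) (y j))"
  by (simp add: mac_coeff_def cfac_def)

lemma scale_scale_commute:
  fixes y :: "nat \<Rightarrow> 'a::comm_ring_1"
  shows "scale q I (scale q J y) = scale q J (scale q I y)"
  by (auto simp: scale_def fun_eq_iff mult_ac)

text \<open>Weight 1 gives the first Macdonald operator (\<open>mac_op_1\<close>); the weight w(x) =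
  x gives at t = 0 the operator B. Commutation and q-commutation thus become one
  computation.\<close>

definition weighted_op ::
    "nat \<Rightarrow> ('a \<Rightarrow> 'a) \<Rightarrow> 'a \<Rightarrow> 'a \<Rightarrow> ((nat \<Rightarrow> 'a) \<Rightarrow> 'a) \<Rightarrow> (nat \<Rightarrow> 'a) \<Rightarrow> 'a::field" where
  "weighted_op n w q t f y = (\<Sum>i = 1..n. w (y i) * mac_coeff n t {i} y * f (scale q {i} y))"

lemma sum_rsets_insert:
  "(\<Sum>I\<in>rsets n r. \<Sum>i\<in>{1..n} - I. h (insert i I) i) = (\<Sum>K\<in>rsets n (Suc r). \<Sum>i\<in>K. h K i)"
proof -
  have fin: "finite I" if "I \<in> rsets n r" for I r using that finite_subset by (auto simp: rsets_def)
  have "(\<Sum>I\<in>rsets n r. \<Sum>i\<in>{1..n} - I. h (insert i I) i) =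
      (\<Sum>(I, i)\<in>Sigma (rsets n r) (\<lambda>I. {1..n} - I). h (insert i I) i)"
    by (rule sum.Sigma) auto
  also have "\<dots> = (\<Sum>(K, i)\<in>Sigma (rsets n (Suc r)) (\<lambda>K. K). h K i)"
  proof (rule sum.reindex_bij_witness[of _ "\<lambda>(K, i). (K - {i}, i)" "\<lambda>(I, i). (insert i I, i)"])
    fix a assume a: "a \<in> Sigma (rsets n r) (\<lambda>I. {1..n} - I)"
    then obtain I i where ai: "a = (I, i)" "I \<in> rsets n r" "i \<in> {1..n}" "i \<notin> I" by auto
    then show "(case case a of (I, i) \<Rightarrow> (insert i I, i) of (K, i) \<Rightarrow> (K - {i}, i)) = a" by simp
    show "(case a of (I, i) \<Rightarrow> (insert i I, i)) \<in> Sigma (rsets n (Suc r)) (\<lambda>K. K)"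
      using ai fin[OF ai(2)] by (auto simp: rsets_def)
  next
    fix b assume b: "b \<in> Sigma (rsets n (Suc r)) (\<lambda>K. K)"
    then obtain K i where bi: "b = (K, i)" "K \<in> rsets n (Suc r)" "i \<in> K" by auto
    then show "(case b of (K, i) \<Rightarrow> (K - {i}, i)) \<in> Sigma (rsets n r) (\<lambda>I. {1..n} - I)"
      using fin[OF bi(2)] by (auto simp: rsets_def)
    show "(case case b of (K, i) \<Rightarrow> (K - {i}, i) of (I, i) \<Rightarrow> (insert i I, i)) = b"
      using bi by (auto simp: insert_absorb)
  qed auto
  also have "\<dots> = (\<Sum>K\<in>rsets n (Suc r). \<Sum>i\<in>K. h K i)"
    using fin by (intro sum.Sigma[symmetric]) auto
  finally show ?thesis .
qed

text \<open>Each composition is a double sum over I and i. For i in I the terms agree one by one,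
  the factor \<rho> arising because the weight is taken at a scaled coordinate. For i outside I the
  shift depends only on \<open>K = insert i I\<close>; collecting the terms of one K and splitting
  off the common product \<open>out K\<close> leaves exactly \<open>exch\<close>.\<close>

lemma mac_op_weighted_op:
  fixes y :: "nat \<Rightarrow> 'a::field"
  assumes q: "q \<noteq> 0" and w: "\<And>a. w (q * a) = \<rho> * w a"
    and exch: "\<And>K. K \<in> rsets n (Suc r) \<Longrightarrow>
      (\<Sum>i\<in>K. w (y i) * (\<Prod>k\<in>K - {i}. cfac t (y k) (y i) * cfac t (y i) (q * y k))) =
      \<rho> * (\<Sum>i\<in>K. w (y i) * (\<Prod>k\<in>K - {i}. cfac t (y i) (y k) * cfac t (y k) (q * y i)))"
  shows "mac_op n r q t (weighted_op n w q t f) y = \<rho> * weighted_op n w q t (mac_op n r q t f) y"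
proof -
  have fin: "finite I" if "I \<in> rsets n r" for I r using that finite_subset by (auto simp: rsets_def)
  define G where "G I i = f (scale q {i} (scale q I y))" for I i
  define L where "L I i = mac_coeff n t I y * (w (scale q I y i) * mac_coeff n t {i} (scale q I y))" for I i
  define R where "R I i = \<rho> * (w (y i) * mac_coeff n t {i} y * mac_coeff n t I (scale q {i} y))" for I i
  define out where "out K = (\<Prod>k\<in>K. \<Prod>j\<in>{1..n} - K. cfac t (y k) (y j))" for K
  have split: "(\<Sum>i = 1..n. g i) = (\<Sum>i\<in>I. g i) + (\<Sum>i\<in>{1..n} - I. g i)" if "I \<in> rsets n r"
    for I and g :: "nat \<Rightarrow> 'a"
    using that sum.subset_diff[of I "{1..n}" g] by (simp add: rsets_def add.commute)
  have lhs: "mac_op n r q t (weighted_op n w q t f) y =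
      (\<Sum>I\<in>rsets n r. \<Sum>i\<in>I. L I i * G I i) + (\<Sum>I\<in>rsets n r. \<Sum>i\<in>{1..n} - I. L I i * G I i)"
    unfolding mac_op_def weighted_op_def sum.distrib[symmetric]
  proof (rule sum.cong[OF refl])
    fix I assume I: "I \<in> rsets n r"
    show "mac_coeff n t I y * (\<Sum>i = 1..n. w (scale q I y i) * mac_coeff n t {i} (scale q I y) *
        f (scale q {i} (scale q I y))) = (\<Sum>i\<in>I. L I i * G I i) + (\<Sum>i\<in>{1..n} - I. L I i * G I i)"
      unfolding split[OF I] by (simp add: distrib_left sum_distrib_left L_def G_def mult_ac)
  qed
  have "\<rho> * weighted_op n w q t (mac_op n r q t f) y = (\<Sum>i = 1..n. \<Sum>I\<in>rsets n r. R I i * G I i)"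
    unfolding mac_op_def weighted_op_def sum_distrib_left
    by (intro sum.cong refl) (simp add: R_def G_def scale_scale_commute[of q "{_}"] mult_ac)
  also have "\<dots> = (\<Sum>I\<in>rsets n r. \<Sum>i = 1..n. R I i * G I i)" by (rule sum.swap)
  also have "\<dots> = (\<Sum>I\<in>rsets n r. \<Sum>i\<in>I. R I i * G I i) + (\<Sum>I\<in>rsets n r. \<Sum>i\<in>{1..n} - I. R I i * G I i)"
    unfolding sum.distrib[symmetric] by (rule sum.cong[OF refl], rule split)
  finally have rhs: "\<rho> * weighted_op n w q t (mac_op n r q t f) y =
      (\<Sum>I\<in>rsets n r. \<Sum>i\<in>I. R I i * G I i) + (\<Sum>I\<in>rsets n r. \<Sum>i\<in>{1..n} - I. R I i * G I i)" .
  have single: "mac_coeff n t {i} x = (\<Prod>k\<in>J. cfac t (x i) (x k)) * (\<Prod>j\<in>{1..n} - insert i J. cfac t (x i) (x j))"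
    if "J \<subseteq> {1..n}" "i \<notin> J" for i J and x :: "nat \<Rightarrow> 'a"
  proof -
    have "mac_coeff n t {i} x = (\<Prod>j\<in>{1..n} - {i}. cfac t (x i) (x j))" by (simp add: mac_coeff_cfac)
    also have "\<dots> = (\<Prod>j\<in>({1..n} - {i}) - J. cfac t (x i) (x j)) * (\<Prod>k\<in>J. cfac t (x i) (x k))"
      using that by (intro prod.subset_diff) auto
    also have "({1..n} - {i}) - J = {1..n} - insert i J" by auto
    finally show ?thesis by (simp add: mult.commute)
  qed
  have "L I i = R I i" if I: "I \<in> rsets n r" and i: "i \<in> I" for I i
  proof -
    have J: "I - {i} \<subseteq> {1..n}" "insert i (I - {i}) = I" using I i by (auto simp: rsets_def)
    have rem: "(\<Prod>k\<in>I. g k) = g i * (\<Prod>k\<in>I - {i}. g k)" for g :: "nat \<Rightarrow> 'a"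
      using prod.remove[OF fin[OF I] i] .
    have 1: "mac_coeff n t {i} (scale q I y) =
        (\<Prod>k\<in>I - {i}. cfac t (y i) (y k)) * (\<Prod>j\<in>{1..n} - I. cfac t (q * y i) (y j))"
      unfolding single[OF J(1), of i, simplified J(2), simplified]
      by (intro arg_cong2[of _ _ _ _ "(*)"] prod.cong) (use i q in \<open>auto simp: scale_def cfac_scale\<close>)
    have 2: "mac_coeff n t {i} y =
        (\<Prod>k\<in>I - {i}. cfac t (y i) (y k)) * (\<Prod>j\<in>{1..n} - I. cfac t (y i) (y j))"
      using single[OF J(1), of i, simplified J(2)] by simp
    have 3: "mac_coeff n t I y = (\<Prod>j\<in>{1..n} - I. cfac t (y i) (y j)) *
        (\<Prod>k\<in>I - {i}. \<Prod>j\<in>{1..n} - I. cfac t (y k) (y j))"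
      unfolding mac_coeff_cfac by (rule rem)
    have 4: "mac_coeff n t I (scale q {i} y) = (\<Prod>j\<in>{1..n} - I. cfac t (q * y i) (y j)) *
        (\<Prod>k\<in>I - {i}. \<Prod>j\<in>{1..n} - I. cfac t (y k) (y j))"
      unfolding mac_coeff_cfac rem
      by (intro arg_cong2[of _ _ _ _ "(*)"] prod.cong) (use i in \<open>auto simp: scale_def\<close>)
    show ?thesis unfolding L_def R_def 1 2 3 4 using i by (simp add: scale_def w mult_ac)
  qed
  then have inner: "(\<Sum>I\<in>rsets n r. \<Sum>i\<in>I. L I i * G I i) = (\<Sum>I\<in>rsets n r. \<Sum>i\<in>I. R I i * G I i)"
    by simp
  define h where "h K = f (scale q K y)" for K
  have Gh: "G I i = h (insert i I)" if "i \<notin> I" for I i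
    unfolding G_def h_def by (rule arg_cong[of _ _ f]) (use that in \<open>auto simp: scale_def fun_eq_iff\<close>)
  define L' where "L' K i = w (y i) * (\<Prod>k\<in>K - {i}. cfac t (y k) (y i) * cfac t (y i) (q * y k))" for K i
  define R' where "R' K i = w (y i) * (\<Prod>k\<in>K - {i}. cfac t (y i) (y k) * cfac t (y k) (q * y i))" for K i
  have LR: "L I i = out (insert i I) * L' (insert i I) i" "R I i = \<rho> * (out (insert i I) * R' (insert i I) i)"
    if I: "I \<in> rsets n r" and i: "i \<in> {1..n} - I" for I i
  proof -
    have J: "I \<subseteq> {1..n}" "i \<notin> I" and K: "insert i I - {i} = I" using I i by (auto simp: rsets_def)
    have O: "{1..n} - I = insert i ({1..n} - insert i I)" using i by auto
    have 1: "mac_coeff n t {i} (scale q I y) =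
        (\<Prod>k\<in>I. cfac t (y i) (q * y k)) * (\<Prod>j\<in>{1..n} - insert i I. cfac t (y i) (y j))"
      unfolding single[OF J]
      by (intro arg_cong2[of _ _ _ _ "(*)"] prod.cong) (use i in \<open>auto simp: scale_def\<close>)
    have 2: "mac_coeff n t {i} y =
        (\<Prod>k\<in>I. cfac t (y i) (y k)) * (\<Prod>j\<in>{1..n} - insert i I. cfac t (y i) (y j))"
      by (rule single[OF J])
    have 3: "mac_coeff n t I y = (\<Prod>k\<in>I. cfac t (y k) (y i)) *
        (\<Prod>k\<in>I. \<Prod>j\<in>{1..n} - insert i I. cfac t (y k) (y j))"
      unfolding mac_coeff_cfac by (subst O) (simp add: prod.distrib)
    have 4: "mac_coeff n t I (scale q {i} y) = (\<Prod>k\<in>I. cfac t (y k) (q * y i)) *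
        (\<Prod>k\<in>I. \<Prod>j\<in>{1..n} - insert i I. cfac t (y k) (y j))"
      unfolding mac_coeff_cfac prod.distrib[symmetric]
    proof (rule prod.cong[OF refl])
      fix k assume "k \<in> I"
      then have ki: "k \<noteq> i" using i by auto
      show "(\<Prod>j\<in>{1..n} - I. cfac t (scale q {i} y k) (scale q {i} y j)) =
        cfac t (y k) (q * y i) * (\<Prod>j\<in>{1..n} - insert i I. cfac t (y k) (y j))"
        by (subst O) (simp add: scale_def ki)
    qed
    have 5: "out (insert i I) = (\<Prod>j\<in>{1..n} - insert i I. cfac t (y i) (y j)) *
        (\<Prod>k\<in>I. \<Prod>j\<in>{1..n} - insert i I. cfac t (y k) (y j))"
      unfolding out_def using J fin[OF I] by simp
    show "L I i = out (insert i I) * L' (insert i I) i"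
      unfolding L_def L'_def 1 3 5 K prod.distrib using J by (simp add: scale_def mult_ac)
    show "R I i = \<rho> * (out (insert i I) * R' (insert i I) i)"
      unfolding R_def R'_def 2 4 5 K prod.distrib by (simp add: mult_ac)
  qed
  have "(\<Sum>I\<in>rsets n r. \<Sum>i\<in>{1..n} - I. L I i * G I i) =
      (\<Sum>I\<in>rsets n r. \<Sum>i\<in>{1..n} - I. out (insert i I) * L' (insert i I) i * h (insert i I))"
    by (intro sum.cong refl) (simp add: LR Gh)
  also have "\<dots> = (\<Sum>K\<in>rsets n (Suc r). \<Sum>i\<in>K. out K * L' K i * h K)" by (rule sum_rsets_insert)
  also have "\<dots> = (\<Sum>K\<in>rsets n (Suc r). out K * h K * (\<Sum>i\<in>K. L' K i))"
    by (simp add: sum_distrib_left mult_ac)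
  also have "\<dots> = (\<Sum>K\<in>rsets n (Suc r). out K * h K * (\<rho> * (\<Sum>i\<in>K. R' K i)))"
    by (rule sum.cong) (simp_all add: exch L'_def R'_def)
  also have "\<dots> = (\<Sum>K\<in>rsets n (Suc r). \<Sum>i\<in>K. \<rho> * (out K * R' K i) * h K)"
    by (simp add: sum_distrib_left mult_ac)
  also have "\<dots> = (\<Sum>I\<in>rsets n r. \<Sum>i\<in>{1..n} - I. \<rho> * (out (insert i I) * R' (insert i I) i) * h (insert i I))"
    by (rule sum_rsets_insert[symmetric])
  also have "\<dots> = (\<Sum>I\<in>rsets n r. \<Sum>i\<in>{1..n} - I. R I i * G I i)"
    by (intro sum.cong refl) (simp add: LR Gh)
  finally show ?thesis using lhs rhs inner by simp
qed

lemma rsets_1: "rsets n (Suc 0) = (\<lambda>i. {i}) ` {1..n}"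
  by (auto simp: rsets_def card_Suc_eq)

lemma mac_op_1: "mac_op n (Suc 0) q t f = weighted_op n (\<lambda>_. 1) q t f"
  by (rule ext) (simp add: mac_op_def weighted_op_def rsets_1 sum.reindex inj_on_def)

section \<open>Evaluation at a generic point\<close>

definition embK :: "Qqt \<Rightarrow> Qqt mpol fract" where
  "embK c = emb (cst c)"

text \<open>The variables as elements of the field of rational functions form a generic point: they
  satisfy no polynomial relation over \<rat>(q,t), so an identity there is an identity of
  coefficients (\<open>xgen_independent\<close>).\<close>

definition xgen :: "nat \<Rightarrow> Qqt mpol fract" where
  "xgen i = emb (X i)"

lemma emb_0 [simp]: "emb 0 = 0" and emb_1 [simp]: "emb 1 = 1"
  by (simp_all add: emb_def Zero_fract_def One_fract_def)

lemma emb_add: "emb (a + b) = emb a + emb b" and emb_mult: "emb (a * b) = emb a * emb b"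
  and emb_diff: "emb (a - b) = emb a - emb b"
  by (simp_all add: emb_def)

lemma emb_eq_0_iff [simp]: "emb a = 0 \<longleftrightarrow> a = 0"
  by (simp add: emb_def Zero_fract_def eq_fract)

lemma emb_eq_iff [simp]: "emb a = emb b \<longleftrightarrow> a = b"
  by (simp add: emb_def eq_fract)

lemma emb_sum: "emb (sum f A) = (\<Sum>i\<in>A. emb (f i))"
  by (induction A rule: infinite_finite_induct) (simp_all add: emb_add)

lemma cst_0 [simp]: "cst 0 = 0" and cst_1 [simp]: "cst 1 = 1"
  and cst_add: "cst (a + b) = cst a + cst b"
  by (simp_all add: cst_def single_add)

lemma cst_mult: "cst (a * b) = cst a * cst (b :: 'a::semiring_0)"
  by (simp add: cst_def mult_single)

lemma embK_0 [simp]: "embK 0 = 0" and embK_1 [simp]: "embK 1 = 1"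
  and embK_add: "embK (a + b) = embK a + embK b" and embK_mult: "embK (a * b) = embK a * embK b"
  by (simp_all add: embK_def emb_add emb_mult cst_add cst_mult)

lemma embK_eq_0_iff [simp]: "embK a = 0 \<longleftrightarrow> a = 0"
  by (simp add: embK_def cst_def) (metis lookup_single_eq lookup_zero single_zero)

lemma embK_diff: "embK (a - b) = embK a - embK b"
  using embK_add[of "a - b" b] by simp

lemma embK_uminus: "embK (- a) = - embK a"
  using embK_diff[of 0 a] by simp

lemma embK_eq_iff [simp]: "embK a = embK b \<longleftrightarrow> a = b"
  using embK_eq_0_iff[of "a - b"] by (simp add: embK_diff)

lemma embK_power: "embK (a ^ k) = embK a ^ k"
  by (induction k) (simp_all add: embK_mult)

lemma embK_sum: "embK (sum f A) = (\<Sum>i\<in>A. embK (f i))"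
  by (induction A rule: infinite_finite_induct) (simp_all add: embK_add)

lemma embK_of_nat: "embK (of_nat k) = of_nat k"
  by (induction k) (simp_all add: embK_add)

lemma embK_of_int: "embK (of_int k) = of_int k"
  by (cases k rule: int_cases2) (simp_all add: embK_of_nat embK_uminus)

lemmas embK_simps = embK_add embK_mult embK_diff embK_uminus embK_power embK_sum embK_of_int

definition expo :: "(nat \<Rightarrow> nat) \<Rightarrow> nat \<Rightarrow>\<^sub>0 nat" where
  "expo \<alpha> = Abs_poly_mapping \<alpha>"

lemma lookup_expo:
  assumes "\<And>i. i \<notin> {1..n} \<Longrightarrow> \<alpha> i = 0"
  shows "Poly_Mapping.lookup (expo \<alpha>) = \<alpha>"
  unfolding expo_def
proof (rule lookup_Abs_poly_mapping)
  have "{k. \<alpha> k \<noteq> 0} \<subseteq> {1..n}"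
  proof (intro subsetI, rule ccontr)
    fix k assume "k \<in> {k. \<alpha> k \<noteq> 0}" "k \<notin> {1..n}"
    then show False using assms[of k] by simp
  qed
  then show "finite {k. \<alpha> k \<noteq> 0}" by (rule finite_subset) simp
qed

lemma X_power: "X i ^ k = Poly_Mapping.single (Poly_Mapping.single i k) 1"
  by (induction k) (simp_all add: X_def mult_single single_add[symmetric])

lemma mon_xgen:
  assumes "\<And>i. i \<notin> {1..n} \<Longrightarrow> \<alpha> i = 0"
  shows "mon n \<alpha> xgen = emb (Poly_Mapping.single (expo \<alpha>) 1)"
proof -
  have p: "xgen i ^ k = emb (Poly_Mapping.single (Poly_Mapping.single i k) 1)" for i k
    by (simp flip: X_power) (induction k; simp add: xgen_def emb_mult)
  have "mon m \<alpha> xgen = emb (Poly_Mapping.single (\<Sum>i = 1..m. Poly_Mapping.single i (\<alpha> i)) 1)" for m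
  proof (induction m)
    case (Suc m)
    then show ?case by (simp add: mon_Suc p emb_mult[symmetric] mult_single)
  qed (simp add: mon_def)
  moreover have "(\<Sum>i = 1..n. Poly_Mapping.single i (\<alpha> i)) = expo \<alpha>"
  proof (rule poly_mapping_eqI)
    fix k
    have "Poly_Mapping.lookup (\<Sum>i = 1..n. Poly_Mapping.single i (\<alpha> i)) k = (\<Sum>i = 1..n. if i = k then \<alpha> i else 0)"
      by (simp add: lookup_sum lookup_single when_def)
    also have "\<dots> = \<alpha> k" using assms by (simp add: sum.delta)
    finally show "Poly_Mapping.lookup (\<Sum>i = 1..n. Poly_Mapping.single i (\<alpha> i)) k = Poly_Mapping.lookup (expo \<alpha>) k"
      using lookup_expo[of n \<alpha>] assms by simp
  qed
  ultimately show ?thesis by simp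
qed

lemma xgen_independent:
  assumes A: "finite A" and supp: "\<And>\<alpha> i. \<alpha> \<in> A \<Longrightarrow> i \<notin> {1..n} \<Longrightarrow> \<alpha> i = 0"
    and eq: "(\<Sum>\<alpha>\<in>A. embK (g \<alpha>) * mon n \<alpha> xgen) = 0" and b: "\<beta> \<in> A"
  shows "g \<beta> = 0"
proof -
  have "(\<Sum>\<alpha>\<in>A. embK (g \<alpha>) * mon n \<alpha> xgen) = (\<Sum>\<alpha>\<in>A. emb (Poly_Mapping.single (expo \<alpha>) (g \<alpha>)))"
  proof (rule sum.cong[OF refl])
    fix \<alpha> assume "\<alpha> \<in> A"
    then have "mon n \<alpha> xgen = emb (Poly_Mapping.single (expo \<alpha>) 1)" using supp by (intro mon_xgen) blast
    then show "embK (g \<alpha>) * mon n \<alpha> xgen = emb (Poly_Mapping.single (expo \<alpha>) (g \<alpha>))"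
      by (simp add: embK_def cst_def emb_mult[symmetric] mult_single)
  qed
  also have "\<dots> = emb (\<Sum>\<alpha>\<in>A. Poly_Mapping.single (expo \<alpha>) (g \<alpha>))" by (simp add: emb_sum)
  finally have "(\<Sum>\<alpha>\<in>A. Poly_Mapping.single (expo \<alpha>) (g \<alpha>)) = 0" using eq by simp
  then have "0 = (\<Sum>\<alpha>\<in>A. Poly_Mapping.lookup (Poly_Mapping.single (expo \<alpha>) (g \<alpha>)) (expo \<beta>))"
    by (simp flip: lookup_sum)
  also have "\<dots> = (\<Sum>\<alpha>\<in>A. if \<alpha> = \<beta> then g \<alpha> else 0)"
  proof (rule sum.cong[OF refl])
    fix \<alpha> assume a: "\<alpha> \<in> A"
    have "Poly_Mapping.lookup (expo \<alpha>) = \<alpha>" by (rule lookup_expo[OF supp[OF a]])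
    moreover have "Poly_Mapping.lookup (expo \<beta>) = \<beta>" by (rule lookup_expo[OF supp[OF b]])
    ultimately have "expo \<alpha> = expo \<beta> \<longleftrightarrow> \<alpha> = \<beta>" by metis
    then show "Poly_Mapping.lookup (Poly_Mapping.single (expo \<alpha>) (g \<alpha>)) (expo \<beta>) = (if \<alpha> = \<beta> then g \<alpha> else 0)"
      by (auto simp: lookup_single when_def)
  qed
  finally show ?thesis using A b by simp
qed

text \<open>Two distinct monomials of degree one are independent. With c = q this keeps the
  coordinates distinct after a q-shift and the nodes of the exchange identities apart.\<close>

lemma xgen_neq:
  assumes i: "i \<in> {1..n}" and j: "j \<in> {1..n}" and ij: "i \<noteq> j"
  shows "xgen i \<noteq> embK c * xgen j"
proof
  assume eq: "xgen i = embK c * xgen j"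
  define e where "e k = (\<lambda>l::nat. if l = k then 1 else 0 :: nat)" for k :: nat
  have e: "mon n (e k) xgen = xgen k" if "k \<in> {1..n}" for k
  proof -
    have "mon n (e k) xgen = (\<Prod>l = 1..n. if l = k then xgen l else 1)"
      unfolding mon_def by (rule prod.cong) (auto simp: e_def)
    then show ?thesis using that by simp
  qed
  have ne: "e i \<noteq> e j" using ij by (auto simp: e_def fun_eq_iff)
  let ?g = "\<lambda>\<alpha>. if \<alpha> = e i then 1 else - c"
  have "(\<Sum>\<alpha>\<in>{e i, e j}. embK (?g \<alpha>) * mon n \<alpha> xgen) = 0"
    using ne ne[symmetric] eq by (simp add: e[OF i] e[OF j] embK_uminus)
  then have "?g (e i) = 0"
    by (rule xgen_independent[of "{e i, e j}" n ?g, rotated 2]) (use i j in \<open>auto simp: e_def\<close>)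
  then show False by simp
qed

lemma xgen_nonzero: "xgen i \<noteq> 0"
  by (simp add: xgen_def X_def) (metis lookup_single_eq lookup_zero zero_neq_one)

lemma inj_xgen: "inj_on xgen {1..n}"
proof (rule inj_onI, rule ccontr)
  fix i j assume "i \<in> {1..n}" "j \<in> {1..n}" "xgen i = xgen j" "i \<noteq> j"
  then show False using xgen_neq[of i n j 1] by simp
qed

lemma inj_scale_xgen:
  assumes "q \<noteq> 0"
  shows "inj_on (scale (embK q) I xgen) {1..n}"
proof (rule inj_onI, rule ccontr)
  fix i j assume ij: "i \<in> {1..n}" "j \<in> {1..n}" "scale (embK q) I xgen i = scale (embK q) I xgen j" "i \<noteq> j"
  have "xgen i \<noteq> embK q * xgen j" "xgen j \<noteq> embK q * xgen i" "xgen i \<noteq> xgen j"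
    using xgen_neq[of i n j q] xgen_neq[of j n i q] xgen_neq[of i n j 1] ij by auto
  then show False using ij assms by (auto simp: scale_def split: if_splits)
qed

lemma par_orb_disjoint:
  assumes "\<mu> \<in> par n d" "\<nu> \<in> par n d'" "\<alpha> \<in> orb n \<mu>" "\<alpha> \<in> orb n \<nu>"
  shows "\<mu> = \<nu> \<and> d = d'"
proof -
  have "\<alpha> \<in> evec n d" "\<alpha> \<in> evec n d'" using assms orb_subset_evec par_evec by blast+
  then have d: "d = d'" by (simp add: evec_def)
  obtain \<pi> \<rho> where p: "\<pi> permutes {1..n}" "\<rho> permutes {1..n}" "\<mu> \<circ> \<pi> = \<nu> \<circ> \<rho>"
    using assms by (auto simp: orb_def)
  then have "\<nu> = \<mu> \<circ> (\<pi> \<circ> inv \<rho>)" by (simp add: o_assoc) (simp add: o_assoc[symmetric] permutes_inv_o)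
  then have "\<nu> \<in> orb n \<mu>" using p by (auto simp: orb_def intro!: imageI permutes_compose permutes_inv)
  then show ?thesis using par_orb_unique[OF assms(1) _] assms(2) d by blast
qed

text \<open>The integer coefficients of \<open>alt (\<delta> + \<alpha>) / alt \<delta>\<close> in the monomial symmetric functions.\<close>
definition schur_coeff :: "nat \<Rightarrow> (nat \<Rightarrow> nat) \<Rightarrow> (nat \<Rightarrow> nat) \<Rightarrow> int" where
  "schur_coeff n \<alpha> = (SOME k. \<exists>d. \<exists>\<mu>\<in>par n d. \<alpha> \<in> orb n \<mu> \<and> k \<mu> = (if \<alpha> = \<mu> then 1 else 0) \<and>
    (\<forall>\<nu>. k \<nu> \<noteq> 0 \<longrightarrow> \<nu> \<in> par n d \<and> dom_le n \<nu> \<mu>) \<and>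
    (\<forall>y :: nat \<Rightarrow> Qqt mpol fract. alt n (\<lambda>i. stair n i + \<alpha> i) y =
       alt n (stair n) y * (\<Sum>\<nu>\<in>par n d. of_int (k \<nu>) * msf n \<nu> y)))"

text \<open>The choice in the definition quantifies over the partition and the degree; since
  distinct orbits are disjoint, both must be the given ones.\<close>

lemma schur_coeff:
  assumes mu: "\<mu> \<in> par n d" and al: "\<alpha> \<in> orb n \<mu>"
  shows "schur_coeff n \<alpha> \<mu> = (if \<alpha> = \<mu> then 1 else 0)"
    and "schur_coeff n \<alpha> \<nu> \<noteq> 0 \<Longrightarrow> dom_le n \<nu> \<mu>"
    and "alt n (\<lambda>i. stair n i + \<alpha> i) (y :: nat \<Rightarrow> Qqt mpol fract) =
       alt n (stair n) y * (\<Sum>\<nu>\<in>par n d. of_int (schur_coeff n \<alpha> \<nu>) * msf n \<nu> y)"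
proof -
  define Q where "Q k d \<mu> \<longleftrightarrow> k \<mu> = (if \<alpha> = \<mu> then 1 else 0) \<and>
    (\<forall>\<nu>. k \<nu> \<noteq> 0 \<longrightarrow> \<nu> \<in> par n d \<and> dom_le n \<nu> \<mu>) \<and>
    (\<forall>y :: nat \<Rightarrow> Qqt mpol fract. alt n (\<lambda>i. stair n i + \<alpha> i) y =
       alt n (stair n) y * (\<Sum>\<nu>\<in>par n d. of_int (k \<nu>) * msf n \<nu> y))" for k :: "(nat \<Rightarrow> nat) \<Rightarrow> int" and d \<mu>
  have "\<exists>k. Q k d \<mu>" unfolding Q_def by (rule alt_expansion[OF mu al])
  then have "\<exists>k. \<exists>d. \<exists>\<mu>\<in>par n d. \<alpha> \<in> orb n \<mu> \<and> Q k d \<mu>" using mu al by blast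
  moreover have "schur_coeff n \<alpha> = (SOME k. \<exists>d. \<exists>\<mu>\<in>par n d. \<alpha> \<in> orb n \<mu> \<and> Q k d \<mu>)"
    unfolding schur_coeff_def Q_def ..
  ultimately have "\<exists>d. \<exists>\<mu>\<in>par n d. \<alpha> \<in> orb n \<mu> \<and> Q (schur_coeff n \<alpha>) d \<mu>"
    using someI_ex[of "\<lambda>k. \<exists>d. \<exists>\<mu>\<in>par n d. \<alpha> \<in> orb n \<mu> \<and> Q k d \<mu>"] by simp
  then obtain d' \<mu>' where "\<mu>' \<in> par n d'" "\<alpha> \<in> orb n \<mu>'" "Q (schur_coeff n \<alpha>) d' \<mu>'" by blast
  then have "Q (schur_coeff n \<alpha>) d \<mu>" using par_orb_disjoint[OF mu _ al] by blast
  then show "schur_coeff n \<alpha> \<mu> = (if \<alpha> = \<mu> then 1 else 0)"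
    and "schur_coeff n \<alpha> \<nu> \<noteq> 0 \<Longrightarrow> dom_le n \<nu> \<mu>"
    and "alt n (\<lambda>i. stair n i + \<alpha> i) (y :: nat \<Rightarrow> Qqt mpol fract) =
       alt n (stair n) y * (\<Sum>\<nu>\<in>par n d. of_int (schur_coeff n \<alpha> \<nu>) * msf n \<nu> y)"
    unfolding Q_def by blast+
qed

section \<open>Matrices of the operators on coefficient vectors\<close>

definition mac_mat :: "nat \<Rightarrow> nat \<Rightarrow> Qqt \<Rightarrow> Qqt \<Rightarrow> (nat \<Rightarrow> nat) \<Rightarrow> (nat \<Rightarrow> nat) \<Rightarrow> Qqt" where
  "mac_mat n r q t \<mu> \<nu> = (\<Sum>\<alpha>\<in>orb n \<mu>. eig n r q t \<alpha> * of_int (schur_coeff n \<alpha> \<nu>))"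

text \<open>Only the values of g on \<open>par n d\<close> enter, so coefficient vectors are
  compared on \<open>par n d\<close> throughout.\<close>

definition sf :: "nat \<Rightarrow> nat \<Rightarrow> ((nat \<Rightarrow> nat) \<Rightarrow> Qqt) \<Rightarrow> (nat \<Rightarrow> Qqt mpol fract) \<Rightarrow> Qqt mpol fract" where
  "sf n d g y = (\<Sum>\<mu>\<in>par n d. embK (g \<mu>) * msf n \<mu> y)"

lemma embK_eig: "embK (eig n r q t \<alpha>) = eig n r (embK q) (embK t) \<alpha>"
  by (simp add: eig_def embK_simps)

lemma mac_mat_diag:
  assumes "\<mu> \<in> par n d"
  shows "mac_mat n r q t \<mu> \<mu> = eig n r q t \<mu>"
proof -
  have "mac_mat n r q t \<mu> \<mu> = (\<Sum>\<alpha>\<in>orb n \<mu>. if \<alpha> = \<mu> then eig n r q t \<alpha> else 0)"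
    unfolding mac_mat_def by (rule sum.cong) (auto simp: schur_coeff(1)[OF assms])
  then show ?thesis by (simp add: self_in_orb)
qed

text \<open>The triangularity comes from straightening: \<open>mac_op\<close> multiplies the
  alternants of the orbit by scalars, and each of these alternants expands into partitions dominated
  by \<mu>.\<close>

lemma mac_mat_triangular:
  assumes "\<mu> \<in> par n d" "mac_mat n r q t \<mu> \<nu> \<noteq> 0"
  shows "dom_le n \<nu> \<mu>"
proof -
  obtain \<alpha> where "\<alpha> \<in> orb n \<mu>" "eig n r q t \<alpha> * of_int (schur_coeff n \<alpha> \<nu>) \<noteq> 0"
    using assms(2) unfolding mac_mat_def by (meson sum.not_neutral_contains_not_neutral)
  then show ?thesis using schur_coeff(2)[OF assms(1)] by auto
qed

lemma mac_op_msf: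
  assumes mu: "\<mu> \<in> par n d" and inj: "inj_on y {1..n}"
  shows "mac_op n r (embK q) (embK t) (msf n \<mu>) y = (\<Sum>\<nu>\<in>par n d. embK (mac_mat n r q t \<mu> \<nu>) * msf n \<nu> y)"
proof -
  have "alt n (stair n) y * mac_op n r (embK q) (embK t) (msf n \<mu>) y =
    (\<Sum>\<alpha>\<in>orb n \<mu>. embK (eig n r q t \<alpha>) *
      (alt n (stair n) y * (\<Sum>\<nu>\<in>par n d. of_int (schur_coeff n \<alpha> \<nu>) * msf n \<nu> y)))"
    unfolding alt_stair_mult_mac_op_msf[OF inj] embK_eig by (rule sum.cong) (simp_all add: schur_coeff(3)[OF mu])
  also have "\<dots> = (\<Sum>\<alpha>\<in>orb n \<mu>. \<Sum>\<nu>\<in>par n d. alt n (stair n) y *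
      (embK (eig n r q t \<alpha>) * of_int (schur_coeff n \<alpha> \<nu>) * msf n \<nu> y))"
    by (simp add: sum_distrib_left mult_ac)
  also have "\<dots> = alt n (stair n) y * (\<Sum>\<nu>\<in>par n d. embK (mac_mat n r q t \<mu> \<nu>) * msf n \<nu> y)"
    by (subst sum.swap) (simp add: mac_mat_def embK_simps sum_distrib_left sum_distrib_right)
  finally show ?thesis using alt_stair_nonzero[OF inj] by simp
qed

definition mac_act ::
    "nat \<Rightarrow> nat \<Rightarrow> Qqt \<Rightarrow> Qqt \<Rightarrow> nat \<Rightarrow> ((nat \<Rightarrow> nat) \<Rightarrow> Qqt) \<Rightarrow> (nat \<Rightarrow> nat) \<Rightarrow> Qqt" where
  "mac_act n r q t d g \<nu> = (\<Sum>\<mu>\<in>par n d. g \<mu> * mac_mat n r q t \<mu> \<nu>)"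

lemma mac_op_sf:
  assumes inj: "inj_on y {1..n}"
  shows "mac_op n r (embK q) (embK t) (sf n d g) y = sf n d (mac_act n r q t d g) y"
proof -
  have "mac_op n r (embK q) (embK t) (sf n d g) y = (\<Sum>\<mu>\<in>par n d. embK (g \<mu>) * mac_op n r (embK q) (embK t) (msf n \<mu>) y)"
    unfolding mac_op_def sf_def sum_distrib_left by (subst sum.swap) (simp add: mult_ac)
  also have "\<dots> = (\<Sum>\<mu>\<in>par n d. \<Sum>\<nu>\<in>par n d. embK (g \<mu> * mac_mat n r q t \<mu> \<nu>) * msf n \<nu> y)"
    by (rule sum.cong) (simp_all add: mac_op_msf[OF _ inj] sum_distrib_left embK_mult mult_ac)
  also have "\<dots> = sf n d (mac_act n r q t d g) y"
    by (subst sum.swap) (simp add: sf_def mac_act_def embK_sum sum_distrib_right)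
  finally show ?thesis .
qed

definition srt :: "nat \<Rightarrow> (nat \<Rightarrow> nat) \<Rightarrow> nat \<Rightarrow> nat" where
  "srt n \<alpha> = (THE \<mu>. \<exists>d. \<mu> \<in> par n d \<and> \<alpha> \<in> orb n \<mu>)"

lemma srt_eq:
  assumes "\<mu> \<in> par n d" "\<alpha> \<in> orb n \<mu>"
  shows "srt n \<alpha> = \<mu>"
  unfolding srt_def by (rule the_equality) (use assms par_orb_disjoint in blast)+

lemma sf_eq_sum_evec: "sf n d g y = (\<Sum>\<alpha>\<in>evec n d. embK (g (srt n \<alpha>)) * mon n \<alpha> y)"
  unfolding sum_evec_orb sf_def msf_def sum_distrib_left
  by (intro sum.cong refl) (simp add: srt_eq)

lemma sf_xgen_eq_0:
  assumes "sf n d g xgen = 0" "\<mu> \<in> par n d"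
  shows "g \<mu> = 0"
proof -
  have "g (srt n \<mu>) = 0"
    by (rule xgen_independent[OF finite_evec _ assms(1)[unfolded sf_eq_sum_evec] par_evec[OF assms(2)]])
      (simp add: evec_def)
  then show ?thesis using srt_eq[OF assms(2) self_in_orb] by simp
qed

lemma sf_diff: "sf n d (\<lambda>\<mu>. g \<mu> - h \<mu>) y = sf n d g y - sf n d h y"
  by (simp add: sf_def embK_diff left_diff_distrib sum_subtractf)

lemma sf_smult: "sf n d (\<lambda>\<mu>. c * g \<mu>) y = embK c * sf n d g y"
  by (simp add: sf_def embK_mult sum_distrib_left mult.assoc)

lemma sf_xgen_eqD:
  assumes "sf n d g xgen = sf n d h xgen" "\<mu> \<in> par n d"
  shows "g \<mu> = h \<mu>"
  using sf_xgen_eq_0[of n d "\<lambda>\<mu>. g \<mu> - h \<mu>" \<mu>] assms by (simp add: sf_diff)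

lemma mac_op_cong:
  assumes "\<And>I. I \<in> rsets n r \<Longrightarrow> f (scale q I y) = g (scale q I y)"
  shows "mac_op n r q t f y = mac_op n r q t g y"
  unfolding mac_op_def by (rule sum.cong) (simp_all add: assms)

text \<open>\<open>mac_op_weighted_op\<close> with constant weight, where
  \<open>exchange_identity\<close> supplies the exchange hypothesis. The inner operator is evaluated
  at points that arise from \<open>xgen\<close> by one q-shift; their coordinates are still
  distinct, so coefficient vectors describe it there.\<close>

lemma mac_act_commute:
  assumes q: "q \<noteq> 0" "q \<noteq> 1" and t: "t \<noteq> 1" "t \<noteq> q" and nu: "\<nu> \<in> par n d"
  shows "mac_act n r q t d (mac_act n 1 q t d g) \<nu> = mac_act n 1 q t d (mac_act n r q t d g) \<nu>"
proof -
  let ?q = "embK q" and ?t = "embK t"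
  have "embK q \<noteq> embK 1" "embK t \<noteq> embK 1" using q t by (simp_all only: embK_eq_iff) auto
  then have q': "?q \<noteq> 0" "?q \<noteq> 1" and t': "?t \<noteq> 1" "?t \<noteq> ?q" using q t by auto
  have "sf n d (mac_act n r q t d (mac_act n 1 q t d g)) xgen = mac_op n r ?q ?t (sf n d (mac_act n 1 q t d g)) xgen"
    by (rule mac_op_sf[OF inj_xgen, symmetric])
  also have "\<dots> = mac_op n r ?q ?t (mac_op n 1 ?q ?t (sf n d g)) xgen"
    by (rule mac_op_cong) (rule mac_op_sf[OF inj_scale_xgen[OF q(1)], symmetric])
  also have "\<dots> = 1 * mac_op n 1 ?q ?t (mac_op n r ?q ?t (sf n d g)) xgen"
    unfolding One_nat_def mac_op_1
  proof (rule mac_op_weighted_op[OF q'(1)])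
    fix K assume K: "K \<in> rsets n (Suc r)"
    then have K': "finite K" "K \<subseteq> {1..n}" using finite_subset[of K "{1..n}"] by (simp_all add: rsets_def)
    have ne: "xgen i \<noteq> ?q * xgen k" if "i \<in> K" "k \<in> K" "i \<noteq> k" for i k
      by (rule xgen_neq[OF subsetD[OF K'(2) that(1)] subsetD[OF K'(2) that(2)] that(3)])
    have "(\<Sum>i\<in>K. \<Prod>k\<in>K - {i}. cfac ?t (xgen k) (xgen i) * cfac ?t (xgen i) (?q * xgen k)) =
      (\<Sum>i\<in>K. \<Prod>k\<in>K - {i}. cfac ?t (xgen i) (xgen k) * cfac ?t (xgen k) (?q * xgen i))"
      by (rule exchange_identity[OF K'(1) inj_on_subset[OF inj_xgen K'(2)] q' xgen_nonzero ne t'])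
    then show "(\<Sum>i\<in>K. 1 * (\<Prod>k\<in>K - {i}. cfac ?t (xgen k) (xgen i) * cfac ?t (xgen i) (?q * xgen k))) =
      1 * (\<Sum>i\<in>K. 1 * (\<Prod>k\<in>K - {i}. cfac ?t (xgen i) (xgen k) * cfac ?t (xgen k) (?q * xgen i)))" by simp
  qed simp
  also have "mac_op n 1 ?q ?t (mac_op n r ?q ?t (sf n d g)) xgen = mac_op n 1 ?q ?t (sf n d (mac_act n r q t d g)) xgen"
    by (rule mac_op_cong) (rule mac_op_sf[OF inj_scale_xgen[OF q(1)]])
  also have "\<dots> = sf n d (mac_act n 1 q t d (mac_act n r q t d g)) xgen"
    by (rule mac_op_sf[OF inj_xgen])
  finally show ?thesis unfolding mult_1_left by (rule sf_xgen_eqD[OF _ nu])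
qed

text \<open>Take \<mu> of maximal height in the support of h. By triangularity only the diagonal
  entry contributes to the coefficient at \<mu>, so whatever operator has h as an eigenvector, its
  eigenvalue is the one belonging to \<mu>. The uniqueness arguments for eigenvectors rest on
  this.\<close>

lemma ex_top_support:
  assumes "h \<mu>0 \<noteq> (0::Qqt)" "\<mu>0 \<in> par n d"
  obtains \<mu> where "\<mu> \<in> par n d" "h \<mu> \<noteq> 0"
    "\<And>r q t e. (\<And>\<nu>. \<nu> \<in> par n d \<Longrightarrow> mac_act n r q t d h \<nu> = e * h \<nu>) \<Longrightarrow> eig n r q t \<mu> = e"
proof -
  let ?A = "{\<mu>\<in>par n d. h \<mu> \<noteq> 0}"
  have fin: "finite (height n ` ?A)" by simp
  have "Max (height n ` ?A) \<in> height n ` ?A" using assms by (intro Max_in[OF fin]) auto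
  then obtain \<mu> where mu: "\<mu> \<in> par n d" "h \<mu> \<noteq> 0" and M: "Max (height n ` ?A) = height n \<mu>" by auto
  have top: "\<not> dom_less n \<mu> \<nu>" if "\<nu> \<in> par n d" "h \<nu> \<noteq> 0" for \<nu>
    using Max_ge[OF fin, of "height n \<nu>"] M that height_less[of n \<mu> \<nu> d] par_evec mu(1) by fastforce
  show thesis
  proof (rule that[OF mu])
    fix r q t e assume "\<And>\<nu>. \<nu> \<in> par n d \<Longrightarrow> mac_act n r q t d h \<nu> = e * h \<nu>"
    then have "e * h \<mu> = mac_act n r q t d h \<mu>" using mu by simp
    also have "\<dots> = (\<Sum>\<kappa>\<in>par n d. if \<kappa> = \<mu> then h \<mu> * eig n r q t \<mu> else 0)"
      unfolding mac_act_def
    proof (rule sum.cong[OF refl])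
      fix \<kappa> assume k: "\<kappa> \<in> par n d"
      show "h \<kappa> * mac_mat n r q t \<kappa> \<mu> = (if \<kappa> = \<mu> then h \<mu> * eig n r q t \<mu> else 0)"
      proof (cases "\<kappa> = \<mu>")
        case False
        then have "h \<kappa> = 0 \<or> mac_mat n r q t \<kappa> \<mu> = 0"
          using mac_mat_triangular[OF k, of r q t \<mu>] top[OF k] by (auto simp: dom_le_def)
        then show ?thesis using False by auto
      qed (simp add: mac_mat_diag[OF mu(1)])
    qed
    also have "\<dots> = h \<mu> * eig n r q t \<mu>" using mu by simp
    finally show "eig n r q t \<mu> = e" using mu by simp
  qed
qed

section \<open>Macdonald polynomials and their limit at t = 0\<close>

lemma to_fract_power: "to_fract (a ^ k) = to_fract a ^ k"
  by (induction k) simp_all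

lemma qK_eq: "qK = to_fract (monom (monom 1 1) 0)"
  by (simp add: qK_def to_fract_def monom_altdef)

lemma tK_eq: "tK = to_fract (monom 1 1)"
  by (simp add: tK_def to_fract_def monom_altdef)

lemma qK_tK_monom: "qK ^ a * tK ^ b = to_fract (monom (monom 1 a) b)"
  by (simp add: qK_eq tK_eq to_fract_power[symmetric] to_fract_mult[symmetric] monom_power mult_monom
      del: to_fract_mult)

lemma qK_power: "qK ^ a = to_fract [:monom 1 a:]"
  using qK_tK_monom[of a 0] by (simp add: monom_0)

lemma qK_power_eq_iff: "qK ^ a = qK ^ b \<longleftrightarrow> a = b"
  by (simp add: qK_power monom_eq_iff')

lemma qK_nonzero: "qK \<noteq> 0" and qK_neq_1: "qK \<noteq> 1"
  using qK_power_eq_iff[of 1 0] by (auto simp: qK_eq)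

lemma tK_nonzero: "tK \<noteq> 0" by (simp add: tK_eq)

lemma tK_neq: "tK \<noteq> 1" "tK \<noteq> qK"
proof -
  have n: "monom (monom 1 0) 1 \<noteq> monom (monom (1::rat) a) 0" for a
    by (simp add: monom_eq_iff')
  have "tK = to_fract (monom (monom 1 0) 1)" by (simp add: tK_eq)
  moreover have "1 = to_fract (monom (monom (1::rat) 0) 0)" by simp
  ultimately show "tK \<noteq> 1" "tK \<noteq> qK" unfolding qK_eq using n by (metis to_fract_eq_iff)+
qed

lemma eig_1: "eig n (Suc 0) q t \<alpha> = (\<Sum>i = 1..n. q ^ \<alpha> i * t ^ (n - i))"
  by (simp add: eig_def rsets_1 sum.reindex inj_on_def choose_two_def stair_def)

text \<open>The coefficient of t to the power n - i is q to the power of the i-th part. For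
  indeterminate t, all parts can be read off the eigenvalue of H_1.\<close>

lemma eig_1_inj:
  assumes "eig n (Suc 0) qK tK \<mu> = eig n (Suc 0) qK tK \<nu>" "\<mu> \<in> evec n d" "\<nu> \<in> evec n d'"
  shows "\<mu> = \<nu>"
proof (rule evec_eqI[OF assms(2,3)])
  fix i assume i: "i \<in> {1..n}"
  have c: "coeff (\<Sum>j = 1..n. monom (monom (1::rat) (\<alpha> j)) (n - j)) (n - i) = monom 1 (\<alpha> i)" for \<alpha>
  proof -
    have "coeff (\<Sum>j = 1..n. monom (monom (1::rat) (\<alpha> j)) (n - j)) (n - i) =
        (\<Sum>j = 1..n. if j = i then monom 1 (\<alpha> j) else 0)"
      unfolding coeff_sum by (rule sum.cong) (use i in auto)
    then show ?thesis using i by simp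
  qed
  have "(\<Sum>j = 1..n. monom (monom (1::rat) (\<mu> j)) (n - j)) = (\<Sum>j = 1..n. monom (monom 1 (\<nu> j)) (n - j))"
    using assms(1) by (simp add: eig_1 qK_tK_monom to_fract_sum[symmetric] del: to_fract_sum)
  then have "monom (1::rat) (\<mu> i) = monom 1 (\<nu> i)" using c by metis
  then show "\<mu> i = \<nu> i" by (simp add: monom_eq_iff')
qed

text \<open>Back substitution for an eigenvector of a triangular matrix \<open>C\<close> with diagonal \<open>e\<close>.\<close>
function tri_sol :: "nat \<Rightarrow> nat \<Rightarrow> ((nat \<Rightarrow> nat) \<Rightarrow> (nat \<Rightarrow> nat) \<Rightarrow> 'a::field) \<Rightarrow> ((nat \<Rightarrow> nat) \<Rightarrow> 'a) \<Rightarrow>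
    (nat \<Rightarrow> nat) \<Rightarrow> (nat \<Rightarrow> nat) \<Rightarrow> 'a" where
  "tri_sol n d C e lam \<mu> = (if \<mu> = lam then 1 else
     (\<Sum>\<nu>\<in>{\<nu>\<in>par n d. dom_less n \<mu> \<nu> \<and> dom_le n \<nu> lam \<and> \<mu> \<in> par n d \<and> lam \<in> par n d}.
        tri_sol n d C e lam \<nu> * C \<nu> \<mu>) / (e lam - e \<mu>))"
  by pat_completeness auto
termination
\<comment> \<open>The conditions \<open>\<mu> \<in> par n d\<close> and
  \<open>lam \<in> par n d\<close> in the index set serve this comparison of heights, which
  presupposes vectors of equal degree.\<close>
proof (relation "measure (\<lambda>(n, d, C, e, lam, \<mu>). height n lam - height n \<mu>)")
  fix n d lam \<mu> \<nu> and C :: "(nat \<Rightarrow> nat) \<Rightarrow> (nat \<Rightarrow> nat) \<Rightarrow> 'a" and e :: "(nat \<Rightarrow> nat) \<Rightarrow> 'a"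
  assume "\<nu> \<in> {\<nu>\<in>par n d. dom_less n \<mu> \<nu> \<and> dom_le n \<nu> lam \<and> \<mu> \<in> par n d \<and> lam \<in> par n d}"
  then have "height n \<mu> < height n \<nu>" "height n \<nu> \<le> height n lam"
    using height_less par_evec unfolding dom_le_def by (blast, fastforce simp: less_imp_le)
  then show "((n, d, C, e, lam, \<nu>), n, d, C, e, lam, \<mu>) \<in> measure (\<lambda>(n, d, C, e, lam, \<mu>). height n lam - height n \<mu>)"
    by simp
qed simp

declare tri_sol.simps [simp del]

lemma tri_sol_support:
  assumes lam: "lam \<in> par n d" and nz: "tri_sol n d C e lam \<mu> \<noteq> 0"
  shows "\<mu> \<in> par n d \<and> dom_le n \<mu> lam"
proof (cases "\<mu> = lam")
  case False
  then have "(\<Sum>\<nu>\<in>{\<nu>\<in>par n d. dom_less n \<mu> \<nu> \<and> dom_le n \<nu> lam \<and> \<mu> \<in> par n d \<and> lam \<in> par n d}.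
      tri_sol n d C e lam \<nu> * C \<nu> \<mu>) \<noteq> 0"
    using nz by (subst (asm) tri_sol.simps) (simp split: if_splits)
  then obtain \<nu> where "\<nu> \<in> par n d" "dom_less n \<mu> \<nu>" "dom_le n \<nu> lam" "\<mu> \<in> par n d"
    by (rule sum.not_neutral_contains_not_neutral) blast
  then show ?thesis using dom_less_trans[of n \<mu> \<nu> lam d] lam par_evec unfolding dom_le_def by blast
qed (use lam in \<open>simp add: dom_le_def\<close>)

lemma dom_le_antisym:
  assumes "dom_le n \<mu> \<nu>" "dom_le n \<nu> \<mu>" "\<mu> \<in> par n d" "\<nu> \<in> par n d"
  shows "\<mu> = \<nu>"
  using assms dom_less_trans[of n \<mu> \<nu> \<mu> d] par_evec dom_less_irrefl unfolding dom_le_def by blast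

text \<open>Back substitution solves the equation for H_1. For another r, commutation makes the
  defect of the eigenvalue equation an eigenvector of H_1 with the eigenvalue of \<open>lam\<close>.
  If it were nonzero, the partition given by \<open>ex_top_support\<close> would be
  \<open>lam\<close>, but the coefficient of the defect there is 0.\<close>

lemma ex_macdonald_coeffs:
  assumes lam: "lam \<in> par n d"
  obtains g where "g lam = 1" "\<And>\<mu>. g \<mu> \<noteq> 0 \<Longrightarrow> \<mu> \<in> par n d \<and> dom_le n \<mu> lam"
    "\<And>r \<nu>. \<nu> \<in> par n d \<Longrightarrow> mac_act n r qK tK d g \<nu> = eig n r qK tK lam * g \<nu>"
proof -
  let ?e = "eig n 1 qK tK" and ?C = "mac_mat n 1 qK tK"
  define g where "g = tri_sol n d ?C ?e lam"
  have g1: "g lam = 1" unfolding g_def by (subst tri_sol.simps) simp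
  have gs: "\<mu> \<in> par n d \<and> dom_le n \<mu> lam" if "g \<mu> \<noteq> 0" for \<mu>
    using tri_sol_support[OF lam] that unfolding g_def .
  \<comment> \<open>g is supported below \<open>lam\<close> and the matrix only leads downwards, so
    antisymmetry of the order leaves the diagonal entry.\<close>
  have diag: "mac_act n r qK tK d g lam = eig n r qK tK lam" for r
  proof -
    have "mac_act n r qK tK d g lam = (\<Sum>\<kappa>\<in>par n d. if \<kappa> = lam then eig n r qK tK lam else 0)"
      unfolding mac_act_def
    proof (rule sum.cong[OF refl])
      fix \<kappa> assume k: "\<kappa> \<in> par n d"
      show "g \<kappa> * mac_mat n r qK tK \<kappa> lam = (if \<kappa> = lam then eig n r qK tK lam else 0)"
      proof (cases "\<kappa> = lam")
        case False
        then have "g \<kappa> = 0 \<or> mac_mat n r qK tK \<kappa> lam = 0"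
          using gs[of \<kappa>] mac_mat_triangular[OF k, of r qK tK lam] dom_le_antisym k lam by blast
        then show ?thesis using False by auto
      qed (simp add: g1 mac_mat_diag[OF lam])
    qed
    then show ?thesis using lam by simp
  qed
  have e1: "mac_act n 1 qK tK d g \<nu> = ?e lam * g \<nu>" if nu: "\<nu> \<in> par n d" for \<nu>
  proof (cases "\<nu> = lam")
    case True
    then show ?thesis using diag[of 1] g1 by simp
  next
    case False
    let ?S = "{\<kappa>\<in>par n d. dom_less n \<nu> \<kappa> \<and> dom_le n \<kappa> lam \<and> \<nu> \<in> par n d \<and> lam \<in> par n d}"
    have "?e lam \<noteq> ?e \<nu>" using eig_1_inj par_evec[OF lam] par_evec[OF nu] False by (metis One_nat_def)
    then have rec: "(\<Sum>\<kappa>\<in>?S. g \<kappa> * ?C \<kappa> \<nu>) = g \<nu> * (?e lam - ?e \<nu>)"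
      unfolding g_def using False by (subst (2) tri_sol.simps) simp
    have "mac_act n 1 qK tK d g \<nu> = (\<Sum>\<kappa>\<in>insert \<nu> ?S. g \<kappa> * ?C \<kappa> \<nu>)"
      unfolding mac_act_def
    proof (rule sum.mono_neutral_right)
      show "\<forall>\<kappa>\<in>par n d - insert \<nu> ?S. g \<kappa> * ?C \<kappa> \<nu> = 0"
        using gs mac_mat_triangular[of _ n d 1 qK tK \<nu>] nu lam unfolding dom_le_def by auto
    qed (use nu in auto)
    also have "\<dots> = g \<nu> * ?e \<nu> + (\<Sum>\<kappa>\<in>?S. g \<kappa> * ?C \<kappa> \<nu>)"
      by (subst sum.insert) (simp_all add: mac_mat_diag[OF nu])
    finally show ?thesis unfolding rec by (simp add: algebra_simps)
  qed
  have "mac_act n r qK tK d g \<nu> = eig n r qK tK lam * g \<nu>" if nu: "\<nu> \<in> par n d" for r \<nu>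
  proof (rule ccontr)
    define h where "h \<nu> = mac_act n r qK tK d g \<nu> - eig n r qK tK lam * g \<nu>" for \<nu>
    assume "\<not> ?thesis"
    then have "h \<nu> \<noteq> 0" by (simp add: h_def)
    from this nu obtain \<mu> where mu: "\<mu> \<in> par n d" "h \<mu> \<noteq> 0"
      and top: "\<And>r q t e. (\<And>\<nu>. \<nu> \<in> par n d \<Longrightarrow> mac_act n r q t d h \<nu> = e * h \<nu>) \<Longrightarrow> eig n r q t \<mu> = e"
      using ex_top_support[of h \<nu> n d] by metis
    have lin: "mac_act n 1 qK tK d h \<nu> = mac_act n 1 qK tK d (mac_act n r qK tK d g) \<nu> -
        eig n r qK tK lam * mac_act n 1 qK tK d g \<nu>" for \<nu>
      unfolding mac_act_def[of n 1] h_def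
      by (simp add: left_diff_distrib sum_subtractf sum_distrib_left mult.assoc)
    have "mac_act n 1 qK tK d h \<nu> = ?e lam * h \<nu>" if nu: "\<nu> \<in> par n d" for \<nu>
    proof -
      have "mac_act n 1 qK tK d (mac_act n r qK tK d g) \<nu> = mac_act n r qK tK d (mac_act n 1 qK tK d g) \<nu>"
        by (rule mac_act_commute[OF qK_nonzero qK_neq_1 tK_neq nu, symmetric])
      also have "\<dots> = (\<Sum>\<mu>\<in>par n d. ?e lam * g \<mu> * mac_mat n r qK tK \<mu> \<nu>)"
        unfolding mac_act_def[of n r] by (rule sum.cong) (simp_all only: e1)
      also have "\<dots> = ?e lam * mac_act n r qK tK d g \<nu>"
        by (simp add: mac_act_def sum_distrib_left mult.assoc)
      finally show ?thesis unfolding lin e1[OF nu] by (simp add: h_def algebra_simps)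
    qed
    then have "?e \<mu> = ?e lam" by (rule top)
    then have "\<mu> = lam" using eig_1_inj par_evec[OF lam] par_evec[OF mu(1)] by (metis One_nat_def)
    then show False using mu diag[of r] g1 by (simp add: h_def)
  qed
  with that g1 gs show thesis by blast
qed

text \<open>
  \<open>t0_lim c v\<close>: \<open>c\<close> is regular at \<open>t = 0\<close>, with value \<open>v\<close> regarded as an element of \<open>\<rat>(q,t)\<close> free of \<open>t\<close>. This way
  the operators at \<open>t = 0\<close> act over the same field.
\<close>
definition t0_lim :: "Qqt \<Rightarrow> Qqt \<Rightarrow> bool" where
  "t0_lim c v \<longleftrightarrow> (\<exists>a b. poly b 0 \<noteq> 0 \<and> c = to_fract a / to_fract b \<and>
     v = to_fract [:poly a 0:] / to_fract [:poly b 0:])"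

lemma t0_limE:
  assumes "t0_lim c v"
  obtains a b where "poly b 0 \<noteq> 0" "to_fract b \<noteq> 0" "to_fract [:poly b 0:] \<noteq> 0"
    "c = to_fract a / to_fract b" "v = to_fract [:poly a 0:] / to_fract [:poly b 0:]"
  using assms unfolding t0_lim_def by fastforce

lemma to_fract_poly0:
  "to_fract [:poly (a + b) 0:] = to_fract [:poly a 0:] + to_fract [:poly b 0:]"
  "to_fract [:poly (a * b) 0:] = to_fract [:poly a 0:] * to_fract [:poly b 0:]"
  for a b :: "rat poly poly"
  by (simp_all flip: to_fract_add to_fract_mult)

lemma t0_lim_add:
  assumes "t0_lim c v" "t0_lim c' v'"
  shows "t0_lim (c + c') (v + v')"
proof -
  obtain a b where ab: "poly b 0 \<noteq> 0" "to_fract b \<noteq> 0" "to_fract [:poly b 0:] \<noteq> 0"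
    "c = to_fract a / to_fract b" "v = to_fract [:poly a 0:] / to_fract [:poly b 0:]"
    using assms(1) by (rule t0_limE)
  obtain a' b' where ab': "poly b' 0 \<noteq> 0" "to_fract b' \<noteq> 0" "to_fract [:poly b' 0:] \<noteq> 0"
    "c' = to_fract a' / to_fract b'" "v' = to_fract [:poly a' 0:] / to_fract [:poly b' 0:]"
    using assms(2) by (rule t0_limE)
  show ?thesis unfolding t0_lim_def
  proof (rule exI[of _ "a * b' + a' * b"], rule exI[of _ "b * b'"], intro conjI)
    show "c + c' = to_fract (a * b' + a' * b) / to_fract (b * b')"
      unfolding ab(4) ab'(4) to_fract_add to_fract_mult by (rule add_frac_eq[OF ab(2) ab'(2)])
    show "v + v' = to_fract [:poly (a * b' + a' * b) 0:] / to_fract [:poly (b * b') 0:]"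
      unfolding ab(5) ab'(5) to_fract_poly0 by (rule add_frac_eq[OF ab(3) ab'(3)])
  qed (use ab ab' in simp)
qed

lemma t0_lim_mult:
  assumes "t0_lim c v" "t0_lim c' v'"
  shows "t0_lim (c * c') (v * v')"
proof -
  obtain a b where ab: "poly b 0 \<noteq> 0"
    "c = to_fract a / to_fract b" "v = to_fract [:poly a 0:] / to_fract [:poly b 0:]"
    using assms(1) by (rule t0_limE)
  obtain a' b' where ab': "poly b' 0 \<noteq> 0"
    "c' = to_fract a' / to_fract b'" "v' = to_fract [:poly a' 0:] / to_fract [:poly b' 0:]"
    using assms(2) by (rule t0_limE)
  show ?thesis unfolding t0_lim_def
  proof (rule exI[of _ "a * a'"], rule exI[of _ "b * b'"], intro conjI)
    show "v * v' = to_fract [:poly (a * a') 0:] / to_fract [:poly (b * b') 0:]"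
      unfolding ab(3) ab'(3) to_fract_poly0 by simp
  qed (use ab ab' in simp_all)
qed

lemma t0_lim_divide:
  assumes "t0_lim c v" "t0_lim c' v'" "v' \<noteq> 0"
  shows "t0_lim (c / c') (v / v')"
proof -
  obtain a b where ab: "poly b 0 \<noteq> 0"
    "c' = to_fract a / to_fract b" "v' = to_fract [:poly a 0:] / to_fract [:poly b 0:]"
    using assms(2) by (rule t0_limE)
  have "poly a 0 \<noteq> 0" using assms(3) ab by auto
  then have "t0_lim (inverse c') (inverse v')"
    unfolding t0_lim_def using ab by (intro exI[of _ b] exI[of _ a]) simp
  then show ?thesis unfolding divide_inverse by (rule t0_lim_mult[OF assms(1)])
qed

lemma t0_lim_unique:
  assumes "t0_lim c v" "t0_lim c v'"
  shows "v = v'"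
proof -
  obtain a b where ab: "poly b 0 \<noteq> 0" "to_fract b \<noteq> 0" "to_fract [:poly b 0:] \<noteq> 0"
    "c = to_fract a / to_fract b" "v = to_fract [:poly a 0:] / to_fract [:poly b 0:]"
    using assms(1) by (rule t0_limE)
  obtain a' b' where ab': "poly b' 0 \<noteq> 0" "to_fract b' \<noteq> 0" "to_fract [:poly b' 0:] \<noteq> 0"
    "c = to_fract a' / to_fract b'" "v' = to_fract [:poly a' 0:] / to_fract [:poly b' 0:]"
    using assms(2) by (rule t0_limE)
  have "to_fract (a * b') = to_fract (a' * b)"
    using ab(2,4) ab'(2,4) by (simp add: frac_eq_eq)
  then have "a * b' = a' * b" by (simp only: to_fract_eq_iff)
  then have "to_fract [:poly a 0:] * to_fract [:poly b' 0:] = to_fract [:poly a' 0:] * to_fract [:poly b 0:]"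
    unfolding to_fract_poly0[symmetric] by simp
  then show ?thesis unfolding ab(5) ab'(5) frac_eq_eq[OF ab(3) ab'(3)] .
qed

lemma t0_lim_const: "t0_lim (to_fract [:a:]) (to_fract [:a:])"
  unfolding t0_lim_def by (intro exI[of _ "[:a:]"] exI[of _ 1]) (simp flip: one_pCons)

lemma to_fract_of_int: "to_fract (of_int k) = of_int k"
proof -
  have "to_fract (of_nat m) = of_nat m" for m by (induction m) simp_all
  then show ?thesis by (cases k rule: int_cases2) simp_all
qed

lemma t0_lim_of_int: "t0_lim (of_int k) (of_int k)"
  using t0_lim_const[of "of_int k"] by (simp add: of_int_poly[symmetric] to_fract_of_int)

lemma t0_lim_qK: "t0_lim qK qK"
  using t0_lim_const[of "monom 1 1"] by (simp add: qK_eq monom_0)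

lemma t0_lim_tK: "t0_lim tK 0"
  unfolding t0_lim_def by (intro exI[of _ "monom 1 1"] exI[of _ 1]) (simp add: tK_eq poly_monom flip: one_pCons)

lemma t0_lim_0: "t0_lim 0 0" and t0_lim_1: "t0_lim 1 1"
  using t0_lim_of_int[of 0] t0_lim_of_int[of 1] by simp_all

lemma t0_lim_diff: "t0_lim c v \<Longrightarrow> t0_lim c' v' \<Longrightarrow> t0_lim (c - c') (v - v')"
  using t0_lim_add[of c v "of_int (- 1) * c'" "of_int (- 1) * v'"] t0_lim_mult[OF t0_lim_of_int[of "- 1"]] by simp

lemma t0_lim_sum: "(\<And>i. i \<in> A \<Longrightarrow> t0_lim (f i) (g i)) \<Longrightarrow> t0_lim (sum f A) (sum g A)"
  by (induction A rule: infinite_finite_induct) (simp_all add: t0_lim_0 t0_lim_add)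

lemma t0_lim_power: "t0_lim c v \<Longrightarrow> t0_lim (c ^ k) (v ^ k)"
  by (induction k) (simp_all add: t0_lim_1 t0_lim_mult)

lemma t0_lim_eig: "t0_lim (eig n r qK tK \<alpha>) (eig n r qK 0 \<alpha>)"
  unfolding eig_def by (intro t0_lim_sum t0_lim_mult t0_lim_power t0_lim_qK t0_lim_tK)

lemma t0_lim_mac_mat: "t0_lim (mac_mat n r qK tK \<mu> \<nu>) (mac_mat n r qK 0 \<mu> \<nu>)"
  unfolding mac_mat_def by (intro t0_lim_sum t0_lim_mult t0_lim_eig t0_lim_of_int)

section \<open>Eigenvalues at t = 0 and regularity\<close>

definition tail :: "nat \<Rightarrow> nat \<Rightarrow> (nat \<Rightarrow> nat) \<Rightarrow> nat" where
  "tail n r \<alpha> = (\<Sum>i\<in>{n - r<..n}. \<alpha> i)"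

text \<open>The equality case of \<open>choose_two_le_sum\<close>: the largest element must equal
  the number of the smaller ones, and the rest follows by induction.\<close>

lemma eq_lessThan_of_sum:
  assumes "finite A" "\<Sum>A \<le> choose_two (card A)"
  shows "A = {..<card A}"
  using assms
proof (induction A rule: finite_linorder_max_induct)
  case (insert b A)
  have "A \<subseteq> {..<b}" using insert by auto
  then have le: "card A \<le> b" using card_mono[of "{..<b}" A] by simp
  have b: "b \<notin> A" using insert by auto
  have "b + \<Sum>A \<le> choose_two (card A) + card A" using insert b by (simp add: choose_two_Suc)
  moreover have "choose_two (card A) \<le> \<Sum>A" by (rule choose_two_le_sum[OF insert(1)])
  ultimately have "b = card A" "\<Sum>A \<le> choose_two (card A)" using le by linarith+
  then show ?case using insert b by (simp add: lessThan_Suc)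
qed simp

text \<open>Only the sets S with exponent 0 of t survive. Their staircase values are r distinct
  natural numbers of minimal sum, hence 0, ..., r - 1, and S consists of the last r indices.\<close>

lemma eig_t0:
  assumes r: "r \<le> n"
  shows "eig n r q 0 \<alpha> = q ^ tail n r \<alpha>"
proof -
  let ?T = "{n - r<..n}"
  have T: "?T \<in> rsets n r" using r by (auto simp: rsets_def)
  have uniq: "S = ?T" if S: "S \<in> rsets n r" and le: "sum (stair n) S \<le> choose_two r" for S
  proof -
    have Sn: "S \<subseteq> {1..n}" "card S = r" using S by (auto simp: rsets_def)
    have inj: "inj_on (stair n) {1..n}" by (auto simp: inj_on_def stair_def)
    have c: "card (stair n ` S) = r" using card_image[OF inj_on_subset[OF inj Sn(1)]] Sn by simp
    have "finite (stair n ` S)" using Sn finite_subset by blast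
    moreover have "\<Sum>(stair n ` S) \<le> choose_two (card (stair n ` S))"
      using le c sum.reindex[OF inj_on_subset[OF inj Sn(1)], of "\<lambda>x. x"] by simp
    ultimately have "stair n ` S = {..<r}" using eq_lessThan_of_sum c by metis
    then have "stair n i < r" if "i \<in> S" for i using that by auto
    then have "S \<subseteq> ?T" using Sn(1) by (fastforce simp: stair_def)
    then show ?thesis using Sn T by (intro card_subset_eq) (auto simp: rsets_def)
  qed
  have sT: "sum (stair n) ?T = choose_two r"
  proof (rule le_antisym)
    have "sum (stair n) ?T = (\<Sum>i<r. i)"
      by (rule sum.reindex_bij_witness[of _ "\<lambda>i. n - i" "\<lambda>i. n - i"]) (use r in \<open>auto simp: stair_def\<close>)
    also have "\<dots> = choose_two r" by (induction r) (simp_all add: choose_two_Suc choose_two_def[of 0])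
    finally show "sum (stair n) ?T \<le> choose_two r" by simp
    show "choose_two r \<le> sum (stair n) ?T" using choose_two_le_sum_stair[of ?T n] T by (simp add: rsets_def)
  qed
  have "eig n r q 0 \<alpha> = (\<Sum>S\<in>rsets n r. if S = ?T then q ^ tail n r \<alpha> else 0)"
    unfolding eig_def
  proof (rule sum.cong[OF refl])
    fix S assume S: "S \<in> rsets n r"
    show "q ^ sum \<alpha> S * 0 ^ (sum (stair n) S - choose_two r) = (if S = ?T then q ^ tail n r \<alpha> else 0)"
    proof (cases "S = ?T")
      case False
      then have "0 < sum (stair n) S - choose_two r" using uniq[OF S] by force
      then show ?thesis using False by (simp add: zero_power)
    qed (simp add: sT tail_def)
  qed
  then show ?thesis using T by simp
qed

lemma tail_Suc:
  assumes "r < n"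
  shows "tail n (Suc r) \<alpha> = \<alpha> (n - r) + tail n r \<alpha>"
proof -
  have "{n - Suc r<..n} = insert (n - r) {n - r<..n}" using assms by auto
  then show ?thesis by (simp add: tail_def)
qed

lemma tail_eqD:
  assumes "\<And>r. r \<in> {1..n} \<Longrightarrow> tail n r \<mu> = tail n r \<nu>" and "i \<in> {1..n}"
  shows "\<mu> i = \<nu> i"
proof -
  have all: "tail n r \<mu> = tail n r \<nu>" if "r \<le> n" for r
    using assms(1)[of r] that by (cases "r = 0") (auto simp: tail_def)
  show ?thesis using tail_Suc[of "n - i" n \<mu>] tail_Suc[of "n - i" n \<nu>] all[of "Suc (n - i)"] all[of "n - i"] assms(2)
    by simp
qed

lemma eig_t0_separates:
  assumes "\<mu> \<in> evec n d" "\<nu> \<in> evec n d'" "\<mu> \<noteq> \<nu>"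
  obtains r where "r \<in> {1..n}" "eig n r qK 0 \<mu> \<noteq> eig n r qK 0 \<nu>"
proof -
  have "\<exists>r\<in>{1..n}. tail n r \<mu> \<noteq> tail n r \<nu>"
    using tail_eqD[of n \<mu> \<nu>] evec_eqI[OF assms(1,2)] assms(3) by blast
  then show thesis using that by (auto simp: eig_t0 qK_power_eq_iff)
qed

text \<open>The eigenvalue equation is solved for the coefficient at \<mu>, with r chosen for this
  \<mu> so that the eigenvalues of \<open>lam\<close> and \<mu> differ even at t = 0. The
  denominator then has a nonzero limit, and the numerator involves coefficients at larger partitions
  only, which are regular by induction.\<close>

lemma macdonald_coeffs_regular:
  assumes lam: "lam \<in> par n d" and g1: "g lam = 1"
    and gs: "\<And>\<mu>. g \<mu> \<noteq> 0 \<Longrightarrow> \<mu> \<in> par n d \<and> dom_le n \<mu> lam"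
    and ev: "\<And>r \<nu>. \<nu> \<in> par n d \<Longrightarrow> mac_act n r qK tK d g \<nu> = eig n r qK tK lam * g \<nu>"
  shows "\<exists>v. t0_lim (g \<mu>) v"
proof (induction "height n lam - height n \<mu>" arbitrary: \<mu> rule: less_induct)
  case less
  show ?case
  proof (cases "g \<mu> = 0 \<or> \<mu> = lam")
    case True
    then show ?thesis using t0_lim_0 t0_lim_1 g1 by (metis)
  next
    case False
    then have mu: "\<mu> \<in> par n d" "dom_less n \<mu> lam" using gs[of \<mu>] by (auto simp: dom_le_def)
    obtain r where r: "eig n r qK 0 lam \<noteq> eig n r qK 0 \<mu>"
      using eig_t0_separates[OF par_evec[OF lam] par_evec[OF mu(1)]] False by metis
    have "\<exists>w. t0_lim (g \<kappa> * mac_mat n r qK tK \<kappa> \<mu>) w" if k: "\<kappa> \<in> par n d - {\<mu>}" for \<kappa>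
    proof (cases "g \<kappa> = 0 \<or> mac_mat n r qK tK \<kappa> \<mu> = 0")
      case True
      then show ?thesis using t0_lim_0 by auto
    next
      case nz: False
      have "dom_less n \<mu> \<kappa>" using mac_mat_triangular[of \<kappa> n d r qK tK \<mu>] k nz by (auto simp: dom_le_def)
      then have "height n \<mu> < height n \<kappa>" using height_less par_evec mu k by blast
      moreover have "height n \<kappa> \<le> height n lam"
        using gs[of \<kappa>] nz height_less[of n \<kappa> lam d] par_evec lam by (fastforce simp: dom_le_def)
      ultimately have "height n lam - height n \<kappa> < height n lam - height n \<mu>" by arith
      from less[OF this] obtain v where "t0_lim (g \<kappa>) v" by blast
      then show ?thesis using t0_lim_mult t0_lim_mac_mat by blast
    qed
    then obtain w where w: "t0_lim (g \<kappa> * mac_mat n r qK tK \<kappa> \<mu>) (w \<kappa>)" if "\<kappa> \<in> par n d - {\<mu>}" for \<kappa>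
      by metis
    let ?e = "eig n r qK tK lam - eig n r qK tK \<mu>" and ?f = "eig n r qK 0 lam - eig n r qK 0 \<mu>"
    have e: "t0_lim ?e ?f" by (rule t0_lim_diff[OF t0_lim_eig t0_lim_eig])
    have "?e \<noteq> 0"
    proof
      assume "?e = 0"
      then have "?f = 0" using e t0_lim_0 t0_lim_unique by metis
      then show False using r by simp
    qed
    moreover have "eig n r qK tK lam * g \<mu> = g \<mu> * eig n r qK tK \<mu> +
        (\<Sum>\<kappa>\<in>par n d - {\<mu>}. g \<kappa> * mac_mat n r qK tK \<kappa> \<mu>)"
      unfolding ev[OF mu(1), symmetric] mac_act_def mac_mat_diag[OF mu(1), symmetric]
      by (rule sum.remove) (use mu in auto)
    ultimately have "g \<mu> = (\<Sum>\<kappa>\<in>par n d - {\<mu>}. g \<kappa> * mac_mat n r qK tK \<kappa> \<mu>) / ?e"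
      by (simp add: field_simps)
    moreover have "t0_lim ((\<Sum>\<kappa>\<in>par n d - {\<mu>}. g \<kappa> * mac_mat n r qK tK \<kappa> \<mu>) / ?e)
        ((\<Sum>\<kappa>\<in>par n d - {\<mu>}. w \<kappa>) / ?f)"
      using r by (intro t0_lim_divide e t0_lim_sum w) auto
    ultimately show ?thesis by auto
  qed
qed

lemma ex_macdonald_t0_coeffs:
  assumes lam: "lam \<in> par n d" and g1: "g lam = 1"
    and gs: "\<And>\<mu>. g \<mu> \<noteq> 0 \<Longrightarrow> \<mu> \<in> par n d \<and> dom_le n \<mu> lam"
    and ev: "\<And>r \<nu>. \<nu> \<in> par n d \<Longrightarrow> mac_act n r qK tK d g \<nu> = eig n r qK tK lam * g \<nu>"
  obtains h where "\<And>\<mu>. t0_lim (g \<mu>) (h \<mu>)" "h lam = 1"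
    "\<And>\<mu>. h \<mu> \<noteq> 0 \<Longrightarrow> \<mu> \<in> par n d \<and> dom_le n \<mu> lam"
    "\<And>r \<nu>. \<nu> \<in> par n d \<Longrightarrow> mac_act n r qK 0 d h \<nu> = eig n r qK 0 lam * h \<nu>"
proof -
  obtain h where h: "t0_lim (g \<mu>) (h \<mu>)" for \<mu>
    using macdonald_coeffs_regular[OF assms] by metis
  show thesis
  proof (rule that[of h])
    show "h lam = 1" using h[of lam] g1 t0_lim_1 t0_lim_unique by metis
    show "\<mu> \<in> par n d \<and> dom_le n \<mu> lam" if "h \<mu> \<noteq> 0" for \<mu>
    proof (rule gs, rule notI)
      assume "g \<mu> = 0"
      then show False using that h[of \<mu>] t0_lim_0 t0_lim_unique by metis
    qed
    show "mac_act n r qK 0 d h \<nu> = eig n r qK 0 lam * h \<nu>" if nu: "\<nu> \<in> par n d" for r \<nu>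
    proof (rule t0_lim_unique)
      show "t0_lim (mac_act n r qK tK d g \<nu>) (mac_act n r qK 0 d h \<nu>)"
        unfolding mac_act_def by (intro t0_lim_sum t0_lim_mult h t0_lim_mac_mat)
      show "t0_lim (mac_act n r qK tK d g \<nu>) (eig n r qK 0 lam * h \<nu>)"
        unfolding ev[OF nu] by (intro t0_lim_mult h t0_lim_eig)
    qed
  qed (rule h)
qed

section \<open>Joint eigenfunctions at t = 0\<close>

text \<open>The coefficient vector of the function E of the overview, known as a q-Whittaker
  polynomial.\<close>

definition is_qw :: "nat \<Rightarrow> nat \<Rightarrow> (nat \<Rightarrow> nat) \<Rightarrow> ((nat \<Rightarrow> nat) \<Rightarrow> Qqt) \<Rightarrow> bool" where
  "is_qw n d lam h \<longleftrightarrow> h lam = 1 \<and> (\<forall>\<mu>. h \<mu> \<noteq> 0 \<longrightarrow> \<mu> \<in> par n d \<and> dom_le n \<mu> lam) \<and>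
    (\<forall>r\<in>{1..n}. \<forall>\<nu>\<in>par n d. mac_act n r qK 0 d h \<nu> = qK ^ tail n r lam * h \<nu>)"

definition qw :: "nat \<Rightarrow> (nat \<Rightarrow> nat) \<Rightarrow> (nat \<Rightarrow> nat) \<Rightarrow> Qqt" where
  "qw n lam = (SOME h. is_qw n (\<Sum>i = 1..n. lam i) lam h)"

text \<open>The exponents e are arbitrary, so that the lemma also covers joint eigenvalues belonging
  to no partition at all; such an h vanishes on \<open>par n d\<close>.\<close>

lemma t0_joint_eigen:
  assumes ev: "\<And>r \<nu>. r \<in> {1..n} \<Longrightarrow> \<nu> \<in> par n d \<Longrightarrow> mac_act n r qK 0 d h \<nu> = qK ^ e r * h \<nu>"
    and none: "\<And>\<rho>. \<rho> \<in> par n d \<Longrightarrow> (\<And>r. r \<in> {1..n} \<Longrightarrow> tail n r \<rho> = e r) \<Longrightarrow> h \<rho> = 0"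
    and mu: "\<mu> \<in> par n d"
  shows "h \<mu> = 0"
proof (rule ccontr)
  assume "h \<mu> \<noteq> 0"
  from this mu obtain \<rho> where rho: "\<rho> \<in> par n d" "h \<rho> \<noteq> 0"
    and top: "\<And>r q t e. (\<And>\<nu>. \<nu> \<in> par n d \<Longrightarrow> mac_act n r q t d h \<nu> = e * h \<nu>) \<Longrightarrow> eig n r q t \<rho> = e"
    using ex_top_support[of h \<mu> n d] by metis
  have "tail n r \<rho> = e r" if r: "r \<in> {1..n}" for r
    using top[of r qK 0 "qK ^ e r"] ev[OF r] r by (simp add: eig_t0 qK_power_eq_iff)
  then show False using none rho by blast
qed

lemma t0_joint_eigen_unique:
  assumes lam: "lam \<in> par n d" and h: "is_qw n d lam h"
    and ev: "\<And>r \<nu>. r \<in> {1..n} \<Longrightarrow> \<nu> \<in> par n d \<Longrightarrow> mac_act n r qK 0 d g \<nu> = qK ^ tail n r lam * g \<nu>"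
    and mu: "\<mu> \<in> par n d"
  shows "g \<mu> = g lam * h \<mu>"
proof -
  define f where "f \<nu> = g \<nu> - g lam * h \<nu>" for \<nu>
  have "f \<mu> = 0"
  proof (rule t0_joint_eigen[OF _ _ mu])
    fix r \<nu> assume r: "r \<in> {1..n}" and nu: "\<nu> \<in> par n d"
    have "mac_act n r qK 0 d f \<nu> = mac_act n r qK 0 d g \<nu> - g lam * mac_act n r qK 0 d h \<nu>"
      by (simp add: mac_act_def f_def left_diff_distrib sum_subtractf sum_distrib_left mult.assoc)
    also have "\<dots> = qK ^ tail n r lam * f \<nu>"
      using ev[OF r nu] h r nu by (simp add: is_qw_def f_def algebra_simps)
    finally show "mac_act n r qK 0 d f \<nu> = qK ^ tail n r lam * f \<nu>" .
  next
    fix \<rho> assume rho: "\<rho> \<in> par n d" "\<And>r. r \<in> {1..n} \<Longrightarrow> tail n r \<rho> = tail n r lam"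
    have "\<rho> = lam" by (rule evec_eqI[OF par_evec[OF rho(1)] par_evec[OF lam]]) (rule tail_eqD[OF rho(2)])
    then show "f \<rho> = 0" using h by (simp add: f_def is_qw_def)
  qed
  then show ?thesis by (simp add: f_def)
qed

lemma ex_is_qw:
  assumes lam: "lam \<in> par n d"
  obtains h where "is_qw n d lam h"
proof -
  obtain g where g: "g lam = 1" "\<And>\<mu>. g \<mu> \<noteq> 0 \<Longrightarrow> \<mu> \<in> par n d \<and> dom_le n \<mu> lam"
    "\<And>r \<nu>. \<nu> \<in> par n d \<Longrightarrow> mac_act n r qK tK d g \<nu> = eig n r qK tK lam * g \<nu>"
    using ex_macdonald_coeffs[OF lam] by metis
  obtain h where "h lam = 1" "\<And>\<mu>. h \<mu> \<noteq> 0 \<Longrightarrow> \<mu> \<in> par n d \<and> dom_le n \<mu> lam"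
    "\<And>r \<nu>. \<nu> \<in> par n d \<Longrightarrow> mac_act n r qK 0 d h \<nu> = eig n r qK 0 lam * h \<nu>"
    using ex_macdonald_t0_coeffs[OF lam g] by metis
  then show thesis by (intro that[of h]) (simp add: is_qw_def eig_t0)
qed

lemma is_qw_qw:
  assumes "lam \<in> par n d"
  shows "is_qw n d lam (qw n lam)"
proof -
  have d: "(\<Sum>i = 1..n. lam i) = d" using assms by (simp add: par_def evec_def)
  obtain h where "is_qw n d lam h" by (rule ex_is_qw[OF assms])
  then show ?thesis unfolding qw_def d by (rule someI[of "is_qw n d lam"])
qed

lemma qw_eqI:
  assumes lam: "lam \<in> par n d" and h: "is_qw n d lam h" and mu: "\<mu> \<in> par n d"
  shows "h \<mu> = qw n lam \<mu>"
  using t0_joint_eigen_unique[OF lam is_qw_qw[OF lam] _ mu, of h] h unfolding is_qw_def by simp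

lemma qw_self: "lam \<in> par n d \<Longrightarrow> qw n lam lam = 1"
  using is_qw_qw unfolding is_qw_def by blast

lemma qw_support: "lam \<in> par n d \<Longrightarrow> qw n lam \<mu> \<noteq> 0 \<Longrightarrow> \<mu> \<in> par n d \<and> dom_le n \<mu> lam"
  using is_qw_qw unfolding is_qw_def by blast

lemma qw_eigen:
  "lam \<in> par n d \<Longrightarrow> r \<in> {1..n} \<Longrightarrow> \<nu> \<in> par n d \<Longrightarrow>
    mac_act n r qK 0 d (qw n lam) \<nu> = qK ^ tail n r lam * qw n lam \<nu>"
  using is_qw_qw unfolding is_qw_def by blast

lemma mac_op_qw:
  assumes lam: "lam \<in> par n d" and r: "r \<in> {1..n}" and inj: "inj_on y {1..n}"
  shows "mac_op n r (embK qK) 0 (sf n d (qw n lam)) y = embK (qK ^ tail n r lam) * sf n d (qw n lam) y"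
proof -
  have "mac_op n r (embK qK) (embK 0) (sf n d (qw n lam)) y = sf n d (\<lambda>\<nu>. qK ^ tail n r lam * qw n lam \<nu>) y"
    unfolding mac_op_sf[OF inj] sf_def by (rule sum.cong) (simp_all add: qw_eigen[OF lam r])
  then show ?thesis by (simp add: sf_smult)
qed

section \<open>Setting the last variable to 0\<close>

lemma srt_evec:
  assumes "\<alpha> \<in> evec n d"
  shows "srt n \<alpha> \<in> par n d" "\<alpha> \<in> orb n (srt n \<alpha>)"
  using ex_par_orb[OF assms] srt_eq by metis+

lemma srt_par: "\<mu> \<in> par n d \<Longrightarrow> srt n \<mu> = \<mu>"
  using srt_eq self_in_orb by blast

lemma srt_compose:
  assumes "\<alpha> \<in> evec n d" "\<pi> permutes {1..n}"
  shows "srt n (\<alpha> \<circ> \<pi>) = srt n \<alpha>"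
proof (rule srt_eq[OF srt_evec(1)[OF assms(1)]])
  obtain \<rho> where r: "\<rho> permutes {1..n}" "\<alpha> = srt n \<alpha> \<circ> \<rho>"
    using srt_evec(2)[OF assms(1)] by (auto simp: orb_def)
  have "\<rho> \<circ> \<pi> \<in> {\<pi>. \<pi> permutes {1..n}}" using permutes_compose[OF assms(2) r(1)] by simp
  moreover have "\<alpha> \<circ> \<pi> = srt n \<alpha> \<circ> (\<rho> \<circ> \<pi>)" using r(2) by (metis o_assoc)
  ultimately show "\<alpha> \<circ> \<pi> \<in> orb n (srt n \<alpha>)" unfolding orb_def by blast
qed

lemma evec_Suc_iff: "\<alpha> \<in> evec m d \<longleftrightarrow> \<alpha> \<in> evec (Suc m) d \<and> \<alpha> (Suc m) = 0"
proof
  assume "\<alpha> \<in> evec m d"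
  then show "\<alpha> \<in> evec (Suc m) d \<and> \<alpha> (Suc m) = 0" by (auto simp: evec_def)
next
  assume a: "\<alpha> \<in> evec (Suc m) d \<and> \<alpha> (Suc m) = 0"
  then have "\<alpha> i = 0" if "i \<notin> {1..m}" for i
    using that by (cases "i = Suc m") (auto simp: evec_def)
  then show "\<alpha> \<in> evec m d" using a by (auto simp: evec_def)
qed

lemma par_Suc_iff: "\<mu> \<in> par m d \<longleftrightarrow> \<mu> \<in> par (Suc m) d \<and> \<mu> (Suc m) = 0"
proof -
  have "(\<forall>i\<in>{1..<Suc m}. \<mu> (i + 1) \<le> \<mu> i) \<longleftrightarrow> (\<forall>i\<in>{1..<m}. \<mu> (i + 1) \<le> \<mu> i)" if "\<mu> (Suc m) = 0"
    using that by (auto simp: less_Suc_eq)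
  then show ?thesis using evec_Suc_iff[of \<mu> m d] by (auto simp: par_def)
qed

lemma orb_Suc: "\<alpha> \<in> orb m \<mu> \<Longrightarrow> \<alpha> \<in> orb (Suc m) \<mu>"
  unfolding orb_def by (auto intro!: imageI elim: permutes_subset)

lemma srt_Suc:
  assumes "\<alpha> \<in> evec m d"
  shows "srt (Suc m) \<alpha> = srt m \<alpha>"
  using srt_eq[of "srt m \<alpha>" "Suc m" d \<alpha>] srt_evec[OF assms] orb_Suc par_Suc_iff[of _ m d] by blast

text \<open>The coefficient at an arbitrary exponent vector; splitting off the last variable leads
  to vectors that are not decreasing.\<close>

definition qw_mon :: "nat \<Rightarrow> (nat \<Rightarrow> nat) \<Rightarrow> (nat \<Rightarrow> nat) \<Rightarrow> Qqt" where
  "qw_mon n lam \<alpha> = qw n lam (srt n \<alpha>)"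

lemma qw_mon_compose: "\<alpha> \<in> evec n d \<Longrightarrow> \<pi> permutes {1..n} \<Longrightarrow> qw_mon n lam (\<alpha> \<circ> \<pi>) = qw_mon n lam \<alpha>"
  by (simp add: qw_mon_def srt_compose)

lemma sf_qw: "sf n d (qw n lam) y = (\<Sum>\<alpha>\<in>evec n d. embK (qw_mon n lam \<alpha>) * mon n \<alpha> y)"
  by (simp add: sf_eq_sum_evec qw_mon_def)

lemma sum_evec_Suc:
  "(\<Sum>\<beta>\<in>evec (Suc m) d. F \<beta>) = (\<Sum>k\<le>d. \<Sum>\<alpha>\<in>evec m (d - k). F (\<alpha>(Suc m := k)))"
proof -
  have "(\<Sum>\<beta>\<in>evec (Suc m) d. F \<beta>) = (\<Sum>(k, \<alpha>)\<in>Sigma {..d} (\<lambda>k. evec m (d - k)). F (\<alpha>(Suc m := k)))"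
  proof (rule sum.reindex_bij_witness[of _ "\<lambda>(k, \<alpha>). \<alpha>(Suc m := k)" "\<lambda>\<beta>. (\<beta> (Suc m), \<beta>(Suc m := 0))"])
    fix \<beta> assume b: "\<beta> \<in> evec (Suc m) d"
    have "(\<Sum>i = 1..m. (\<beta>(Suc m := 0)) i) = (\<Sum>i = 1..m. \<beta> i)" by (rule sum.cong) auto
    then have "\<beta>(Suc m := 0) \<in> evec m (d - \<beta> (Suc m))" "\<beta> (Suc m) \<le> d"
      using b by (auto simp: evec_def)
    then show "(\<beta> (Suc m), \<beta>(Suc m := 0)) \<in> Sigma {..d} (\<lambda>k. evec m (d - k))" by simp
  next
    fix b assume "b \<in> Sigma {..d} (\<lambda>k. evec m (d - k))"
    then obtain k \<alpha> where b: "b = (k, \<alpha>)" "k \<le> d" "\<alpha> \<in> evec m (d - k)" by auto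
    have "(\<Sum>i = 1..m. (\<alpha>(Suc m := k)) i) = (\<Sum>i = 1..m. \<alpha> i)" by (rule sum.cong) auto
    then show "(case b of (k, \<alpha>) \<Rightarrow> \<alpha>(Suc m := k)) \<in> evec (Suc m) d" using b by (auto simp: evec_def)
    show "((case b of (k, \<alpha>) \<Rightarrow> \<alpha>(Suc m := k)) (Suc m), (case b of (k, \<alpha>) \<Rightarrow> \<alpha>(Suc m := k))(Suc m := 0)) = b"
      using b by (auto simp: evec_def fun_eq_iff)
  qed auto
  also have "\<dots> = (\<Sum>k\<le>d. \<Sum>\<alpha>\<in>evec m (d - k). F (\<alpha>(Suc m := k)))"
    by (rule sum.Sigma[symmetric]) auto
  finally show ?thesis .
qed

lemma mon_Suc_upd: "mon (Suc m) (\<alpha>(Suc m := k)) y = mon m \<alpha> y * y (Suc m) ^ k"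
  unfolding mon_Suc by (simp add: mon_def)

lemma mon_upd: "mon m \<alpha> (y(Suc m := c)) = mon m \<alpha> y"
  by (simp add: mon_def)

lemma sf_Suc_at_0: "sf (Suc m) d g (y(Suc m := 0)) = sf m d g y"
proof -
  have "sf (Suc m) d g (y(Suc m := 0)) = (\<Sum>k\<le>d. if k = 0 then sf m d g y else 0)"
    unfolding sf_eq_sum_evec[of "Suc m"] sum_evec_Suc
  proof (rule sum.cong[OF refl])
    fix k
    show "(\<Sum>\<alpha>\<in>evec m (d - k). embK (g (srt (Suc m) (\<alpha>(Suc m := k)))) * mon (Suc m) (\<alpha>(Suc m := k)) (y(Suc m := 0))) =
      (if k = 0 then sf m d g y else 0)"
    proof (cases "k = 0")
      case True
      have "embK (g (srt (Suc m) (\<alpha>(Suc m := 0)))) * mon (Suc m) (\<alpha>(Suc m := 0)) (y(Suc m := 0)) =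
          embK (g (srt m \<alpha>)) * mon m \<alpha> y" if a: "\<alpha> \<in> evec m d" for \<alpha>
      proof -
        have "\<alpha>(Suc m := 0) = \<alpha>" using a by (auto simp: evec_def fun_eq_iff)
        then show ?thesis using mon_Suc_upd[of m \<alpha> 0 "y(Suc m := 0)"] by (simp add: mon_upd srt_Suc[OF a])
      qed
      then show ?thesis using True by (simp add: sf_eq_sum_evec)
    qed (simp add: mon_Suc zero_power)
  qed
  then show ?thesis by simp
qed

text \<open>If the last index lies outside I, each factor joining it to an element of I has
  numerator 0. If it lies in I, its factors have equal numerator and denominator. So exactly the
  sets containing the last index survive, and r + 1 drops to r together with the number of
  variables.\<close>

lemma mac_op_at_0:
  fixes y :: "nat \<Rightarrow> 'a::field"
  assumes y: "\<And>i. i \<in> {1..m} \<Longrightarrow> y i \<noteq> 0"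
  shows "mac_op (Suc m) (Suc r) q 0 f (y(Suc m := 0)) = mac_op m r q 0 (\<lambda>y. f (y(Suc m := 0))) y"
proof -
  let ?y = "y(Suc m := 0)"
  have fin: "finite I" if "I \<in> rsets n r" for I n r using that finite_subset by (auto simp: rsets_def)
  have "mac_op (Suc m) (Suc r) q 0 f ?y =
      (\<Sum>I\<in>{I\<in>rsets (Suc m) (Suc r). Suc m \<in> I}. mac_coeff (Suc m) 0 I ?y * f (scale q I ?y))"
    unfolding mac_op_def
  proof (rule sum.mono_neutral_right)
    show "\<forall>I\<in>rsets (Suc m) (Suc r) - {I\<in>rsets (Suc m) (Suc r). Suc m \<in> I}.
        mac_coeff (Suc m) 0 I ?y * f (scale q I ?y) = 0"
    proof
      fix I assume I: "I \<in> rsets (Suc m) (Suc r) - {I\<in>rsets (Suc m) (Suc r). Suc m \<in> I}"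
      then obtain i where i: "i \<in> I" by (fastforce simp: rsets_def)
      have mem: "Suc m \<in> {1..Suc m} - I" using I by auto
      have "(\<Prod>j\<in>{1..Suc m} - I. (0 * ?y i - ?y j) / (?y i - ?y j)) = 0"
        by (rule prod_zero, simp, rule bexI[OF _ mem], simp)
      then have ex: "\<exists>i\<in>I. (\<Prod>j\<in>{1..Suc m} - I. (0 * ?y i - ?y j) / (?y i - ?y j)) = 0" using i by blast
      have "finite I" using I fin[of I "Suc m" "Suc r"] by simp
      then have "mac_coeff (Suc m) 0 I ?y = 0" unfolding mac_coeff_def using ex by (rule prod_zero)
      then show "mac_coeff (Suc m) 0 I ?y * f (scale q I ?y) = 0" by simp
    qed
  qed auto
  also have "\<dots> = (\<Sum>I\<in>rsets m r. mac_coeff m 0 I y * f ((scale q I y)(Suc m := 0)))"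
  proof (rule sum.reindex_bij_witness[of _ "insert (Suc m)" "\<lambda>I. I - {Suc m}"])
    fix I assume "I \<in> {I\<in>rsets (Suc m) (Suc r). Suc m \<in> I}"
    then have I: "I \<subseteq> {1..Suc m}" "card I = Suc r" "Suc m \<in> I" "finite I"
      using fin[of I "Suc m" "Suc r"] by (simp_all add: rsets_def)
    define J where "J = I - {Suc m}"
    have J: "I = insert (Suc m) J" "Suc m \<notin> J" "finite J" "J \<subseteq> {1..m}" using I by (auto simp: J_def atLeastAtMostSuc_conv)
    have O: "{1..Suc m} - I = {1..m} - J" using J by (auto simp: atLeastAtMostSuc_conv)
    have "mac_coeff (Suc m) 0 I ?y = (\<Prod>j\<in>{1..m} - J. (- y j) / (- y j)) *
        (\<Prod>i\<in>J. \<Prod>j\<in>{1..m} - J. (0 * y i - y j) / (y i - y j))"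
      unfolding mac_coeff_def O unfolding J(1) prod.insert[OF J(3,2)]
      by (intro arg_cong2[of _ _ _ _ "(*)"] prod.cong refl) (use J in auto)
    also have "(\<Prod>j\<in>{1..m} - J. (- y j) / (- y j)) = 1" using y by (intro prod.neutral) auto
    finally have "mac_coeff (Suc m) 0 I ?y = mac_coeff m 0 J y" by (simp add: mac_coeff_def)
    moreover have "scale q I ?y = (scale q J y)(Suc m := 0)" using J by (auto simp: scale_def fun_eq_iff)
    ultimately show "mac_coeff m 0 (I - {Suc m}) y * f ((scale q (I - {Suc m}) y)(Suc m := 0)) =
        mac_coeff (Suc m) 0 I ?y * f (scale q I ?y)" by (simp add: J_def)
    show "insert (Suc m) (I - {Suc m}) = I" using I by auto
    show "I - {Suc m} \<in> rsets m r" using J I by (auto simp: rsets_def)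
  next
    fix J assume "J \<in> rsets m r"
    then have J: "J \<subseteq> {1..m}" "card J = r" "finite J" using fin[of J m r] by (simp_all add: rsets_def)
    then have "Suc m \<notin> J" by auto
    then show "insert (Suc m) J - {Suc m} = J" "insert (Suc m) J \<in> {I\<in>rsets (Suc m) (Suc r). Suc m \<in> I}"
      using J by (auto simp: rsets_def)
  qed
  finally show ?thesis by (simp add: mac_op_def)
qed

lemma dom_le_Suc:
  assumes "dom_le (Suc m) \<mu> lam" "\<mu> \<in> par m d" "lam \<in> par m d"
  shows "dom_le m \<mu> lam"
  using assms unfolding dom_le_def dom_less_def by (auto simp: par_def evec_def)

text \<open>By \<open>mac_op_at_0\<close> the restriction of E to last variable 0 is a joint
  eigenfunction in one variable less. Since the last part of \<open>lam\<close> is 0, the tail of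
  length r + 1 has the same sum as the tail of length r there, and uniqueness identifies the
  restriction.\<close>

lemma qw_mon_stable:
  assumes lam: "lam \<in> par m d" and al: "\<alpha> \<in> evec m d"
  shows "qw_mon (Suc m) lam \<alpha> = qw_mon m lam \<alpha>"
proof -
  have lam': "lam \<in> par (Suc m) d" and l0: "lam (Suc m) = 0"
    using par_Suc_iff[THEN iffD1, OF lam] by blast+
  define h where "h \<mu> = (if \<mu> \<in> par m d then qw (Suc m) lam \<mu> else 0)" for \<mu>
  have inj0: "inj_on (xgen(Suc m := 0)) {1..Suc m}"
  proof (rule inj_onI)
    fix i j assume ij: "i \<in> {1..Suc m}" "j \<in> {1..Suc m}" "(xgen(Suc m := 0)) i = (xgen(Suc m := 0)) j"
    show "i = j"
      using inj_onD[OF inj_xgen[of "Suc m"], of i j] ij xgen_nonzero[of i] xgen_nonzero[of j] by (auto split: if_splits)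
  qed
  have sfh: "sf m d h y = sf (Suc m) d (qw (Suc m) lam) (y(Suc m := 0))" for y
    unfolding sf_Suc_at_0 by (simp add: sf_def h_def)
  have "is_qw m d lam h"
    unfolding is_qw_def
  proof (intro conjI allI impI ballI)
    show "h lam = 1" using lam qw_self[OF lam'] by (simp add: h_def)
    fix \<mu> assume "h \<mu> \<noteq> 0"
    then have "\<mu> \<in> par m d" "qw (Suc m) lam \<mu> \<noteq> 0" by (auto simp: h_def split: if_splits)
    then show "\<mu> \<in> par m d" "dom_le m \<mu> lam" using qw_support[OF lam'] dom_le_Suc lam by blast+
  next
    fix r \<nu> assume r: "r \<in> {1..m}" and nu: "\<nu> \<in> par m d"
    have t: "tail (Suc m) (Suc r) lam = tail m r lam"
    proof -
      have "{Suc m - Suc r<..Suc m} = insert (Suc m) {m - r<..m}" using r by auto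
      then show ?thesis by (simp add: tail_def l0)
    qed
    have "sf m d (mac_act m r qK 0 d h) xgen = mac_op m r (embK qK) (embK 0) (sf m d h) xgen"
      by (rule mac_op_sf[OF inj_xgen, symmetric])
    also have "\<dots> = mac_op (Suc m) (Suc r) (embK qK) 0 (sf (Suc m) d (qw (Suc m) lam)) (xgen(Suc m := 0))"
      using xgen_nonzero by (subst mac_op_at_0) (simp_all add: sfh[abs_def])
    also have "\<dots> = embK (qK ^ tail (Suc m) (Suc r) lam) * sf m d h xgen"
      using r by (subst mac_op_qw[OF lam' _ inj0]) (simp_all add: sfh)
    also have "\<dots> = sf m d (\<lambda>\<nu>. qK ^ tail m r lam * h \<nu>) xgen" by (simp add: sf_smult t)
    finally show "mac_act m r qK 0 d h \<nu> = qK ^ tail m r lam * h \<nu>" by (rule sf_xgen_eqD[OF _ nu])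
  qed
  from qw_eqI[OF lam this srt_evec(1)[OF al]] show ?thesis
    using srt_evec(1)[OF al] by (simp add: qw_mon_def h_def srt_Suc[OF al])
qed

section \<open>Multiplication by the product of the variables\<close>

definition shf :: "nat \<Rightarrow> (nat \<Rightarrow> nat) \<Rightarrow> nat \<Rightarrow> nat" where
  "shf n \<alpha> i = (if i \<in> {1..n} then Suc (\<alpha> i) else 0)"

lemma shf_evec: "\<alpha> \<in> evec n d \<Longrightarrow> shf n \<alpha> \<in> evec n (d + n)"
  by (auto simp: evec_def shf_def sum.distrib[of _ "\<lambda>_. 1", simplified] sum_Suc)

lemma shf_par: "\<mu> \<in> par n d \<Longrightarrow> shf n \<mu> \<in> par n (d + n)"
  using shf_evec[of \<mu> n d] by (auto simp: par_def shf_def)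

lemma ex_shf_evec:
  assumes "\<beta> \<in> evec n d" "\<And>i. i \<in> {1..n} \<Longrightarrow> \<beta> i \<noteq> 0"
  obtains \<alpha> where "\<beta> = shf n \<alpha>" "\<alpha> \<in> evec n (d - n)" "n \<le> d"
proof -
  define \<alpha> where "\<alpha> i = \<beta> i - 1" for i
  have b: "\<beta> = shf n \<alpha>" using assms by (auto simp: shf_def \<alpha>_def evec_def fun_eq_iff)
  have "(\<Sum>i = 1..n. \<beta> i) = (\<Sum>i = 1..n. \<alpha> i + 1)"
    by (rule sum.cong) (use b in \<open>auto simp: shf_def\<close>)
  also have "\<dots> = (\<Sum>i = 1..n. \<alpha> i) + n" by (simp add: sum_Suc)
  finally have "(\<Sum>i = 1..n. \<alpha> i) + n = d" using assms by (simp add: evec_def)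
  moreover have "\<alpha> i = 0" if "i \<notin> {1..n}" for i using that assms by (auto simp: evec_def \<alpha>_def)
  ultimately show thesis by (intro that[OF b]) (auto simp: evec_def)
qed

lemma ex_shf_par:
  assumes "\<mu> \<in> par n d" "\<And>i. i \<in> {1..n} \<Longrightarrow> \<mu> i \<noteq> 0"
  obtains \<nu> where "\<mu> = shf n \<nu>" "\<nu> \<in> par n (d - n)" "n \<le> d"
proof -
  obtain \<nu> where nu: "\<mu> = shf n \<nu>" "\<nu> \<in> evec n (d - n)" "n \<le> d"
    by (rule ex_shf_evec[OF par_evec[OF assms(1)] assms(2)])
  have "\<nu> (i + 1) \<le> \<nu> i" if "i \<in> {1..<n}" for i
  proof -
    have "shf n \<nu> (i + 1) \<le> shf n \<nu> i" using assms(1) that unfolding nu(1) by (simp add: par_def)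
    then show ?thesis using that by (simp add: shf_def)
  qed
  then show thesis using nu that by (auto simp: par_def)
qed

lemma shf_inj:
  assumes "shf n \<alpha> = shf n \<beta>" "\<alpha> \<in> evec n d" "\<beta> \<in> evec n d'"
  shows "\<alpha> = \<beta>"
proof (rule evec_eqI[OF assms(2,3)])
  fix i assume "i \<in> {1..n}"
  then show "\<alpha> i = \<beta> i" using fun_cong[OF assms(1), of i] by (simp add: shf_def)
qed

lemma srt_shf:
  assumes "\<alpha> \<in> evec n d"
  shows "srt n (shf n \<alpha>) = shf n (srt n \<alpha>)"
proof (rule srt_eq[OF shf_par[OF srt_evec(1)[OF assms]]])
  obtain \<rho> where r: "\<rho> permutes {1..n}" "\<alpha> = srt n \<alpha> \<circ> \<rho>"
    using srt_evec(2)[OF assms] by (auto simp: orb_def)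
  have "shf n \<alpha> = shf n (srt n \<alpha>) \<circ> \<rho>"
    using permutes_in_image[OF r(1)] fun_cong[OF r(2)] by (auto simp: shf_def fun_eq_iff)
  then show "shf n \<alpha> \<in> orb n (shf n (srt n \<alpha>))" using r(1) by (auto simp: orb_def)
qed

lemma mon_shf: "mon n (shf n \<alpha>) y = (\<Prod>i = 1..n. y i) * mon n \<alpha> y"
  unfolding mon_def prod.distrib[symmetric] by (rule prod.cong) (simp_all add: shf_def)

lemma prod_scale:
  assumes "I \<in> rsets n r"
  shows "(\<Prod>i = 1..n. scale q I y i) = (q :: 'a::comm_ring_1) ^ r * (\<Prod>i = 1..n. y i)"
  using assms mon_scale[of I n "\<lambda>_. 1" q y] by (simp add: mon_def rsets_def)

text \<open>Shifting r variables multiplies the product of all variables by q to the power r.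
  Multiplication by that product therefore preserves joint eigenfunctions and raises the exponent of
  the r-th eigenvalue by r, as does adding 1 to every part. The second claim expresses divisibility
  by the product.\<close>

lemma qw_mon_shf:
  assumes lam: "lam \<in> par n d"
  shows "\<alpha> \<in> evec n d \<Longrightarrow> qw_mon n (shf n lam) (shf n \<alpha>) = qw_mon n lam \<alpha>"
    and "\<beta> \<in> evec n (d + n) \<Longrightarrow> i \<in> {1..n} \<Longrightarrow> \<beta> i = 0 \<Longrightarrow> qw_mon n (shf n lam) \<beta> = 0"
proof -
  have lam': "shf n lam \<in> par n (d + n)" by (rule shf_par[OF lam])
  \<comment> \<open>The coefficients of E times the product of the variables, see
    \<open>sfh\<close>.\<close>
  define h where "h \<mu> = (if \<exists>\<nu>\<in>par n d. \<mu> = shf n \<nu> then qw n lam (THE \<nu>. \<nu> \<in> par n d \<and> \<mu> = shf n \<nu>) else 0)" for \<mu>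
  have h1: "h (shf n \<nu>) = qw n lam \<nu>" if "\<nu> \<in> par n d" for \<nu>
  proof -
    have "(THE \<nu>'. \<nu>' \<in> par n d \<and> shf n \<nu> = shf n \<nu>') = \<nu>"
      using that shf_inj par_evec by (intro the_equality) blast+
    then show ?thesis using that by (auto simp: h_def)
  qed
  have h0: "h \<mu> = 0" if "\<And>\<nu>. \<nu> \<in> par n d \<Longrightarrow> \<mu> \<noteq> shf n \<nu>" for \<mu>
    using that by (auto simp: h_def)
  have sfh: "sf n (d + n) h y = (\<Prod>i = 1..n. y i) * sf n d (qw n lam) y" for y
  proof -
    have "sf n (d + n) h y = (\<Sum>\<beta>\<in>shf n ` evec n d. embK (h (srt n \<beta>)) * mon n \<beta> y)"
      unfolding sf_eq_sum_evec
    proof (rule sum.mono_neutral_right)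
      show "\<forall>\<beta>\<in>evec n (d + n) - shf n ` evec n d. embK (h (srt n \<beta>)) * mon n \<beta> y = 0"
      proof
        fix \<beta> assume b: "\<beta> \<in> evec n (d + n) - shf n ` evec n d"
        have "srt n \<beta> \<noteq> shf n \<nu>" if nu: "\<nu> \<in> par n d" for \<nu>
        proof
          assume eq: "srt n \<beta> = shf n \<nu>"
          obtain \<rho> where r: "\<rho> permutes {1..n}" "\<beta> = shf n \<nu> \<circ> \<rho>"
            using srt_evec(2)[of \<beta> n "d + n"] b eq by (auto simp: orb_def)
          have "\<beta> = shf n (\<nu> \<circ> \<rho>)"
            using permutes_in_image[OF r(1)] fun_cong[OF r(2)] by (auto simp: shf_def fun_eq_iff)
          then show False using b evec_compose[OF par_evec[OF nu] r(1)] by blast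
        qed
        then show "embK (h (srt n \<beta>)) * mon n \<beta> y = 0" using h0 by simp
      qed
    qed (use shf_evec in auto)
    also have "\<dots> = (\<Sum>\<alpha>\<in>evec n d. embK (h (srt n (shf n \<alpha>))) * mon n (shf n \<alpha>) y)"
      by (rule sum.reindex[unfolded o_def]) (use shf_inj in \<open>blast intro: inj_onI\<close>)
    also have "\<dots> = (\<Sum>\<alpha>\<in>evec n d. (\<Prod>i = 1..n. y i) * (embK (qw n lam (srt n \<alpha>)) * mon n \<alpha> y))"
      by (rule sum.cong) (simp_all add: srt_shf h1 srt_evec mon_shf mult_ac)
    finally show ?thesis by (simp add: sf_eq_sum_evec sum_distrib_left)
  qed
  have "is_qw n (d + n) (shf n lam) h"
    unfolding is_qw_def
  proof (intro conjI allI impI ballI)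
    show "h (shf n lam) = 1" using h1[OF lam] qw_self[OF lam] by simp
    fix \<mu> assume nz: "h \<mu> \<noteq> 0"
    then obtain \<nu> where nu: "\<nu> \<in> par n d" "\<mu> = shf n \<nu>" using h0 by blast
    then show "\<mu> \<in> par n (d + n)" using shf_par by blast
    have "dom_le n \<nu> lam" using nz h1[OF nu(1)] nu(2) qw_support[OF lam] by auto
    moreover have "(\<Sum>i = 1..k. shf n \<alpha> i) = (\<Sum>i = 1..k. \<alpha> i) + k" if "k \<le> n" for k \<alpha>
    proof -
      have "(\<Sum>i = 1..k. shf n \<alpha> i) = (\<Sum>i = 1..k. \<alpha> i + 1)" by (rule sum.cong) (use that in \<open>auto simp: shf_def\<close>)
      then show ?thesis by (simp add: sum_Suc)
    qed
    ultimately show "dom_le n \<mu> (shf n lam)" unfolding nu(2) dom_le_def dom_less_def by auto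
  next
    fix r \<nu> assume r: "r \<in> {1..n}" and nu: "\<nu> \<in> par n (d + n)"
    have t: "tail n r (shf n lam) = tail n r lam + r"
    proof -
      have "tail n r (shf n lam) = (\<Sum>i\<in>{n - r<..n}. lam i + 1)"
        unfolding tail_def by (rule sum.cong) (auto simp: shf_def)
      then show ?thesis using r by (simp add: tail_def sum_Suc)
    qed
    have "sf n (d + n) (mac_act n r qK 0 (d + n) h) xgen = mac_op n r (embK qK) 0 (sf n (d + n) h) xgen"
      using mac_op_sf[OF inj_xgen, of n r qK 0 "d + n" h] by simp
    also have "\<dots> = embK qK ^ r * (\<Prod>i = 1..n. xgen i) * mac_op n r (embK qK) 0 (sf n d (qw n lam)) xgen"
      unfolding mac_op_def sum_distrib_left
    proof (rule sum.cong[OF refl])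
      fix I assume I: "I \<in> rsets n r"
      show "mac_coeff n 0 I xgen * sf n (d + n) h (scale (embK qK) I xgen) = embK qK ^ r * (\<Prod>i = 1..n. xgen i) *
        (mac_coeff n 0 I xgen * sf n d (qw n lam) (scale (embK qK) I xgen))"
        unfolding sfh prod_scale[OF I] by (simp add: mult_ac)
    qed
    also have "\<dots> = embK (qK ^ tail n r (shf n lam)) * sf n (d + n) h xgen"
      by (simp add: mac_op_qw[OF lam r inj_xgen] sfh t power_add embK_simps mult_ac)
    also have "\<dots> = sf n (d + n) (\<lambda>\<nu>. qK ^ tail n r (shf n lam) * h \<nu>) xgen" by (simp add: sf_smult)
    finally show "mac_act n r qK 0 (d + n) h \<nu> = qK ^ tail n r (shf n lam) * h \<nu>" by (rule sf_xgen_eqD[OF _ nu])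
  qed
  note eq = qw_eqI[OF lam' this]
  show "qw_mon n (shf n lam) (shf n \<alpha>) = qw_mon n lam \<alpha>" if a: "\<alpha> \<in> evec n d"
    using eq[OF shf_par[OF srt_evec(1)[OF a]]] h1[OF srt_evec(1)[OF a]] by (simp add: qw_mon_def srt_shf[OF a])
  show "qw_mon n (shf n lam) \<beta> = 0" if b: "\<beta> \<in> evec n (d + n)" "i \<in> {1..n}" "\<beta> i = 0"
  proof -
    obtain \<rho> where r: "\<rho> permutes {1..n}" "\<beta> = srt n \<beta> \<circ> \<rho>"
      using srt_evec(2)[OF b(1)] by (auto simp: orb_def)
    have "srt n \<beta> (\<rho> i) = 0" using fun_cong[OF r(2), of i] b by simp
    moreover have "\<rho> i \<in> {1..n}" using permutes_in_image[OF r(1)] b by blast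
    ultimately have "srt n \<beta> \<noteq> shf n \<nu>" for \<nu> by (auto simp: shf_def)
    then show ?thesis using eq[OF srt_evec(1)[OF b(1)]] h0 by (simp add: qw_mon_def)
  qed
qed

section \<open>Branching coefficients\<close>

lemma qw_basis_unique:
  assumes eq: "\<And>\<mu>. \<mu> \<in> par m e \<Longrightarrow> (\<Sum>\<nu>\<in>par m e. c \<nu> * qw m \<nu> \<mu>) = 0" and nu: "\<nu> \<in> par m e"
  shows "c \<nu> = 0"
proof (rule ccontr)
  assume "c \<nu> \<noteq> 0"
  let ?A = "{\<mu>\<in>par m e. c \<mu> \<noteq> 0}"
  have fin: "finite (height m ` ?A)" by simp
  have "Max (height m ` ?A) \<in> height m ` ?A" using \<open>c \<nu> \<noteq> 0\<close> nu by (intro Max_in[OF fin]) auto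
  then obtain \<mu> where mu: "\<mu> \<in> par m e" "c \<mu> \<noteq> 0" and M: "Max (height m ` ?A) = height m \<mu>" by auto
  have "c \<kappa> * qw m \<kappa> \<mu> = (if \<kappa> = \<mu> then c \<mu> else 0)" if k: "\<kappa> \<in> par m e" for \<kappa>
  proof (cases "\<kappa> = \<mu> \<or> c \<kappa> = 0 \<or> qw m \<kappa> \<mu> = 0")
    case True
    then show ?thesis using mu qw_self[OF mu(1)] by auto
  next
    case False
    then have "dom_less m \<mu> \<kappa>" using qw_support[OF k, of \<mu>] by (auto simp: dom_le_def)
    then have "height m \<mu> < height m \<kappa>" using height_less par_evec k mu(1) by blast
    moreover have "height m \<kappa> \<le> height m \<mu>" unfolding M[symmetric] using k False by (intro Max_ge[OF fin]) auto
    ultimately show ?thesis by simp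
  qed
  then have "(\<Sum>\<kappa>\<in>par m e. c \<kappa> * qw m \<kappa> \<mu>) = c \<mu>" using mu by simp
  then show False using eq[OF mu(1)] mu(2) by simp
qed

text \<open>The E are unitriangular over the monomial symmetric functions, so the coefficients at
  the largest height can be removed by subtracting multiples of E; k bounds the heights that still
  occur.\<close>

lemma qw_basis_ex: "\<exists>c. \<forall>\<mu>\<in>par m e. g \<mu> = (\<Sum>\<nu>\<in>par m e. c \<nu> * qw m \<nu> \<mu>)"
proof -
  have ex: "\<exists>c. \<forall>\<mu>\<in>par m e. g \<mu> = (\<Sum>\<nu>\<in>par m e. c \<nu> * qw m \<nu> \<mu>)"
    if "\<And>\<mu>. \<mu> \<in> par m e \<Longrightarrow> k \<le> height m \<mu> \<Longrightarrow> g \<mu> = 0" for k and g :: "(nat \<Rightarrow> nat) \<Rightarrow> Qqt"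
    using that
  proof (induction k arbitrary: g)
    case 0
    then show ?case by (intro exI[of _ "\<lambda>_. 0"]) simp
  next
    case (Suc k)
    let ?T = "{\<tau>\<in>par m e. height m \<tau> = k}"
    define g' where "g' \<mu> = g \<mu> - (\<Sum>\<tau>\<in>?T. g \<tau> * qw m \<tau> \<mu>)" for \<mu>
    have low: "\<tau> = \<mu>" if "\<tau> \<in> ?T" "qw m \<tau> \<mu> \<noteq> 0" "k \<le> height m \<mu>" for \<tau> \<mu>
      using qw_support[of \<tau> m e \<mu>] that height_less[of m \<mu> \<tau> e] par_evec by (fastforce simp: dom_le_def)
    have "g' \<mu> = 0" if mu: "\<mu> \<in> par m e" "k \<le> height m \<mu>" for \<mu>
    proof -
      have "(\<Sum>\<tau>\<in>?T. g \<tau> * qw m \<tau> \<mu>) = (\<Sum>\<tau>\<in>?T. if \<tau> = \<mu> then g \<mu> else 0)"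
      proof (rule sum.cong[OF refl])
        fix \<tau> assume t: "\<tau> \<in> ?T"
        show "g \<tau> * qw m \<tau> \<mu> = (if \<tau> = \<mu> then g \<mu> else 0)"
          using low[OF t _ mu(2)] qw_self[OF mu(1)] by (cases "\<tau> = \<mu>") auto
      qed
      also have "\<dots> = g \<mu>" using mu Suc.prems[OF mu(1)] by (cases "height m \<mu> = k") auto
      finally show ?thesis by (simp add: g'_def)
    qed
    from Suc.IH[of g', OF this] obtain c where c: "\<forall>\<mu>\<in>par m e. g' \<mu> = (\<Sum>\<nu>\<in>par m e. c \<nu> * qw m \<nu> \<mu>)" by blast
    show ?case
    proof (intro exI[of _ "\<lambda>\<nu>. c \<nu> + (if height m \<nu> = k then g \<nu> else 0)"] ballI)
      fix \<mu> assume mu: "\<mu> \<in> par m e"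
      have "(\<Sum>\<nu>\<in>par m e. (if height m \<nu> = k then g \<nu> else 0) * qw m \<nu> \<mu>) = (\<Sum>\<tau>\<in>?T. g \<tau> * qw m \<tau> \<mu>)"
        by (rule sum.mono_neutral_cong_right) auto
      then show "g \<mu> = (\<Sum>\<nu>\<in>par m e. (c \<nu> + (if height m \<nu> = k then g \<nu> else 0)) * qw m \<nu> \<mu>)"
        using bspec[OF c mu] by (simp add: distrib_right sum.distrib g'_def diff_eq_eq)
    qed
  qed
  show ?thesis
  proof (rule ex)
    fix \<mu> assume "\<mu> \<in> par m e" "Suc (Max (height m ` par m e)) \<le> height m \<mu>"
    moreover from this(1) have "height m \<mu> \<le> Max (height m ` par m e)" by (intro Max_ge) auto
    ultimately show "g \<mu> = 0" by linarith
  qed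
qed

lemma qw_mon_par: "\<mu> \<in> par n d \<Longrightarrow> qw_mon n lam \<mu> = qw n lam \<mu>"
  by (simp add: qw_mon_def srt_par)

lemma qw_mon_basis_unique:
  assumes "\<And>\<alpha>. \<alpha> \<in> evec m e \<Longrightarrow> (\<Sum>\<nu>\<in>par m e. c \<nu> * qw_mon m \<nu> \<alpha>) = (\<Sum>\<nu>\<in>par m e. c' \<nu> * qw_mon m \<nu> \<alpha>)"
    and "\<nu> \<in> par m e"
  shows "c \<nu> = c' \<nu>"
proof -
  have "c \<nu> - c' \<nu> = 0"
  proof (rule qw_basis_unique[OF _ assms(2)])
    fix \<mu> assume "\<mu> \<in> par m e"
    then show "(\<Sum>\<nu>\<in>par m e. (c \<nu> - c' \<nu>) * qw m \<nu> \<mu>) = 0"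
      using assms(1)[OF par_evec] by (simp add: qw_mon_par left_diff_distrib sum_subtractf)
  qed
  then show ?thesis by simp
qed

lemma upd_evec: "\<alpha> \<in> evec m (d - k) \<Longrightarrow> k \<le> d \<Longrightarrow> \<alpha>(Suc m := k) \<in> evec (Suc m) d"
proof -
  assume a: "\<alpha> \<in> evec m (d - k)" "k \<le> d"
  have "(\<Sum>i = 1..m. (\<alpha>(Suc m := k)) i) = (\<Sum>i = 1..m. \<alpha> i)" by (rule sum.cong) auto
  then show ?thesis using a by (auto simp: evec_def)
qed

lemma upd_0_evec: "\<beta> \<in> evec (Suc m) d \<Longrightarrow> \<beta>(Suc m := 0) \<in> evec m (d - \<beta> (Suc m)) \<and> \<beta> (Suc m) \<le> d"
proof -
  assume b: "\<beta> \<in> evec (Suc m) d"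
  have "(\<Sum>i = 1..m. (\<beta>(Suc m := 0)) i) = (\<Sum>i = 1..m. \<beta> i)" by (rule sum.cong) auto
  then show ?thesis using b by (auto simp: evec_def)
qed

lemma evec_upd_0: "\<alpha> \<in> evec m e \<Longrightarrow> (\<alpha>(Suc m := k))(Suc m := 0) = \<alpha>"
  by (auto simp: evec_def fun_eq_iff)

text \<open>For each power k of the last variable the coefficient is symmetric in the other
  variables and expands in the E of degree d - k. As the degree of \<nu> gives back k, one function
  c serves all powers.\<close>

lemma ex_branch:
  assumes lam: "lam \<in> par (Suc m) d"
  shows "\<exists>c. \<forall>\<beta>\<in>evec (Suc m) d. qw_mon (Suc m) lam \<beta> =
    (\<Sum>\<nu>\<in>par m (d - \<beta> (Suc m)). c \<nu> * qw_mon m \<nu> (\<beta>(Suc m := 0)))"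
proof -
  have "\<exists>c. \<forall>\<mu>\<in>par m (d - k). qw_mon (Suc m) lam (\<mu>(Suc m := k)) = (\<Sum>\<nu>\<in>par m (d - k). c \<nu> * qw m \<nu> \<mu>)" for k
    by (rule qw_basis_ex)
  then obtain c where c: "qw_mon (Suc m) lam (\<mu>(Suc m := k)) = (\<Sum>\<nu>\<in>par m (d - k). c k \<nu> * qw m \<nu> \<mu>)"
    if "\<mu> \<in> par m (d - k)" for k \<mu> by metis
  define c' where "c' \<nu> = c (d - (\<Sum>i = 1..m. \<nu> i)) \<nu>" for \<nu>
  have c': "c' \<nu> = c k \<nu>" if "\<nu> \<in> par m (d - k)" "k \<le> d" for k \<nu>
    using that by (simp add: c'_def par_def evec_def)
  show ?thesis
  proof (intro exI[of _ c'] ballI)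
    fix \<beta> assume b: "\<beta> \<in> evec (Suc m) d"
    define k \<alpha> where "k = \<beta> (Suc m)" and "\<alpha> = \<beta>(Suc m := 0)"
    have k: "k \<le> d" and al: "\<alpha> \<in> evec m (d - k)" using upd_0_evec[OF b] by (auto simp: k_def \<alpha>_def)
    have ba: "\<beta> = \<alpha>(Suc m := k)" by (simp add: k_def \<alpha>_def)
    let ?\<mu> = "srt m \<alpha>"
    obtain \<rho> where r: "\<rho> permutes {1..m}" "\<alpha> = ?\<mu> \<circ> \<rho>" using srt_evec(2)[OF al] by (auto simp: orb_def)
    have r': "\<rho> permutes {1..Suc m}" by (rule permutes_subset[OF r(1)]) auto
    have rs: "\<rho> (Suc m) = Suc m" by (rule permutes_not_in[OF r(1)]) simp
    have "\<rho> i \<noteq> Suc m" if "i \<noteq> Suc m" for i using permutes_inj[OF r(1)] rs that by (metis injD)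
    then have "\<beta> = ?\<mu>(Suc m := k) \<circ> \<rho>" unfolding ba using rs fun_cong[OF r(2)] by (auto simp: fun_eq_iff)
    then have "qw_mon (Suc m) lam \<beta> = qw_mon (Suc m) lam (?\<mu>(Suc m := k))"
      using qw_mon_compose[OF upd_evec[OF par_evec[OF srt_evec(1)[OF al]] k] r'] by simp
    also have "\<dots> = (\<Sum>\<nu>\<in>par m (d - k). c' \<nu> * qw_mon m \<nu> \<alpha>)"
      unfolding c[OF srt_evec(1)[OF al]] by (rule sum.cong) (simp_all add: c' k qw_mon_def)
    finally show "qw_mon (Suc m) lam \<beta> = (\<Sum>\<nu>\<in>par m (d - \<beta> (Suc m)). c' \<nu> * qw_mon m \<nu> (\<beta>(Suc m := 0)))"
      unfolding k_def \<alpha>_def .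
  qed
qed

text \<open>
  The coefficient of \<open>E\<^sub>\<nu>\<close> times a power of the last variable in \<open>E\<^sub>\<lambda>\<close>; the power is determined by the
  size of \<open>\<nu>\<close>.
\<close>
definition branch :: "nat \<Rightarrow> (nat \<Rightarrow> nat) \<Rightarrow> (nat \<Rightarrow> nat) \<Rightarrow> Qqt" where
  "branch m lam = (SOME c. \<forall>\<beta>\<in>evec (Suc m) (\<Sum>i = 1..Suc m. lam i). qw_mon (Suc m) lam \<beta> =
    (\<Sum>\<nu>\<in>par m ((\<Sum>i = 1..Suc m. lam i) - \<beta> (Suc m)). c \<nu> * qw_mon m \<nu> (\<beta>(Suc m := 0))))"

lemma qw_mon_branch:
  assumes lam: "lam \<in> par (Suc m) d" and b: "\<beta> \<in> evec (Suc m) d"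
  shows "qw_mon (Suc m) lam \<beta> = (\<Sum>\<nu>\<in>par m (d - \<beta> (Suc m)). branch m lam \<nu> * qw_mon m \<nu> (\<beta>(Suc m := 0)))"
proof -
  have d: "(\<Sum>i = 1..Suc m. lam i) = d" using lam unfolding par_def evec_def by simp
  show ?thesis using someI_ex[OF ex_branch[OF lam]] b unfolding branch_def d by blast
qed

lemma qw_mon_branch':
  assumes lam: "lam \<in> par (Suc m) d" and k: "k \<le> d" and al: "\<alpha> \<in> evec m (d - k)"
  shows "qw_mon (Suc m) lam (\<alpha>(Suc m := k)) = (\<Sum>\<nu>\<in>par m (d - k). branch m lam \<nu> * qw_mon m \<nu> \<alpha>)"
  using qw_mon_branch[OF lam upd_evec[OF al k]] evec_upd_0[OF al, of k] by simp

lemma branch_eqI: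
  assumes lam: "lam \<in> par (Suc m) d" and e: "e \<le> d" and nu: "\<nu> \<in> par m e"
    and c: "\<And>\<alpha>. \<alpha> \<in> evec m e \<Longrightarrow> qw_mon (Suc m) lam (\<alpha>(Suc m := d - e)) = (\<Sum>\<nu>\<in>par m e. c \<nu> * qw_mon m \<nu> \<alpha>)"
  shows "branch m lam \<nu> = c \<nu>"
proof (rule qw_mon_basis_unique[OF _ nu])
  fix \<alpha> assume "\<alpha> \<in> evec m e"
  then show "(\<Sum>\<nu>\<in>par m e. branch m lam \<nu> * qw_mon m \<nu> \<alpha>) = (\<Sum>\<nu>\<in>par m e. c \<nu> * qw_mon m \<nu> \<alpha>)"
    using qw_mon_branch'[OF lam, of "d - e" \<alpha>] c e by simp
qed

text \<open>The part of E free of the last variable is E in one variable less, by stability.\<close>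

lemma branch_self:
  assumes lam: "lam \<in> par m d"
  shows "branch m lam lam = 1"
proof -
  have lam': "lam \<in> par (Suc m) d" using par_Suc_iff[THEN iffD1, OF lam] by blast
  have "branch m lam lam = (if lam = lam then 1 else 0)"
  proof (rule branch_eqI[OF lam' le_refl lam, of "\<lambda>\<nu>. if \<nu> = lam then 1 else 0"])
    fix \<alpha> assume al: "\<alpha> \<in> evec m d"
    then have "\<alpha>(Suc m := d - d) = \<alpha>" by (auto simp: evec_def fun_eq_iff)
    moreover have "(\<Sum>\<nu>\<in>par m d. (if \<nu> = lam then 1 else 0) * qw_mon m \<nu> \<alpha>) = (\<Sum>\<nu>\<in>par m d. if \<nu> = lam then qw_mon m lam \<alpha> else 0)"
      by (rule sum.cong) auto
    ultimately show "qw_mon (Suc m) lam (\<alpha>(Suc m := d - d)) = (\<Sum>\<nu>\<in>par m d. (if \<nu> = lam then 1 else 0) * qw_mon m \<nu> \<alpha>)"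
      using lam qw_mon_stable[OF lam al] by simp
  qed
  then show ?thesis by simp
qed

lemma shf_upd: "(shf m \<alpha>)(Suc m := Suc k) = shf (Suc m) (\<alpha>(Suc m := k))"
  by (auto simp: shf_def fun_eq_iff)

text \<open>Both sides of the branching expansion are divided by the product of all variables, which
  lowers every part of \<nu> and the power of the last variable by one. The condition
  \<open>e \<le> d + m\<close> says that this power was positive.\<close>

lemma branch_shf:
  assumes lam: "lam \<in> par (Suc m) d" and e: "e \<le> d + Suc m" and nu: "\<nu> \<in> par m e"
  shows "branch m (shf (Suc m) lam) \<nu> =
    (if e \<le> d + m \<and> (\<forall>i\<in>{1..m}. \<nu> i \<noteq> 0) then branch m lam (\<lambda>i. \<nu> i - 1) else 0)"
proof (rule branch_eqI[OF shf_par[OF lam] e nu,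
    of "\<lambda>\<nu>. if e \<le> d + m \<and> (\<forall>i\<in>{1..m}. \<nu> i \<noteq> 0) then branch m lam (\<lambda>i. \<nu> i - 1) else 0"])
  let ?c = "\<lambda>\<nu>. if e \<le> d + m \<and> (\<forall>i\<in>{1..m}. \<nu> i \<noteq> 0) then branch m lam (\<lambda>i. \<nu> i - 1) else 0"
  fix \<alpha> assume al: "\<alpha> \<in> evec m e"
  let ?k = "d + Suc m - e"
  let ?b = "\<alpha>(Suc m := ?k)"
  have b: "?b \<in> evec (Suc m) (d + Suc m)" using al e by (intro upd_evec) auto
  have unshf: "(\<lambda>i. shf m \<nu> i - 1) = \<nu>" if "\<nu> \<in> evec m j" for \<nu> j
    using that by (auto simp: shf_def evec_def fun_eq_iff)
  show "qw_mon (Suc m) (shf (Suc m) lam) ?b = (\<Sum>\<nu>\<in>par m e. ?c \<nu> * qw_mon m \<nu> \<alpha>)"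
  proof (cases "e \<le> d + m")
    case False
    then have "?b (Suc m) = 0" by simp
    then show ?thesis using qw_mon_shf(2)[OF lam b, of "Suc m"] False by simp
  next
    case le: True
    show ?thesis
    proof (cases "\<forall>i\<in>{1..m}. \<alpha> i \<noteq> 0")
      case False
      then obtain i where i: "i \<in> {1..m}" "\<alpha> i = 0" by blast
      then have "qw_mon (Suc m) (shf (Suc m) lam) ?b = 0" by (intro qw_mon_shf(2)[OF lam b, of i]) auto
      moreover have "(\<Sum>\<kappa>\<in>par m e. ?c \<kappa> * qw_mon m \<kappa> \<alpha>) = 0"
      proof (rule sum.neutral, rule ballI)
        fix \<kappa> assume k: "\<kappa> \<in> par m e"
        show "?c \<kappa> * qw_mon m \<kappa> \<alpha> = 0"
        proof (cases "\<forall>i\<in>{1..m}. \<kappa> i \<noteq> 0")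
          case True
          obtain \<tau> where t: "\<kappa> = shf m \<tau>" "\<tau> \<in> par m (e - m)" "m \<le> e"
            using ex_shf_par[OF k] True by metis
          have "qw_mon m \<kappa> \<alpha> = 0" unfolding t(1) by (rule qw_mon_shf(2)[of \<tau> m "e - m" \<alpha> i, OF t(2) _ i]) (use al t in simp)
          then show ?thesis by simp
        qed auto
      qed
      ultimately show ?thesis by simp
    next
      case True
      obtain \<gamma> where g: "\<alpha> = shf m \<gamma>" "\<gamma> \<in> evec m (e - m)" "m \<le> e"
        using ex_shf_evec[OF al] True by metis
      let ?j = "d - (e - m)"
      have j: "?k = Suc ?j" "?j \<le> d" "d - ?j = e - m" using le g(3) by auto
      have gj: "\<gamma>(Suc m := ?j) \<in> evec (Suc m) d" using g(2) j by (intro upd_evec) auto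
      have "qw_mon (Suc m) (shf (Suc m) lam) ?b = qw_mon (Suc m) lam (\<gamma>(Suc m := ?j))"
        unfolding g(1) j(1) shf_upd by (rule qw_mon_shf(1)[OF lam gj])
      also have "\<dots> = (\<Sum>\<nu>\<in>par m (e - m). branch m lam \<nu> * qw_mon m \<nu> \<gamma>)"
        using qw_mon_branch'[OF lam j(2), of \<gamma>] g(2) unfolding j(3) by blast
      also have "\<dots> = (\<Sum>\<nu>\<in>par m (e - m). ?c (shf m \<nu>) * qw_mon m (shf m \<nu>) \<alpha>)"
      proof (rule sum.cong[OF refl])
        fix \<nu> assume nu: "\<nu> \<in> par m (e - m)"
        have "\<forall>i\<in>{1..m}. shf m \<nu> i \<noteq> 0" by (simp add: shf_def)
        then have "?c (shf m \<nu>) = branch m lam \<nu>" using le unshf[OF par_evec[OF nu]] by simp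
        moreover have "qw_mon m (shf m \<nu>) \<alpha> = qw_mon m \<nu> \<gamma>" unfolding g(1) by (rule qw_mon_shf(1)[OF nu g(2)])
        ultimately show "branch m lam \<nu> * qw_mon m \<nu> \<gamma> = ?c (shf m \<nu>) * qw_mon m (shf m \<nu>) \<alpha>" by simp
      qed
      also have "\<dots> = (\<Sum>\<nu>\<in>shf m ` par m (e - m). ?c \<nu> * qw_mon m \<nu> \<alpha>)"
        by (rule sum.reindex[unfolded o_def, symmetric]) (use shf_inj par_evec in \<open>blast intro: inj_onI\<close>)
      also have "\<dots> = (\<Sum>\<nu>\<in>par m e. ?c \<nu> * qw_mon m \<nu> \<alpha>)"
      proof (rule sum.mono_neutral_left)
        show "shf m ` par m (e - m) \<subseteq> par m e" using shf_par[of _ m "e - m"] g(3) by auto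
        show "\<forall>\<nu>\<in>par m e - shf m ` par m (e - m). ?c \<nu> * qw_mon m \<nu> \<alpha> = 0"
        proof
          fix \<nu> assume nu: "\<nu> \<in> par m e - shf m ` par m (e - m)"
          have "\<not> (\<forall>i\<in>{1..m}. \<nu> i \<noteq> 0)"
          proof
            assume "\<forall>i\<in>{1..m}. \<nu> i \<noteq> 0"
            then show False using ex_shf_par[of \<nu> m e] nu by blast
          qed
          then show "?c \<nu> * qw_mon m \<nu> \<alpha> = 0" by auto
        qed
      qed simp
      finally show ?thesis .
    qed
  qed
qed

text \<open>The last two variables are exchanged by symmetry and the vacated one is set to 0. An E
  whose partition has \<open>Suc k\<close> nonzero parts is divisible by the product of its
  variables and disappears; the others become E in k variables by stability.\<close>

lemma branch_stable:
  assumes kap: "\<kappa> \<in> par (Suc k) d" and nu: "\<nu> \<in> par k e" and e: "e \<le> d"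
  shows "branch (Suc k) \<kappa> \<nu> = branch k \<kappa> \<nu>"
proof (rule branch_eqI[OF kap e nu, of "branch (Suc k) \<kappa>", symmetric])
  fix \<alpha> assume al: "\<alpha> \<in> evec k e"
  have kap': "\<kappa> \<in> par (Suc (Suc k)) d" using par_Suc_iff[THEN iffD1, OF kap] by blast
  have al': "\<alpha> \<in> evec (Suc k) e" and a0: "\<alpha> (Suc k) = 0" "\<alpha> (Suc (Suc k)) = 0"
    using evec_Suc_iff[THEN iffD1, OF al] al by (auto simp: evec_def)
  let ?j = "d - e" and ?t = "transpose (Suc k) (Suc (Suc k))"
  have b: "\<alpha>(Suc k := ?j) \<in> evec (Suc k) d" using al e by (intro upd_evec) auto
  have b': "\<alpha>(Suc (Suc k) := ?j) \<in> evec (Suc (Suc k)) d" using al' e by (intro upd_evec) auto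
  have "qw_mon (Suc k) \<kappa> (\<alpha>(Suc k := ?j)) = qw_mon (Suc (Suc k)) \<kappa> (\<alpha>(Suc k := ?j))"
    by (rule qw_mon_stable[OF kap b, symmetric])
  also have "\<dots> = qw_mon (Suc (Suc k)) \<kappa> (\<alpha>(Suc (Suc k) := ?j))"
  proof -
    have "\<alpha>(Suc k := ?j) = \<alpha>(Suc (Suc k) := ?j) \<circ> ?t"
      using a0 by (auto simp: fun_eq_iff transpose_def)
    moreover have "?t permutes {1..Suc (Suc k)}" by (rule permutes_swap_id) simp_all
    ultimately show ?thesis using qw_mon_compose[OF b'] by simp
  qed
  also have "\<dots> = (\<Sum>\<nu>\<in>par (Suc k) e. branch (Suc k) \<kappa> \<nu> * qw_mon (Suc k) \<nu> \<alpha>)"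
    using qw_mon_branch'[OF kap', of ?j \<alpha>] al' e by simp
  also have "\<dots> = (\<Sum>\<nu>\<in>par k e. branch (Suc k) \<kappa> \<nu> * qw_mon k \<nu> \<alpha>)"
  proof (rule sum.mono_neutral_cong_right)
    show "par k e \<subseteq> par (Suc k) e" using par_Suc_iff[of _ k e] by blast
    show "\<forall>\<nu>\<in>par (Suc k) e - par k e. branch (Suc k) \<kappa> \<nu> * qw_mon (Suc k) \<nu> \<alpha> = 0"
    proof
      fix \<nu> assume n: "\<nu> \<in> par (Suc k) e - par k e"
      then have "\<nu> (Suc k) \<noteq> 0" using par_Suc_iff[of \<nu> k e] by simp
      then have "\<nu> i \<noteq> 0" if "i \<in> {1..Suc k}" for i
        using par_antimono[of \<nu> "Suc k" e i "Suc k"] n that by auto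
      then obtain \<tau> where t: "\<nu> = shf (Suc k) \<tau>" "\<tau> \<in> par (Suc k) (e - Suc k)" "Suc k \<le> e"
        using ex_shf_par[of \<nu> "Suc k" e] n by blast
      have "qw_mon (Suc k) \<nu> \<alpha> = 0"
        unfolding t(1) by (rule qw_mon_shf(2)[OF t(2), of _ "Suc k"]) (use al' a0 t(3) in auto)
      then show "branch (Suc k) \<kappa> \<nu> * qw_mon (Suc k) \<nu> \<alpha> = 0" by simp
    qed
    show "branch (Suc k) \<kappa> \<nu> * qw_mon (Suc k) \<nu> \<alpha> = branch (Suc k) \<kappa> \<nu> * qw_mon k \<nu> \<alpha>" if "\<nu> \<in> par k e" for \<nu>
      using qw_mon_stable[OF that al] by simp
  qed simp
  finally show "qw_mon (Suc k) \<kappa> (\<alpha>(Suc k := d - e)) = (\<Sum>\<nu>\<in>par k e. branch (Suc k) \<kappa> \<nu> * qw_mon k \<nu> \<alpha>)" .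
qed

section \<open>The raising operator B\<close>

lemma ex_sf_power_sum_mult:
  obtains b where "\<And>y. sf n (d + 1) b y = (\<Sum>i = 1..n. y i) * sf n d g y"
proof -
  define G where "G \<alpha> = g (srt n \<alpha>)" for \<alpha>
  define H where "H \<beta> = (\<Sum>i = 1..n. if \<beta> i = 0 then 0 else G (\<beta>(i := \<beta> i - 1)))" for \<beta> :: "nat \<Rightarrow> nat"
  have dec: "\<beta>(i := \<beta> i - 1) \<in> evec n d" if b: "\<beta> \<in> evec n (d + 1)" "i \<in> {1..n}" "\<beta> i \<noteq> 0" for \<beta> i
  proof -
    have "(\<Sum>j = 1..n. (\<beta>(i := \<beta> i - 1)) j) = (\<beta> i - 1) + (\<Sum>j\<in>{1..n} - {i}. \<beta> j)"
      using b by (subst sum.remove[of _ i]) auto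
    also have "Suc \<dots> = (\<Sum>j = 1..n. \<beta> j)" using b sum.remove[of "{1..n}" i \<beta>] by simp
    finally show ?thesis using b by (auto simp: evec_def)
  qed
  have inc: "\<alpha>(i := Suc (\<alpha> i)) \<in> evec n (d + 1)" if a: "\<alpha> \<in> evec n d" "i \<in> {1..n}" for \<alpha> i
  proof -
    have "(\<Sum>j = 1..n. (\<alpha>(i := Suc (\<alpha> i))) j) = Suc (\<alpha> i) + (\<Sum>j\<in>{1..n} - {i}. \<alpha> j)"
      using a by (subst sum.remove[of _ i]) auto
    also have "\<dots> = Suc (\<Sum>j = 1..n. \<alpha> j)" using a sum.remove[of "{1..n}" i \<alpha>] by simp
    finally show ?thesis using a by (auto simp: evec_def)
  qed
  have sym: "H (\<beta> \<circ> \<pi>) = H \<beta>" if p: "\<pi> permutes {1..n}" and b: "\<beta> \<in> evec n (d + 1)" for \<pi> \<beta>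
  proof -
    have "(if (\<beta> \<circ> \<pi>) i = 0 then 0 else G ((\<beta> \<circ> \<pi>)(i := (\<beta> \<circ> \<pi>) i - 1))) =
        (if \<beta> (\<pi> i) = 0 then 0 else G (\<beta>(\<pi> i := \<beta> (\<pi> i) - 1)))" if i: "i \<in> {1..n}" for i
    proof (cases "\<beta> (\<pi> i) = 0")
      case False
      have pi: "\<pi> i \<in> {1..n}" using permutes_in_image[OF p] i by blast
      have "(\<beta> \<circ> \<pi>)(i := (\<beta> \<circ> \<pi>) i - 1) = (\<beta>(\<pi> i := \<beta> (\<pi> i) - 1)) \<circ> \<pi>"
        using permutes_inj[OF p] by (auto simp: fun_eq_iff inj_def)
      then show ?thesis using False srt_compose[OF dec[OF b pi False] p] by (simp add: G_def)
    qed simp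
    then have "H (\<beta> \<circ> \<pi>) = (\<Sum>i = 1..n. if \<beta> (\<pi> i) = 0 then 0 else G (\<beta>(\<pi> i := \<beta> (\<pi> i) - 1)))"
      unfolding H_def by (rule sum.cong[OF refl])
    also have "\<dots> = H \<beta>"
      unfolding H_def using sum.permute[OF p, of "\<lambda>i. if \<beta> i = 0 then 0 else G (\<beta>(i := \<beta> i - 1))"]
      by (simp add: o_def)
    finally show ?thesis .
  qed
  have "sf n (d + 1) H y = (\<Sum>i = 1..n. y i) * sf n d g y" for y
  proof -
    have mi: "y i * mon n \<alpha> y = mon n (\<alpha>(i := Suc (\<alpha> i))) y" if i: "i \<in> {1..n}" for \<alpha> i
    proof -
      have "(\<Prod>j\<in>{1..n} - {i}. y j ^ (\<alpha>(i := Suc (\<alpha> i))) j) = (\<Prod>j\<in>{1..n} - {i}. y j ^ \<alpha> j)"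
        by (rule prod.cong) auto
      moreover have "mon n \<gamma> y = y i ^ \<gamma> i * (\<Prod>j\<in>{1..n} - {i}. y j ^ \<gamma> j)" for \<gamma>
        unfolding mon_def by (rule prod.remove) (use i in auto)
      ultimately show ?thesis by simp
    qed
    have "(\<Sum>i = 1..n. y i) * sf n d g y = (\<Sum>i = 1..n. \<Sum>\<alpha>\<in>evec n d. embK (G \<alpha>) * mon n (\<alpha>(i := Suc (\<alpha> i))) y)"
      unfolding sf_eq_sum_evec sum_product
      by (intro sum.cong refl) (simp add: G_def mi[symmetric] mult_ac)
    also have "\<dots> = (\<Sum>i = 1..n. \<Sum>\<beta>\<in>evec n (d + 1). embK (if \<beta> i = 0 then 0 else G (\<beta>(i := \<beta> i - 1))) * mon n \<beta> y)"
    proof (rule sum.cong[OF refl])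
      fix i assume i: "i \<in> {1..n}"
      have "(\<Sum>\<beta>\<in>evec n (d + 1). embK (if \<beta> i = 0 then 0 else G (\<beta>(i := \<beta> i - 1))) * mon n \<beta> y) =
          (\<Sum>\<beta>\<in>{\<beta>\<in>evec n (d + 1). \<beta> i \<noteq> 0}. embK (G (\<beta>(i := \<beta> i - 1))) * mon n \<beta> y)"
        by (rule sum.mono_neutral_cong_right) auto
      also have "\<dots> = (\<Sum>\<alpha>\<in>evec n d. embK (G \<alpha>) * mon n (\<alpha>(i := Suc (\<alpha> i))) y)"
        by (rule sum.reindex_bij_witness[of _ "\<lambda>\<alpha>. \<alpha>(i := Suc (\<alpha> i))" "\<lambda>\<beta>. \<beta>(i := \<beta> i - 1)"])
          (use dec[OF _ i] inc[OF _ i] in auto)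
      finally show "(\<Sum>\<alpha>\<in>evec n d. embK (G \<alpha>) * mon n (\<alpha>(i := Suc (\<alpha> i))) y) =
        (\<Sum>\<beta>\<in>evec n (d + 1). embK (if \<beta> i = 0 then 0 else G (\<beta>(i := \<beta> i - 1))) * mon n \<beta> y)" ..
    qed
    also have "\<dots> = (\<Sum>\<beta>\<in>evec n (d + 1). embK (H \<beta>) * mon n \<beta> y)"
      by (subst sum.swap) (simp add: H_def embK_sum sum_distrib_right)
    also have "\<dots> = sf n (d + 1) H y"
      unfolding sf_def by (rule sum_evec_symmetric) (simp add: sym)
    finally show ?thesis ..
  qed
  then show thesis by (rule that)
qed


text \<open>
  Thus \<open>(q - 1) B\<close> is the commutator of \<open>D\<^sub>1\<close> and \<open>x\<^sub>1 + \<dots> + x\<^sub>n\<close>, whence \<open>B\<close> preserves symmetric polynomials.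
\<close>
lemma mac_op_power_sum_mult:
  fixes y :: "nat \<Rightarrow> 'a::field"
  shows "mac_op n 1 q t (\<lambda>y. (\<Sum>i = 1..n. y i) * f y) y =
    (\<Sum>i = 1..n. y i) * mac_op n 1 q t f y + (q - 1) * weighted_op n (\<lambda>x. x) q t f y"
proof -
  have s: "(\<Sum>j = 1..n. scale q {i} y j) = (\<Sum>j = 1..n. y j) + (q - 1) * y i" if i: "i \<in> {1..n}" for i
  proof -
    have "(\<Sum>j\<in>{1..n} - {i}. scale q {i} y j) = (\<Sum>j\<in>{1..n} - {i}. y j)"
      by (rule sum.cong) (auto simp: scale_def)
    moreover have "sum g {1..n} = g i + sum g ({1..n} - {i})" for g :: "nat \<Rightarrow> 'a"
      by (rule sum.remove) (use i in auto)
    ultimately show ?thesis by (simp add: scale_def algebra_simps)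
  qed
  have "mac_op n 1 q t (\<lambda>y. (\<Sum>i = 1..n. y i) * f y) y =
      (\<Sum>i = 1..n. (\<Sum>j = 1..n. y j) * (1 * mac_coeff n t {i} y * f (scale q {i} y)) +
        (q - 1) * (y i * mac_coeff n t {i} y * f (scale q {i} y)))"
    unfolding One_nat_def mac_op_1 weighted_op_def
    by (rule sum.cong) (simp_all only: s[unfolded One_nat_def], simp_all add: algebra_simps)
  then show ?thesis
    unfolding One_nat_def mac_op_1 weighted_op_def by (simp only: sum.distrib sum_distrib_left)
qed

lemma ex_weighted_op_sf:
  obtains b where "\<And>y. inj_on y {1..n} \<Longrightarrow> weighted_op n (\<lambda>x. x) (embK qK) 0 (sf n d g) y = sf n (d + 1) b y"
proof -
  obtain a where a: "sf n (d + 1) a y = (\<Sum>i = 1..n. y i) * sf n d g y" for y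
    using ex_sf_power_sum_mult[of n d g] by metis
  obtain c where c: "sf n (d + 1) c y = (\<Sum>i = 1..n. y i) * sf n d (mac_act n 1 qK 0 d g) y" for y
    using ex_sf_power_sum_mult[of n d "mac_act n 1 qK 0 d g"] by metis
  \<comment> \<open>The commutator with the power sum, divided by q - 1, in terms of
    coefficients.\<close>
  define b where "b \<mu> = inverse (qK - 1) * (mac_act n 1 qK 0 (d + 1) a \<mu> - c \<mu>)" for \<mu>
  have "weighted_op n (\<lambda>x. x) (embK qK) 0 (sf n d g) y = sf n (d + 1) b y" if inj: "inj_on y {1..n}" for y
  proof -
    have "mac_op n 1 (embK qK) 0 (sf n (d + 1) a) y = (\<Sum>i = 1..n. y i) * mac_op n 1 (embK qK) 0 (sf n d g) y +
        (embK qK - 1) * weighted_op n (\<lambda>x. x) (embK qK) 0 (sf n d g) y"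
      unfolding mac_op_power_sum_mult[symmetric] a[abs_def] ..
    moreover have "mac_op n 1 (embK qK) 0 (sf n e h) y = sf n e (mac_act n 1 qK 0 e h) y" for e h
      using mac_op_sf[OF inj, of 1 qK 0] by simp
    ultimately have A: "embK (qK - 1) * weighted_op n (\<lambda>x. x) (embK qK) 0 (sf n d g) y =
        sf n (d + 1) (\<lambda>\<mu>. mac_act n 1 qK 0 (d + 1) a \<mu> - c \<mu>) y"
      by (simp add: sf_diff c[simplified] embK_diff)
    have B: "embK (inverse (qK - 1)) * embK (qK - 1) = 1"
      using qK_neq_1 by (simp flip: embK_mult)
    show ?thesis unfolding b_def sf_smult A[symmetric] mult.assoc[symmetric] B by simp
  qed
  then show thesis by (rule that)
qed

abbreviation incr_at :: "(nat \<Rightarrow> nat) \<Rightarrow> nat \<Rightarrow> nat \<Rightarrow> nat" where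
  "incr_at lam n \<equiv> lam(n := Suc (lam n))"

text \<open>The index n belongs to the last r indices for every r from 1 to n, so raising the last
  part raises all tails by one, exactly as B does with the exponents of the joint
  eigenvalues.\<close>

lemma weighted_op_qw:
  assumes lam: "lam \<in> par n d" and n: "1 \<le> n"
  obtains K where "\<And>y. inj_on y {1..n} \<Longrightarrow>
      weighted_op n (\<lambda>x. x) (embK qK) 0 (sf n d (qw n lam)) y = embK K * sf n (d + 1) (qw n (incr_at lam n)) y"
    "incr_at lam n \<notin> par n (d + 1) \<Longrightarrow> K = 0"
proof -
  let ?q = "embK qK" and ?f = "sf n d (qw n lam)" and ?l = "incr_at lam n"
  obtain b where b: "weighted_op n (\<lambda>x. x) ?q 0 ?f y = sf n (d + 1) b y" if "inj_on y {1..n}" for y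
    using ex_weighted_op_sf[of n d "qw n lam"] by metis
  have "?q \<noteq> embK 1" using qK_neq_1 by (simp only: embK_eq_iff not_False_eq_True)
  then have q: "?q \<noteq> 0" "?q \<noteq> 1" using qK_nonzero by auto
  have ev: "mac_act n r qK 0 (d + 1) b \<nu> = qK ^ (tail n r lam + 1) * b \<nu>"
    if r: "r \<in> {1..n}" and nu: "\<nu> \<in> par n (d + 1)" for r \<nu>
  proof (rule sf_xgen_eqD[OF _ nu])
    have "sf n (d + 1) (mac_act n r qK 0 (d + 1) b) xgen = mac_op n r ?q 0 (sf n (d + 1) b) xgen"
      using mac_op_sf[OF inj_xgen, of n r qK 0 "d + 1" b] by simp
    also have "\<dots> = mac_op n r ?q 0 (weighted_op n (\<lambda>x. x) ?q 0 ?f) xgen"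
      by (rule mac_op_cong) (rule b[OF inj_scale_xgen[OF qK_nonzero], symmetric])
    also have "\<dots> = ?q * weighted_op n (\<lambda>x. x) ?q 0 (mac_op n r ?q 0 ?f) xgen"
    proof (rule mac_op_weighted_op[OF q(1)])
      fix K assume K: "K \<in> rsets n (Suc r)"
      then have K': "finite K" "K \<subseteq> {1..n}" "2 \<le> card K"
        using finite_subset[of K "{1..n}"] r by (simp_all add: rsets_def)
      have ne: "xgen i \<noteq> ?q * xgen k" if "i \<in> K" "k \<in> K" "i \<noteq> k" for i k
        by (rule xgen_neq[OF subsetD[OF K'(2) that(1)] subsetD[OF K'(2) that(2)] that(3)])
      show "(\<Sum>i\<in>K. xgen i * (\<Prod>k\<in>K - {i}. cfac 0 (xgen k) (xgen i) * cfac 0 (xgen i) (?q * xgen k))) =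
        ?q * (\<Sum>i\<in>K. xgen i * (\<Prod>k\<in>K - {i}. cfac 0 (xgen i) (xgen k) * cfac 0 (xgen k) (?q * xgen i)))"
        by (rule exchange_identity_t0[OF K'(1) inj_on_subset[OF inj_xgen K'(2)] q xgen_nonzero ne K'(3)])
    qed simp
    also have "weighted_op n (\<lambda>x. x) ?q 0 (mac_op n r ?q 0 ?f) xgen =
        embK (qK ^ tail n r lam) * weighted_op n (\<lambda>x. x) ?q 0 ?f xgen"
      unfolding weighted_op_def sum_distrib_left
      by (rule sum.cong) (simp_all add: mac_op_qw[OF lam r inj_scale_xgen[OF qK_nonzero]] mult_ac)
    also have "\<dots> = embK (qK ^ tail n r lam) * sf n (d + 1) b xgen" by (simp only: b[OF inj_xgen])
    finally show "sf n (d + 1) (mac_act n r qK 0 (d + 1) b) xgen =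
        sf n (d + 1) (\<lambda>\<nu>. qK ^ (tail n r lam + 1) * b \<nu>) xgen"
      unfolding sf_smult by (simp add: embK_simps mult_ac)
  qed
  have t: "tail n r ?l = tail n r lam + 1" if r: "r \<in> {1..n}" for r
  proof -
    have "tail n r \<alpha> = \<alpha> n + (\<Sum>i\<in>{n - r<..n} - {n}. \<alpha> i)" for \<alpha>
      unfolding tail_def by (rule sum.remove) (use r in auto)
    moreover have "(\<Sum>i\<in>{n - r<..n} - {n}. ?l i) = (\<Sum>i\<in>{n - r<..n} - {n}. lam i)" by (rule sum.cong) auto
    ultimately show ?thesis by simp
  qed
  show thesis
  proof (cases "?l \<in> par n (d + 1)")
    case True
    have ev': "mac_act n r qK 0 (d + 1) b \<nu> = qK ^ tail n r ?l * b \<nu>"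
      if r: "r \<in> {1..n}" and nu: "\<nu> \<in> par n (d + 1)" for r \<nu>
      unfolding t[OF r] by (rule ev[OF r nu])
    have "b \<mu> = b ?l * qw n ?l \<mu>" if "\<mu> \<in> par n (d + 1)" for \<mu>
      by (rule t0_joint_eigen_unique[OF True is_qw_qw[OF True] ev' that])
    then have "sf n (d + 1) b y = embK (b ?l) * sf n (d + 1) (qw n ?l) y" for y
      unfolding sf_smult[symmetric] unfolding sf_def by (intro sum.cong refl) simp
    then show thesis using that[of "b ?l"] b True by simp
  next
    case False
    \<comment> \<open>A partition with all tails raised by one would be
      \<open>incr_at lam n\<close>, which is excluded here.\<close>
    have z: "b \<mu> = 0" if "\<mu> \<in> par n (d + 1)" for \<mu>
    proof (rule t0_joint_eigen[OF ev _ that])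
      fix \<rho> assume rho: "\<rho> \<in> par n (d + 1)" "\<And>r. r \<in> {1..n} \<Longrightarrow> tail n r \<rho> = tail n r lam + 1"
      have "\<rho> i = ?l i" if "i \<in> {1..n}" for i
        by (rule tail_eqD[OF _ that]) (simp only: rho(2) t)
      moreover have "\<rho> i = ?l i" if "i \<notin> {1..n}" for i
        using that n rho(1) lam by (auto simp: par_def evec_def)
      ultimately have "\<rho> = ?l" by blast
      then show "b \<rho> = 0" using False rho(1) by simp
    qed
    then have "sf n (d + 1) b y = 0" for y by (simp add: sf_def)
    then show thesis using that[of 0] b by simp
  qed
qed

section \<open>The recursion for the branching coefficients\<close>

lemma weighted_op_split:
  fixes y :: "nat \<Rightarrow> 'a::field"
  assumes inj: "inj_on y {1..Suc m}"
  shows "weighted_op (Suc m) (\<lambda>x. x) q 0 f y =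
    y (Suc m) * (mac_op (Suc m) 1 q 0 f y - mac_op m 1 q 0 f y)"
proof -
  have tm: "y i * mac_coeff (Suc m) 0 {i} y = y (Suc m) * (mac_coeff (Suc m) 0 {i} y - mac_coeff m 0 {i} y)"
    if i: "i \<in> {1..m}" for i
  proof -
    have "{1..Suc m} - {i} = insert (Suc m) ({1..m} - {i})" using i by auto
    then have c: "mac_coeff (Suc m) 0 {i} y = (0 * y i - y (Suc m)) / (y i - y (Suc m)) * mac_coeff m 0 {i} y"
      by (simp add: mac_coeff_def)
    have "y i \<noteq> y (Suc m)" using inj_onD[OF inj, of i "Suc m"] i by auto
    then show ?thesis unfolding c by (simp add: divide_simps) (simp add: algebra_simps)
  qed
  have "weighted_op (Suc m) (\<lambda>x. x) q 0 f y =
      (\<Sum>i = 1..m. y i * mac_coeff (Suc m) 0 {i} y * f (scale q {i} y)) +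
      y (Suc m) * mac_coeff (Suc m) 0 {Suc m} y * f (scale q {Suc m} y)"
    by (simp add: weighted_op_def)
  also have "(\<Sum>i = 1..m. y i * mac_coeff (Suc m) 0 {i} y * f (scale q {i} y)) =
      (\<Sum>i = 1..m. y (Suc m) * (mac_coeff (Suc m) 0 {i} y * f (scale q {i} y))) -
      (\<Sum>i = 1..m. y (Suc m) * (mac_coeff m 0 {i} y * f (scale q {i} y)))"
    unfolding sum_subtractf[symmetric] by (rule sum.cong[OF refl]) (simp add: tm[unfolded One_nat_def] algebra_simps)
  finally show ?thesis
    unfolding One_nat_def mac_op_1 by (simp add: weighted_op_def sum_distrib_left algebra_simps)
qed

lemma sf_qw_branch:
  assumes lam: "lam \<in> par (Suc m) d"
  shows "sf (Suc m) d (qw (Suc m) lam) y = (\<Sum>k\<le>d. \<Sum>\<nu>\<in>par m (d - k).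
    embK (branch m lam \<nu>) * (y (Suc m) ^ k * sf m (d - k) (qw m \<nu>) y))"
  unfolding sf_qw sum_evec_Suc
proof (rule sum.cong[OF refl])
  fix k assume "k \<in> {..d}"
  then have k: "k \<le> d" by simp
  have "(\<Sum>\<alpha>\<in>evec m (d - k). embK (qw_mon (Suc m) lam (\<alpha>(Suc m := k))) * mon (Suc m) (\<alpha>(Suc m := k)) y) =
      (\<Sum>\<alpha>\<in>evec m (d - k). \<Sum>\<nu>\<in>par m (d - k). embK (branch m lam \<nu>) * (y (Suc m) ^ k * (embK (qw_mon m \<nu> \<alpha>) * mon m \<alpha> y)))"
    by (rule sum.cong[OF refl])
      (simp add: qw_mon_branch'[OF lam k] mon_Suc_upd embK_simps sum_distrib_left sum_distrib_right mult_ac)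
  then show "(\<Sum>\<alpha>\<in>evec m (d - k). embK (qw_mon (Suc m) lam (\<alpha>(Suc m := k))) * mon (Suc m) (\<alpha>(Suc m := k)) y) =
      (\<Sum>\<nu>\<in>par m (d - k). embK (branch m lam \<nu>) * (y (Suc m) ^ k * (\<Sum>\<alpha>\<in>evec m (d - k). embK (qw_mon m \<nu> \<alpha>) * mon m \<alpha> y)))"
    by (subst (asm) sum.swap) (simp add: sum_distrib_left)
qed

text \<open>The operator in the first m variables leaves the last one untouched and acts on each E
  by q to the power of the last part of its partition.\<close>

lemma mac_op_1_sf_qw:
  assumes lam: "lam \<in> par (Suc m) d" and m: "1 \<le> m"
  shows "mac_op m 1 (embK qK) 0 (sf (Suc m) d (qw (Suc m) lam)) xgen = (\<Sum>k\<le>d. \<Sum>\<nu>\<in>par m (d - k).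
    embK (qK ^ \<nu> m * branch m lam \<nu>) * (xgen (Suc m) ^ k * sf m (d - k) (qw m \<nu>) xgen))"
proof -
  let ?q = "embK qK"
  have "mac_op m 1 ?q 0 (sf (Suc m) d (qw (Suc m) lam)) xgen =
      (\<Sum>I\<in>rsets m 1. \<Sum>k\<le>d. \<Sum>\<nu>\<in>par m (d - k). embK (branch m lam \<nu>) *
        (xgen (Suc m) ^ k * (mac_coeff m 0 I xgen * sf m (d - k) (qw m \<nu>) (scale ?q I xgen))))"
    unfolding mac_op_def sf_qw_branch[OF lam]
  proof (rule sum.cong[OF refl])
    fix I assume "I \<in> rsets m 1"
    then have "Suc m \<notin> I" by (auto simp: rsets_def)
    then have "scale ?q I xgen (Suc m) = xgen (Suc m)" by (simp add: scale_def)
    then show "mac_coeff m 0 I xgen * (\<Sum>k\<le>d. \<Sum>\<nu>\<in>par m (d - k).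
        embK (branch m lam \<nu>) * (scale ?q I xgen (Suc m) ^ k * sf m (d - k) (qw m \<nu>) (scale ?q I xgen))) =
      (\<Sum>k\<le>d. \<Sum>\<nu>\<in>par m (d - k). embK (branch m lam \<nu>) *
        (xgen (Suc m) ^ k * (mac_coeff m 0 I xgen * sf m (d - k) (qw m \<nu>) (scale ?q I xgen))))"
      by (simp add: sum_distrib_left mult_ac)
  qed
  also have "\<dots> = (\<Sum>k\<le>d. \<Sum>\<nu>\<in>par m (d - k). embK (branch m lam \<nu>) *
        (xgen (Suc m) ^ k * mac_op m 1 ?q 0 (sf m (d - k) (qw m \<nu>)) xgen))"
    unfolding mac_op_def sum_distrib_left by (subst sum.swap, intro sum.cong refl, rule sum.swap)
  also have "\<dots> = (\<Sum>k\<le>d. \<Sum>\<nu>\<in>par m (d - k).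
    embK (qK ^ \<nu> m * branch m lam \<nu>) * (xgen (Suc m) ^ k * sf m (d - k) (qw m \<nu>) xgen))"
  proof (intro sum.cong refl)
    fix k \<nu> assume nu: "\<nu> \<in> par m (d - k)"
    have "tail m 1 \<nu> = \<nu> m" using tail_Suc[of 0 m \<nu>] m by (simp add: tail_def)
    moreover have "mac_op m 1 ?q 0 (sf m (d - k) (qw m \<nu>)) xgen = embK (qK ^ tail m 1 \<nu>) * sf m (d - k) (qw m \<nu>) xgen"
      by (rule mac_op_qw[OF nu _ inj_xgen]) (use m in simp)
    ultimately show "embK (branch m lam \<nu>) * (xgen (Suc m) ^ k * mac_op m 1 ?q 0 (sf m (d - k) (qw m \<nu>)) xgen) =
        embK (qK ^ \<nu> m * branch m lam \<nu>) * (xgen (Suc m) ^ k * sf m (d - k) (qw m \<nu>) xgen)"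
      by (simp add: embK_mult mult_ac)
  qed
  finally show ?thesis .
qed

text \<open>Both expressions for B E are expanded in powers of the last variable times E in the
  others; the factor in front of the difference of the two operators raises the power by one, as
  does the new last part. K is identified only in \<open>branch_recursion\<close>.\<close>

lemma ex_branch_recursion:
  assumes lam: "lam \<in> par (Suc m) d" and m: "1 \<le> m"
  obtains K where
    "\<And>e \<nu>. incr_at lam (Suc m) \<in> par (Suc m) (d + 1) \<Longrightarrow> e \<le> d \<Longrightarrow> \<nu> \<in> par m e \<Longrightarrow>
      K * branch m (incr_at lam (Suc m)) \<nu> = (qK ^ lam (Suc m) - qK ^ \<nu> m) * branch m lam \<nu>"
    "\<And>e \<nu>. incr_at lam (Suc m) \<notin> par (Suc m) (d + 1) \<Longrightarrow> e \<le> d \<Longrightarrow> \<nu> \<in> par m e \<Longrightarrow>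
      (qK ^ lam (Suc m) - qK ^ \<nu> m) * branch m lam \<nu> = 0"
proof -
  let ?n = "Suc m" and ?l = "incr_at lam (Suc m)" and ?q = "embK qK"
  let ?c = "\<lambda>\<nu>. (qK ^ lam (Suc m) - qK ^ \<nu> m) * branch m lam \<nu>"
  have n1: "1 \<le> ?n" by simp
  obtain K where K: "\<And>y. inj_on y {1..?n} \<Longrightarrow>
      weighted_op ?n (\<lambda>x. x) ?q 0 (sf ?n d (qw ?n lam)) y = embK K * sf ?n (d + 1) (qw ?n ?l) y"
    and K0: "?l \<notin> par ?n (d + 1) \<Longrightarrow> K = 0"
    using weighted_op_qw[OF lam n1] by metis
  \<comment> \<open>The monomial coefficients of the right-hand side. The factor
    \<open>xgen ?n\<close> in front leaves no term free of the last variable, hence the value 0 in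
    the first case.\<close>
  define R where "R \<beta> = (if \<beta> ?n = 0 then 0 else
    (\<Sum>\<nu>\<in>par m (d + 1 - \<beta> ?n). ?c \<nu> * qw_mon m \<nu> (\<beta>(?n := 0))))" for \<beta>
  have "embK K * sf ?n (d + 1) (qw ?n ?l) xgen =
      xgen ?n * (mac_op ?n 1 ?q 0 (sf ?n d (qw ?n lam)) xgen - mac_op m 1 ?q 0 (sf ?n d (qw ?n lam)) xgen)"
    unfolding K[OF inj_xgen, symmetric] by (rule weighted_op_split[OF inj_xgen])
  also have "mac_op ?n 1 ?q 0 (sf ?n d (qw ?n lam)) xgen = embK (qK ^ tail ?n 1 lam) * sf ?n d (qw ?n lam) xgen"
    by (rule mac_op_qw[OF lam _ inj_xgen]) simp
  also have "tail ?n 1 lam = lam ?n" using tail_Suc[of 0 ?n lam] by (simp add: tail_def)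
  also have "xgen ?n * (embK (qK ^ lam ?n) * sf ?n d (qw ?n lam) xgen - mac_op m 1 ?q 0 (sf ?n d (qw ?n lam)) xgen) =
      (\<Sum>k\<le>d. \<Sum>\<nu>\<in>par m (d - k). embK (?c \<nu>) * (xgen ?n ^ Suc k * sf m (d - k) (qw m \<nu>) xgen))"
    unfolding mac_op_1_sf_qw[OF lam m] sf_qw_branch[OF lam] sum_distrib_left sum_subtractf[symmetric]
    by (intro sum.cong refl) (simp add: embK_simps algebra_simps)
  also have "\<dots> = (\<Sum>k\<le>d. \<Sum>\<alpha>\<in>evec m (d - k). embK (R (\<alpha>(?n := Suc k))) * mon ?n (\<alpha>(?n := Suc k)) xgen)"
  proof (rule sum.cong[OF refl])
    fix k assume "k \<in> {..d}"
    then have "d + 1 - Suc k = d - k" by simp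
    then have "R (\<alpha>(?n := Suc k)) = (\<Sum>\<nu>\<in>par m (d - k). ?c \<nu> * qw_mon m \<nu> \<alpha>)" if "\<alpha> \<in> evec m (d - k)" for \<alpha>
      unfolding R_def using evec_upd_0[OF that, of "Suc k"] by simp
    then have "(\<Sum>\<alpha>\<in>evec m (d - k). embK (R (\<alpha>(?n := Suc k))) * mon ?n (\<alpha>(?n := Suc k)) xgen) =
        (\<Sum>\<alpha>\<in>evec m (d - k). \<Sum>\<nu>\<in>par m (d - k). embK (?c \<nu>) * (xgen ?n ^ Suc k * (embK (qw_mon m \<nu> \<alpha>) * mon m \<alpha> xgen)))"
      by (intro sum.cong refl) (simp add: mon_Suc_upd embK_mult embK_sum sum_distrib_left sum_distrib_right mult_ac)
    then show "(\<Sum>\<nu>\<in>par m (d - k). embK (?c \<nu>) * (xgen ?n ^ Suc k * sf m (d - k) (qw m \<nu>) xgen)) =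
        (\<Sum>\<alpha>\<in>evec m (d - k). embK (R (\<alpha>(?n := Suc k))) * mon ?n (\<alpha>(?n := Suc k)) xgen)"
      unfolding sf_qw by (subst (asm) sum.swap) (simp only: sum_distrib_left)
  qed
  also have "\<dots> = (\<Sum>\<beta>\<in>evec ?n (d + 1). embK (R \<beta>) * mon ?n \<beta> xgen)"
    unfolding sum_evec_Suc by (simp add: sum.atMost_Suc_shift R_def del: sum.atMost_Suc)
  finally have "(\<Sum>\<beta>\<in>evec ?n (d + 1). embK (K * qw_mon ?n ?l \<beta> - R \<beta>) * mon ?n \<beta> xgen) = 0"
    unfolding sf_qw by (simp add: embK_diff embK_mult left_diff_distrib sum_subtractf sum_distrib_left mult.assoc)
  then have KR: "K * qw_mon ?n ?l \<beta> = R \<beta>" if "\<beta> \<in> evec ?n (d + 1)" for \<beta>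
    using xgen_independent[OF finite_evec _ _ that, of ?n "\<lambda>\<beta>. K * qw_mon ?n ?l \<beta> - R \<beta>"]
    by (fastforce simp: evec_def)
  have main: "K * qw_mon ?n ?l (\<alpha>(?n := Suc (d - e))) = (\<Sum>\<nu>\<in>par m e. ?c \<nu> * qw_mon m \<nu> \<alpha>)"
    if e: "e \<le> d" and al: "\<alpha> \<in> evec m e" for e \<alpha>
  proof -
    have "\<alpha>(?n := Suc (d - e)) \<in> evec ?n (d + 1)" by (rule upd_evec) (use e al in auto)
    moreover have "d + 1 - Suc (d - e) = e" using e by simp
    ultimately show ?thesis using KR evec_upd_0[OF al, of "Suc (d - e)"] unfolding R_def by simp
  qed
  show thesis
  proof (rule that[of K])
    fix e \<nu> assume l: "?l \<in> par ?n (d + 1)" and e: "e \<le> d" and nu: "\<nu> \<in> par m e"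
    show "K * branch m ?l \<nu> = ?c \<nu>"
    proof (rule qw_mon_basis_unique[OF _ nu])
      fix \<alpha> assume al: "\<alpha> \<in> evec m e"
      have "qw_mon ?n ?l (\<alpha>(?n := Suc (d - e))) = (\<Sum>\<nu>\<in>par m e. branch m ?l \<nu> * qw_mon m \<nu> \<alpha>)"
        using qw_mon_branch'[OF l, of "Suc (d - e)" \<alpha>] e al by simp
      then show "(\<Sum>\<nu>\<in>par m e. K * branch m ?l \<nu> * qw_mon m \<nu> \<alpha>) = (\<Sum>\<nu>\<in>par m e. ?c \<nu> * qw_mon m \<nu> \<alpha>)"
        using main[OF e al] by (simp add: sum_distrib_left mult.assoc)
    qed
  next
    fix e \<nu> assume l: "?l \<notin> par ?n (d + 1)" and e: "e \<le> d" and nu: "\<nu> \<in> par m e"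
    show "?c \<nu> = 0"
    proof (rule qw_mon_basis_unique[OF _ nu, of ?c "\<lambda>_. 0"])
      fix \<alpha> assume al: "\<alpha> \<in> evec m e"
      show "(\<Sum>\<nu>\<in>par m e. ?c \<nu> * qw_mon m \<nu> \<alpha>) = (\<Sum>\<nu>\<in>par m e. 0 * qw_mon m \<nu> \<alpha>)"
        using main[OF e al] K0[OF l] by simp
    qed
  qed
qed

section \<open>The branching formula\<close>

text \<open>Given by the q-Pascal rule instead of a quotient: without division it makes sense over
  polynomial rings and is preserved by ring homomorphisms.\<close>

fun qbinom :: "'a::comm_ring_1 \<Rightarrow> nat \<Rightarrow> nat \<Rightarrow> 'a" where
  "qbinom q n 0 = 1"
| "qbinom q 0 (Suc k) = 0"
| "qbinom q (Suc n) (Suc k) = qbinom q n k + q ^ Suc k * qbinom q n (Suc k)"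

definition qpoch :: "'a::comm_ring_1 \<Rightarrow> nat \<Rightarrow> 'a" where
  "qpoch q n = (\<Prod>k = 1..n. 1 - q ^ k)"

lemma qpoch_0 [simp]: "qpoch q 0 = 1" and qpoch_Suc: "qpoch q (Suc n) = qpoch q n * (1 - q ^ Suc n)"
  by (simp_all add: qpoch_def)

lemma qbinom_gt: "n < k \<Longrightarrow> qbinom q n k = 0"
  by (induction q n k rule: qbinom.induct) auto

lemma qbinom_self: "qbinom q n n = 1"
  by (induction n) (simp_all add: qbinom_gt)

lemma qbinom_qpoch: "k \<le> n \<Longrightarrow> qbinom q n k * qpoch q k * qpoch q (n - k) = qpoch q n"
proof (induction n arbitrary: k)
  case (Suc n)
  show ?case
  proof (cases k)
    case (Suc j)
    have 1: "qbinom q n j * qpoch q (Suc j) * qpoch q (n - j) = qpoch q n * (1 - q ^ Suc j)"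
    proof -
      have ih: "qbinom q n j * qpoch q j * qpoch q (n - j) = qpoch q n"
        using Suc.IH[of j] Suc.prems Suc by simp
      show ?thesis unfolding qpoch_Suc ih[symmetric] by (simp only: mult_ac)
    qed
    have 2: "qbinom q n (Suc j) * qpoch q (Suc j) * qpoch q (n - j) = qpoch q n * (1 - q ^ (n - j))"
    proof (cases "j = n")
      case True
      then show ?thesis by (simp add: qbinom_gt)
    next
      case False
      then have "n - j = Suc (n - Suc j)" "Suc j \<le> n" using Suc.prems Suc by auto
      then show ?thesis using Suc.IH[of "Suc j"] by (simp only: qpoch_Suc) (simp only: mult.assoc[symmetric])
    qed
    have "q ^ Suc n = q ^ Suc j * q ^ (n - j)" using Suc.prems Suc by (simp flip: power_Suc power_add)
    have "qbinom q (Suc n) k * qpoch q k * qpoch q (Suc n - k) =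
        qbinom q n j * qpoch q (Suc j) * qpoch q (n - j) +
        q ^ Suc j * (qbinom q n (Suc j) * qpoch q (Suc j) * qpoch q (n - j))"
      using Suc by (simp add: algebra_simps)
    also have "\<dots> = qpoch q n * (1 - q ^ Suc j * q ^ (n - j))" unfolding 1 2 by (simp add: algebra_simps)
    also have "\<dots> = qpoch q (Suc n)" unfolding qpoch_Suc \<open>q ^ Suc n = q ^ Suc j * q ^ (n - j)\<close> ..
    finally show ?thesis .
  qed simp
qed simp

lemma qpoch_qK_nonzero: "qpoch qK n \<noteq> 0"
  using qK_power_eq_iff[of _ 0] by (auto simp: qpoch_def)

text \<open>The last factor of \<open>branch_formula\<close> obeys the recursion in the last part: N
  is the difference of the last two parts of \<open>lam\<close> minus 1, and k is the drop from
  \<open>lam\<close> to \<nu> at the last index of \<nu>.\<close>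

lemma qbinom_qK_step:
  assumes "k \<le> N"
  shows "(1 - qK ^ Suc N) * qbinom qK N k = (1 - qK ^ (Suc N - k)) * qbinom qK (Suc N) k"
proof -
  have "qbinom qK (Suc N) k * qpoch qK k * qpoch qK (Suc (N - k)) = qpoch qK N * (1 - qK ^ Suc N)"
    using qbinom_qpoch[of k "Suc N" qK] assms by (simp add: Suc_diff_le qpoch_Suc)
  then have "(1 - qK ^ Suc (N - k)) * qbinom qK (Suc N) k * (qpoch qK k * qpoch qK (N - k)) =
      (1 - qK ^ Suc N) * qpoch qK N"
    unfolding qpoch_Suc[of _ "N - k"] by (simp only: mult_ac)
  also have "\<dots> = (1 - qK ^ Suc N) * qbinom qK N k * (qpoch qK k * qpoch qK (N - k))"
    unfolding qbinom_qpoch[OF assms, symmetric] by (simp only: mult_ac)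
  finally show ?thesis using qpoch_qK_nonzero assms by (simp add: Suc_diff_le)
qed

definition interlaced :: "nat \<Rightarrow> (nat \<Rightarrow> 'a::linorder) \<Rightarrow> (nat \<Rightarrow> 'a) \<Rightarrow> bool" where
  "interlaced m lam \<nu> \<longleftrightarrow> (\<forall>i\<in>{1..m}. lam (Suc i) \<le> \<nu> i \<and> \<nu> i \<le> lam i)"

definition branch_formula :: "'a::comm_ring_1 \<Rightarrow> nat \<Rightarrow> (nat \<Rightarrow> nat) \<Rightarrow> (nat \<Rightarrow> nat) \<Rightarrow> 'a" where
  "branch_formula q m lam \<nu> = (if interlaced m lam \<nu>
     then \<Prod>i = 1..m. qbinom q (lam i - lam (Suc i)) (lam i - \<nu> i) else 0)"

lemma interlaced_Suc: "interlaced (Suc m) lam \<nu> \<longleftrightarrow>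
    interlaced m lam \<nu> \<and> lam (Suc (Suc m)) \<le> \<nu> (Suc m) \<and> \<nu> (Suc m) \<le> lam (Suc m)"
  by (auto simp: interlaced_def atLeastAtMostSuc_conv)

lemma branch_formula_Suc: "branch_formula q (Suc m) lam \<nu> = (if lam (Suc (Suc m)) \<le> \<nu> (Suc m) \<and> \<nu> (Suc m) \<le> lam (Suc m)
    then branch_formula q m lam \<nu> * qbinom q (lam (Suc m) - lam (Suc (Suc m))) (lam (Suc m) - \<nu> (Suc m)) else 0)"
  by (simp add: branch_formula_def interlaced_Suc)

lemma branch_formula_shf: "branch_formula q m (shf (Suc m) lam) (shf m \<nu>) = branch_formula q m lam \<nu>"
proof -
  have "interlaced m (shf (Suc m) lam) (shf m \<nu>) \<longleftrightarrow> interlaced m lam \<nu>"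
    by (auto simp: interlaced_def shf_def)
  then show ?thesis by (auto simp: branch_formula_def shf_def intro!: prod.cong)
qed

lemma branch_formula_upd_above:
  "branch_formula q m (lam(Suc (Suc m) := c)) \<nu> = branch_formula q m lam \<nu>"
  by (auto simp: branch_formula_def interlaced_def intro!: prod.cong)

lemma par_upd_0:
  assumes "lam \<in> par (Suc m) d"
  shows "lam(Suc m := 0) \<in> par m (d - lam (Suc m))" "lam (Suc m) \<le> d"
  using upd_0_evec[OF par_evec[OF assms]] assms by (auto simp: par_def)

lemma par_all_nonzero:
  assumes "lam \<in> par (Suc m) d" "lam (Suc m) \<noteq> 0"
  obtains lam' d' where "lam = shf (Suc m) lam'" "lam' \<in> par (Suc m) d'" "d = d' + Suc m"
proof -
  have "lam i \<noteq> 0" if "i \<in> {1..Suc m}" for i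
    using par_antimono[OF assms(1) that, of "Suc m"] that assms(2) by auto
  then obtain lam' where "lam = shf (Suc m) lam'" "lam' \<in> par (Suc m) (d - Suc m)" "Suc m \<le> d"
    using ex_shf_par[OF assms(1)] by blast
  then show thesis by (intro that[of lam' "d - Suc m"]) auto
qed

text \<open>Division by the product of the variables lowers the last part to 0, where
  \<open>branch_self\<close> applies. This normalization determines the constant of the
  recursion.\<close>

lemma branch_drop_last:
  assumes "lam \<in> par (Suc m) d"
  shows "branch m lam (lam(Suc m := 0)) = 1"
  using assms
proof (induction "lam (Suc m)" arbitrary: lam d)
  case 0
  then have "lam \<in> par m d" using par_Suc_iff[of lam m d] by simp
  moreover have "lam(Suc m := 0) = lam" using 0 by auto
  ultimately show ?case by (simp add: branch_self)
next
  case (Suc x)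
  then obtain lam' d' where l: "lam = shf (Suc m) lam'" "lam' \<in> par (Suc m) d'" "d = d' + Suc m"
    using par_all_nonzero[of lam m d] by (metis nat.distinct(1))
  have x: "x = lam' (Suc m)" using Suc.hyps(2) l by (simp add: shf_def)
  have nu: "lam(Suc m := 0) = shf m (lam'(Suc m := 0))" unfolding l(1) by (auto simp: shf_def fun_eq_iff)
  let ?e = "d' - lam' (Suc m) + m"
  have "lam(Suc m := 0) \<in> par m ?e" unfolding nu by (rule shf_par[OF par_upd_0(1)[OF l(2)]])
  from branch_shf[OF l(2) _ this] have "branch m lam (lam(Suc m := 0)) = branch m lam' (\<lambda>i. (lam(Suc m := 0)) i - 1)"
    unfolding l(1)[symmetric] by (simp add: nu) (simp add: shf_def)
  also have "(\<lambda>i. (lam(Suc m := 0)) i - 1) = lam'(Suc m := 0)"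
    unfolding nu using l(2) by (auto simp: shf_def fun_eq_iff par_def evec_def)
  also have "branch m lam' (lam'(Suc m := 0)) = 1" by (rule Suc.hyps(1)[OF x l(2)])
  finally show ?case .
qed

text \<open>For \<nu> equal to \<open>lam\<close> without its last part both branching coefficients
  are 1, and the last entry of \<nu> is that of \<open>lam\<close> at m; this identifies K.\<close>

lemma branch_recursion:
  assumes lam: "lam \<in> par (Suc m) d" and m: "1 \<le> m" and e: "e \<le> d" and nu: "\<nu> \<in> par m e"
  shows "incr_at lam (Suc m) \<in> par (Suc m) (d + 1) \<Longrightarrow>
      (qK ^ lam (Suc m) - qK ^ lam m) * branch m (incr_at lam (Suc m)) \<nu> = (qK ^ lam (Suc m) - qK ^ \<nu> m) * branch m lam \<nu>"
    and "incr_at lam (Suc m) \<notin> par (Suc m) (d + 1) \<Longrightarrow> (qK ^ lam (Suc m) - qK ^ \<nu> m) * branch m lam \<nu> = 0"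
proof -
  obtain K where
    K: "\<And>e \<nu>. incr_at lam (Suc m) \<in> par (Suc m) (d + 1) \<Longrightarrow> e \<le> d \<Longrightarrow> \<nu> \<in> par m e \<Longrightarrow>
      K * branch m (incr_at lam (Suc m)) \<nu> = (qK ^ lam (Suc m) - qK ^ \<nu> m) * branch m lam \<nu>"
    and K0: "\<And>e \<nu>. incr_at lam (Suc m) \<notin> par (Suc m) (d + 1) \<Longrightarrow> e \<le> d \<Longrightarrow> \<nu> \<in> par m e \<Longrightarrow>
      (qK ^ lam (Suc m) - qK ^ \<nu> m) * branch m lam \<nu> = 0"
    using ex_branch_recursion[OF lam m] by metis
  show "(qK ^ lam (Suc m) - qK ^ lam m) * branch m (incr_at lam (Suc m)) \<nu> = (qK ^ lam (Suc m) - qK ^ \<nu> m) * branch m lam \<nu>"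
    if l: "incr_at lam (Suc m) \<in> par (Suc m) (d + 1)"
  proof -
    let ?r = "lam(Suc m := 0)"
    have "branch m lam ?r = 1" by (rule branch_drop_last[OF lam])
    moreover have "branch m (incr_at lam (Suc m)) ?r = 1" using branch_drop_last[OF l] by simp
    ultimately have "K = qK ^ lam (Suc m) - qK ^ lam m"
      using K[OF l _ par_upd_0(1)[OF lam]] m by simp
    then show ?thesis using K[OF l e nu] by simp
  qed
  show "(qK ^ lam (Suc m) - qK ^ \<nu> m) * branch m lam \<nu> = 0" if "incr_at lam (Suc m) \<notin> par (Suc m) (d + 1)"
    by (rule K0[OF that e nu])
qed

lemma incr_at_par_iff:
  assumes lam: "lam \<in> par (Suc m) d" and m: "1 \<le> m"
  shows "incr_at lam (Suc m) \<in> par (Suc m) (d + 1) \<longleftrightarrow> lam (Suc m) < lam m"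
proof -
  let ?l = "incr_at lam (Suc m)"
  have "(\<Sum>i = 1..m. ?l i) = (\<Sum>i = 1..m. lam i)" by (rule sum.cong) auto
  then have "?l \<in> evec (Suc m) (d + 1)" using par_evec[OF lam] by (auto simp: evec_def)
  moreover have "(\<forall>i\<in>{1..<Suc m}. ?l (i + 1) \<le> ?l i) \<longleftrightarrow> lam (Suc m) < lam m"
  proof
    assume all: "\<forall>i\<in>{1..<Suc m}. ?l (i + 1) \<le> ?l i"
    have "m \<in> {1..<Suc m}" using m by simp
    from bspec[OF all this] show "lam (Suc m) < lam m" by simp
  next
    assume "lam (Suc m) < lam m"
    then show "\<forall>i\<in>{1..<Suc m}. ?l (i + 1) \<le> ?l i" using lam by (auto simp: par_def)
  qed
  ultimately show ?thesis by (simp add: par_def)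
qed

text \<open>The inner induction measure is the size e of \<nu> plus the truncated difference of its
  last entry and the last part of \<open>lam\<close>. Raising the last part (case A) lowers the
  difference and keeps e; dividing by the product of the variables (case B) lowers e and keeps the
  difference; when both entries are 0 (case C) the number of variables drops.\<close>

theorem branch_eq:
  assumes "lam \<in> par (Suc m) d" "e \<le> d" "\<nu> \<in> par m e"
  shows "branch m lam \<nu> = branch_formula qK m lam \<nu>"
  using assms
proof (induction m arbitrary: lam d e \<nu>)
  case 0
  have "lam(Suc 0 := 0) = \<nu>" using 0 by (auto simp: par_def evec_def fun_eq_iff)
  then show ?case using branch_drop_last[OF 0(1)] by (simp add: branch_formula_def interlaced_def)
next
  case (Suc k)
  note outer = Suc.IH
  let ?m = "Suc k" and ?n = "Suc (Suc k)"
  from Suc.prems show ?case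
  proof (induction "e + (\<nu> ?m - lam ?n)" arbitrary: lam d e \<nu> rule: less_induct)
    case less
    note lam = less.prems(1) and e = less.prems(2) and nu = less.prems(3)
    have m1: "1 \<le> ?m" by simp
    consider (A) "lam ?n < \<nu> ?m" | (B) "\<nu> ?m \<le> lam ?n" "lam ?n \<noteq> 0" | (C) "lam ?n = 0" "\<nu> ?m = 0"
      by linarith
    then show ?case
    proof cases
      case A
      have ne: "qK ^ lam ?n - qK ^ \<nu> ?m \<noteq> 0" using A by (simp add: qK_power_eq_iff)
      show ?thesis
      \<comment> \<open>If the last two parts are equal, the last one cannot be raised and the
        recursion forces the coefficient to be 0; the formula agrees, since \<nu> then exceeds
        \<open>lam\<close> at ?m.\<close>
      proof (cases "lam ?n < lam ?m")
        case False
        then have "branch ?m lam \<nu> = 0"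
          using branch_recursion(2)[OF lam m1 e nu] ne incr_at_par_iff[OF lam m1] by simp
        then show ?thesis using False A by (simp add: branch_formula_Suc)
      next
        case True
        let ?l = "incr_at lam ?n"
        have l: "?l \<in> par ?n (d + 1)" using True incr_at_par_iff[OF lam m1] by simp
        have "branch ?m ?l \<nu> = branch_formula qK ?m ?l \<nu>"
          by (rule less.hyps[OF _ l _ nu]) (use A e in simp_all)
        then have rec: "(qK ^ lam ?n - qK ^ lam ?m) * branch_formula qK ?m ?l \<nu> = (qK ^ lam ?n - qK ^ \<nu> ?m) * branch ?m lam \<nu>"
          using branch_recursion(1)[OF lam m1 e nu l] by simp
        have "(qK ^ lam ?n - qK ^ lam ?m) * branch_formula qK ?m ?l \<nu> =
            (qK ^ lam ?n - qK ^ \<nu> ?m) * branch_formula qK ?m lam \<nu>"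
        proof (cases "\<nu> ?m \<le> lam ?m")
          case le: True
          define N where "N = lam ?m - Suc (lam ?n)"
          define j where "j = lam ?m - \<nu> ?m"
          have N: "lam ?m - lam ?n = Suc N" "j \<le> N" "Suc N - j = \<nu> ?m - lam ?n"
            using True A le by (auto simp: N_def j_def)
          have a: "lam ?m = lam ?n + Suc N" "\<nu> ?m = lam ?n + (Suc N - j)"
            using N True A by linarith+
          have P: "qK ^ lam ?m = qK ^ lam ?n * qK ^ Suc N" "qK ^ \<nu> ?m = qK ^ lam ?n * qK ^ (Suc N - j)"
            by (simp_all only: a power_add)
          have g: "(L - L * x) * B = L * ((1 - x) * B)" for L x B :: Qqt by (simp add: algebra_simps)
          have "(qK ^ lam ?n - qK ^ lam ?m) * qbinom qK N j = (qK ^ lam ?n - qK ^ \<nu> ?m) * qbinom qK (Suc N) j"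
            unfolding P g qbinom_qK_step[OF N(2)] ..
          moreover have "branch_formula qK ?m ?l \<nu> = branch_formula qK k lam \<nu> * qbinom qK N j"
            using A le by (simp add: branch_formula_Suc branch_formula_upd_above N_def j_def)
          moreover have "branch_formula qK ?m lam \<nu> = branch_formula qK k lam \<nu> * qbinom qK (Suc N) j"
            using A le N(1) by (simp add: branch_formula_Suc j_def)
          ultimately show ?thesis by (simp only: mult.left_commute)
        qed (simp add: branch_formula_Suc)
        then show ?thesis using rec ne by simp
      qed
    next
      case B
      obtain lam' d' where l: "lam = shf ?n lam'" "lam' \<in> par ?n d'" "d = d' + ?n"
        using par_all_nonzero[OF lam B(2)] by metis
      have e': "e \<le> d' + ?n" using e l by simp
      note sh = branch_shf[OF l(2) e' nu, folded l(1)]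
      show ?thesis
      proof (cases "e \<le> d' + ?m \<and> (\<forall>i\<in>{1..?m}. \<nu> i \<noteq> 0)")
        case True
        then obtain \<nu>' where n': "\<nu> = shf ?m \<nu>'" "\<nu>' \<in> par ?m (e - ?m)" "?m \<le> e"
          using ex_shf_par[OF nu] by metis
        have "(\<lambda>i. \<nu> i - 1) = \<nu>'" unfolding n'(1) using n'(2) by (auto simp: shf_def fun_eq_iff par_def evec_def)
        then have "branch ?m lam \<nu> = branch ?m lam' \<nu>'" using sh True by simp
        also have "\<dots> = branch_formula qK ?m lam' \<nu>'"
        proof (rule less.hyps[OF _ l(2) _ n'(2)])
          have "\<nu>' ?m - lam' ?n = \<nu> ?m - lam ?n" unfolding n'(1) l(1) by (simp add: shf_def)
          then show "e - ?m + (\<nu>' ?m - lam' ?n) < e + (\<nu> ?m - lam ?n)" using n'(3) by simp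
        qed (use True[THEN conjunct1] in simp)
        finally show ?thesis unfolding l(1) n'(1) branch_formula_shf .
      next
        case False
        \<comment> \<open>All parts of \<open>lam\<close> are positive, so interlacing would make
          all parts of \<nu> positive and would leave a positive power of the last variable.\<close>
        have "\<not> interlaced ?m lam \<nu>"
        proof
          assume il: "interlaced ?m lam \<nu>"
          have "\<nu> i \<noteq> 0" if "i \<in> {1..?m}" for i
          proof -
            have "lam (Suc i) \<le> \<nu> i" using il that by (simp add: interlaced_def)
            moreover have "lam (Suc i) \<noteq> 0" using that by (simp add: l(1) shf_def)
            ultimately show ?thesis by simp
          qed
          moreover have "e \<le> d' + ?m"
          proof -
            have "(\<Sum>i = 1..?m. \<nu> i) \<le> (\<Sum>i = 1..?m. lam i)"
              by (rule sum_mono) (use il in \<open>simp add: interlaced_def\<close>)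
            moreover have "(\<Sum>i = 1..?m. \<nu> i) = e" using nu by (simp add: par_def evec_def)
            moreover have "(\<Sum>i = 1..?m. lam i) + lam ?n = d" using lam by (simp add: par_def evec_def)
            ultimately show ?thesis using B(2) l(3) by linarith
          qed
          ultimately show False using False by blast
        qed
        moreover have "branch ?m lam \<nu> = 0" unfolding sh by (rule if_not_P[OF False])
        ultimately show ?thesis by (simp add: branch_formula_def)
      qed
    next
      case C
      have lam': "lam \<in> par ?m d" using lam C(1) par_Suc_iff[of lam ?m d] by simp
      have nu': "\<nu> \<in> par k e" using nu C(2) par_Suc_iff[of \<nu> k e] by simp
      have "branch ?m lam \<nu> = branch k lam \<nu>" by (rule branch_stable[OF lam' nu' e])
      also have "\<dots> = branch_formula qK k lam \<nu>" by (rule outer[OF lam' e nu'])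
      finally show ?thesis using C by (simp add: branch_formula_Suc qbinom_self)
    qed
  qed
qed

text \<open>The branching formula iterated down to no variables. It is defined over any commutative
  ring, so that \<open>qw_coeff_hom\<close> can carry it from \<rat>(q,t) through \<rat>[q] to the
  complex numbers.\<close>

fun qw_coeff :: "'a::comm_ring_1 \<Rightarrow> nat \<Rightarrow> (nat \<Rightarrow> nat) \<Rightarrow> (nat \<Rightarrow> nat) \<Rightarrow> 'a" where
  "qw_coeff q 0 lam \<alpha> = 1"
| "qw_coeff q (Suc m) lam \<alpha> = (\<Sum>\<nu>\<in>par m ((\<Sum>i = 1..Suc m. lam i) - \<alpha> (Suc m)).
     branch_formula q m lam \<nu> * qw_coeff q m \<nu> (\<alpha>(Suc m := 0)))"

lemma qw_mon_eq_coeff: "lam \<in> par m d \<Longrightarrow> \<alpha> \<in> evec m d \<Longrightarrow> qw_mon m lam \<alpha> = qw_coeff qK m lam \<alpha>"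
proof (induction m arbitrary: lam d \<alpha>)
  case 0
  then have "\<alpha> = lam" by (auto simp: par_def evec_def fun_eq_iff)
  then show ?case using 0 by (simp add: qw_mon_par qw_self)
next
  case (Suc m)
  have d: "(\<Sum>i = 1..Suc m. lam i) = d" using Suc.prems(1) by (simp add: par_def evec_def)
  have "qw_mon (Suc m) lam \<alpha> = (\<Sum>\<nu>\<in>par m (d - \<alpha> (Suc m)). branch m lam \<nu> * qw_mon m \<nu> (\<alpha>(Suc m := 0)))"
    by (rule qw_mon_branch[OF Suc.prems])
  also have "\<dots> = (\<Sum>\<nu>\<in>par m (d - \<alpha> (Suc m)). branch_formula qK m lam \<nu> * qw_coeff qK m \<nu> (\<alpha>(Suc m := 0)))"
  proof (rule sum.cong[OF refl])
    fix \<nu> assume nu: "\<nu> \<in> par m (d - \<alpha> (Suc m))"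
    show "branch m lam \<nu> * qw_mon m \<nu> (\<alpha>(Suc m := 0)) = branch_formula qK m lam \<nu> * qw_coeff qK m \<nu> (\<alpha>(Suc m := 0))"
      using branch_eq[OF Suc.prems(1) diff_le_self nu]
        Suc.IH[OF nu conjunct1[OF upd_0_evec[OF Suc.prems(2)]]] by (simp only:)
  qed
  finally show ?case unfolding qw_coeff.simps d .
qed

lemma qw_coeff_hom:
  fixes f :: "'a::comm_ring_1 \<Rightarrow> 'b::comm_ring_1"
  assumes add: "\<And>a b. f (a + b) = f a + f b" and mult: "\<And>a b. f (a * b) = f a * f b"
    and one: "f 1 = 1"
  shows "f (qw_coeff q n lam \<alpha>) = qw_coeff (f q) n lam \<alpha>"
proof -
  have zero: "f 0 = 0" using add[of 0 0] by simp
  have pow: "f (a ^ k) = f a ^ k" for a k by (induction k) (simp_all add: mult one)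
  have sum: "f (sum g A) = (\<Sum>i\<in>A. f (g i))" for g :: "'c \<Rightarrow> 'a" and A
    by (induction A rule: infinite_finite_induct) (simp_all add: add zero)
  have prod: "f (prod g A) = (\<Prod>i\<in>A. f (g i))" for g :: "'d \<Rightarrow> 'a" and A
    by (induction A rule: infinite_finite_induct) (simp_all add: mult one)
  have qb: "f (qbinom q n k) = qbinom (f q) n k" for n k
    by (induction q n k rule: qbinom.induct) (simp_all add: add mult pow one zero)
  have bf: "f (branch_formula q m lam \<nu>) = branch_formula (f q) m lam \<nu>" for m lam \<nu>
    by (simp add: branch_formula_def prod qb zero)
  show ?thesis by (induction n arbitrary: lam \<alpha>) (simp_all add: one sum mult bf)
qed

section \<open>The Whittaker function as a branching sum\<close>

definition qwp :: "'a::comm_ring_1 \<Rightarrow> nat \<Rightarrow> nat \<Rightarrow> (nat \<Rightarrow> nat) \<Rightarrow> (nat \<Rightarrow> 'a) \<Rightarrow> 'a" where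
  "qwp q n d lam z = (\<Sum>\<alpha>\<in>evec n d. qw_coeff q n lam \<alpha> * mon n \<alpha> z)"

lemma qwp_Suc:
  assumes lam: "lam \<in> par (Suc m) d"
  shows "qwp q (Suc m) d lam z = (\<Sum>k\<le>d. \<Sum>\<nu>\<in>par m (d - k).
    branch_formula q m lam \<nu> * (z (Suc m) ^ k * qwp q m (d - k) \<nu> z))"
  unfolding qwp_def sum_evec_Suc
proof (rule sum.cong[OF refl])
  fix k assume "k \<in> {..d}"
  have d: "(\<Sum>i = 1..Suc m. lam i) = d" using lam by (simp add: par_def evec_def)
  have "(\<Sum>\<alpha>\<in>evec m (d - k). qw_coeff q (Suc m) lam (\<alpha>(Suc m := k)) * mon (Suc m) (\<alpha>(Suc m := k)) z) =
      (\<Sum>\<alpha>\<in>evec m (d - k). \<Sum>\<nu>\<in>par m (d - k). branch_formula q m lam \<nu> * (z (Suc m) ^ k * (qw_coeff q m \<nu> \<alpha> * mon m \<alpha> z)))"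
  proof (rule sum.cong[OF refl])
    fix \<alpha> assume "\<alpha> \<in> evec m (d - k)"
    from evec_upd_0[OF this, of k]
    have "qw_coeff q (Suc m) lam (\<alpha>(Suc m := k)) = (\<Sum>\<nu>\<in>par m (d - k). branch_formula q m lam \<nu> * qw_coeff q m \<nu> \<alpha>)"
      unfolding qw_coeff.simps d by (simp only: fun_upd_same)
    then show "qw_coeff q (Suc m) lam (\<alpha>(Suc m := k)) * mon (Suc m) (\<alpha>(Suc m := k)) z =
        (\<Sum>\<nu>\<in>par m (d - k). branch_formula q m lam \<nu> * (z (Suc m) ^ k * (qw_coeff q m \<nu> \<alpha> * mon m \<alpha> z)))"
      unfolding mon_Suc_upd by (simp add: sum_distrib_left sum_distrib_right mult_ac)
  qed
  then show "(\<Sum>\<alpha>\<in>evec m (d - k). qw_coeff q (Suc m) lam (\<alpha>(Suc m := k)) * mon (Suc m) (\<alpha>(Suc m := k)) z) =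
      (\<Sum>\<nu>\<in>par m (d - k). branch_formula q m lam \<nu> * (z (Suc m) ^ k *
        (\<Sum>\<alpha>\<in>evec m (d - k). qw_coeff q m \<nu> \<alpha> * mon m \<alpha> z)))"
    by (subst (asm) sum.swap) (simp only: sum_distrib_left)
qed

text \<open>Polymorphic, because rows of Gelfand--Zetlin arrays are integer sequences while
  partitions have natural parts.\<close>

definition between :: "nat \<Rightarrow> (nat \<Rightarrow> 'a::{linorder,zero}) \<Rightarrow> (nat \<Rightarrow> 'a) set" where
  "between m p = {\<nu>. interlaced m p \<nu> \<and> (\<forall>i. i \<notin> {1..m} \<longrightarrow> \<nu> i = 0)}"

lemma between_par:
  assumes lam: "lam \<in> par (Suc m) d" and nu: "\<nu> \<in> between m lam"
  shows "\<nu> \<in> par m (\<Sum>i = 1..m. \<nu> i)" "(\<Sum>i = 1..m. \<nu> i) \<le> d"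
proof -
  have il: "lam (Suc i) \<le> \<nu> i" "\<nu> i \<le> lam i" if "i \<in> {1..m}" for i
    using nu that by (auto simp: between_def interlaced_def)
  have "\<nu> (i + 1) \<le> \<nu> i" if "i \<in> {1..<m}" for i
  proof -
    have "\<nu> (i + 1) \<le> lam (i + 1)" by (rule il(2)) (use that in auto)
    also have "lam (i + 1) \<le> \<nu> i" using il(1)[of i] that by simp
    finally show ?thesis .
  qed
  then show "\<nu> \<in> par m (\<Sum>i = 1..m. \<nu> i)" using nu by (auto simp: par_def evec_def between_def)
  have "(\<Sum>i = 1..m. \<nu> i) \<le> (\<Sum>i = 1..m. lam i)" by (rule sum_mono) (rule il(2))
  then show "(\<Sum>i = 1..m. \<nu> i) \<le> d" using lam by (simp add: par_def evec_def)
qed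

lemma qwp_Suc_between:
  assumes lam: "lam \<in> par (Suc m) d"
  shows "qwp q (Suc m) d lam z = (\<Sum>\<nu>\<in>between m lam. branch_formula q m lam \<nu> *
    (z (Suc m) ^ (d - (\<Sum>i = 1..m. \<nu> i)) * qwp q m (\<Sum>i = 1..m. \<nu> i) \<nu> z))"
proof -
  let ?F = "\<lambda>k \<nu>. branch_formula q m lam \<nu> * (z (Suc m) ^ k * qwp q m (d - k) \<nu> z)"
  have "qwp q (Suc m) d lam z = (\<Sum>(k, \<nu>)\<in>Sigma {..d} (\<lambda>k. par m (d - k)). ?F k \<nu>)"
    unfolding qwp_Suc[OF lam] by (rule sum.Sigma) auto
  also have "\<dots> = (\<Sum>(k, \<nu>)\<in>{(k, \<nu>)\<in>Sigma {..d} (\<lambda>k. par m (d - k)). interlaced m lam \<nu>}. ?F k \<nu>)"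
    by (rule sum.mono_neutral_right) (auto simp: branch_formula_def split: if_splits)
  also have "\<dots> = (\<Sum>\<nu>\<in>between m lam. ?F (d - (\<Sum>i = 1..m. \<nu> i)) \<nu>)"
  proof (rule sum.reindex_bij_witness[of _ "\<lambda>\<nu>. (d - (\<Sum>i = 1..m. \<nu> i), \<nu>)" snd])
    fix a assume "a \<in> {(k, \<nu>)\<in>Sigma {..d} (\<lambda>k. par m (d - k)). interlaced m lam \<nu>}"
    then obtain k \<nu> where a: "a = (k, \<nu>)" "k \<le> d" "\<nu> \<in> par m (d - k)" "interlaced m lam \<nu>" by auto
    have s: "(\<Sum>i = 1..m. \<nu> i) = d - k" using a(3) by (simp add: par_def evec_def)
    show "(d - (\<Sum>i = 1..m. snd a i), snd a) = a" using a s by simp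
    show "snd a \<in> between m lam" using a by (auto simp: between_def par_def evec_def)
    show "?F (d - (\<Sum>i = 1..m. snd a i)) (snd a) = (case a of (k, \<nu>) \<Rightarrow> ?F k \<nu>)" using a s by simp
  next
    fix \<nu> assume nu: "\<nu> \<in> between m lam"
    show "(d - (\<Sum>i = 1..m. \<nu> i), \<nu>) \<in> {(k, \<nu>)\<in>Sigma {..d} (\<lambda>k. par m (d - k)). interlaced m lam \<nu>}"
      using between_par[OF lam nu] nu by (auto simp: between_def)
  qed simp
  also have "\<dots> = (\<Sum>\<nu>\<in>between m lam. branch_formula q m lam \<nu> *
    (z (Suc m) ^ (d - (\<Sum>i = 1..m. \<nu> i)) * qwp q m (\<Sum>i = 1..m. \<nu> i) \<nu> z))"
    by (rule sum.cong) (use between_par[OF lam] in simp_all)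
  finally show ?thesis .
qed

section \<open>Gelfand--Zetlin arrays row by row\<close>

definition top_row :: "(nat \<Rightarrow> int) \<Rightarrow> nat \<Rightarrow> nat \<Rightarrow> int" where
  "top_row p l i = (if i \<in> {1..l} then p i else 0)"

text \<open>Entries beyond the triangle are pinned to 0, so adding a top row overwrites a zero row
  and removing it restores that row; this makes the two maps mutually inverse.\<close>

lemma bij_GZ_Suc: "bij_betw (\<lambda>(\<nu>, P). P(Suc (Suc l) := top_row p (Suc (Suc l))))
    (Sigma (between (Suc l) p) (GZ l)) (GZ (Suc l) p)"
proof -
  let ?n = "Suc (Suc l)"
  have ext: "P(?n := top_row p ?n) \<in> GZ (Suc l) p" if nu: "\<nu> \<in> between (Suc l) p" and P: "P \<in> GZ l \<nu>" for \<nu> P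
    unfolding GZ_def
  proof (intro CollectI conjI ballI allI impI)
    let ?Q = "P(?n := top_row p ?n)"
    fix i assume "i \<in> {1..Suc l + 1}"
    then show "?Q (Suc l + 1) i = p i" by (simp add: top_row_def)
  next
    fix k i assume k: "k \<in> {1..Suc l}" and i: "i \<in> {1..k}"
    have "P (k + 1) i \<ge> P k i \<and> P k i \<ge> P (k + 1) (i + 1)" if "k \<le> l"
      using P k i that by (auto simp: GZ_def)
    moreover have "P (Suc l) i = \<nu> i" if "i \<in> {1..Suc l}" using P that by (auto simp: GZ_def)
    ultimately show "(P(?n := top_row p ?n)) (k + 1) i \<ge> (P(?n := top_row p ?n)) k i"
      "(P(?n := top_row p ?n)) k i \<ge> (P(?n := top_row p ?n)) (k + 1) (i + 1)"
      using nu k i by (cases "k = Suc l"; force simp: top_row_def between_def interlaced_def)+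
  next
    fix k i assume "\<not> (1 \<le> i \<and> i \<le> k \<and> k \<le> Suc l + 1)"
    then show "(P(?n := top_row p ?n)) k i = 0" using P by (auto simp: top_row_def GZ_def)
  qed
  have rest: "P (Suc l) \<in> between (Suc l) p \<and> P(?n := (\<lambda>_. 0)) \<in> GZ l (P (Suc l)) \<and> P ?n = top_row p ?n"
    if P: "P \<in> GZ (Suc l) p" for P
  proof (intro conjI)
    have tp: "P ?n i = p i" if "i \<in> {1..?n}" for i using P that by (auto simp: GZ_def)
    have z: "P k i = 0" if "\<not> (1 \<le> i \<and> i \<le> k \<and> k \<le> ?n)" for k i using P that by (auto simp: GZ_def)
    show "P ?n = top_row p ?n" using tp z[of _ ?n] by (auto simp: top_row_def fun_eq_iff)
    have il: "P (k + 1) i \<ge> P k i \<and> P k i \<ge> P (k + 1) (i + 1)" if "k \<in> {1..Suc l}" "i \<in> {1..k}" for k i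
      using P that by (auto simp: GZ_def)
    show "P (Suc l) \<in> between (Suc l) p"
      unfolding between_def interlaced_def
    proof (intro CollectI conjI ballI allI impI)
      fix i assume i: "i \<in> {1..Suc l}"
      then show "p (Suc i) \<le> P (Suc l) i" "P (Suc l) i \<le> p i" using il[of "Suc l" i] tp[of i] tp[of "Suc i"] by auto
    next
      fix i assume "i \<notin> {1..Suc l}"
      then show "P (Suc l) i = 0" by (intro z) auto
    qed
    show "P(?n := (\<lambda>_. 0)) \<in> GZ l (P (Suc l))"
      unfolding GZ_def using il z by (auto simp: less_Suc_eq_le)
  qed
  let ?f = "\<lambda>(\<nu>, P). P(?n := top_row p ?n)" and ?g = "\<lambda>P. (P (Suc l), P(?n := (\<lambda>_. 0)))"
  show ?thesis
  proof (rule bij_betw_byWitness[of _ ?g])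
    show "\<forall>b\<in>Sigma (between (Suc l) p) (GZ l). ?g (?f b) = b"
    proof
      fix b assume "b \<in> Sigma (between (Suc l) p) (GZ l)"
      then obtain \<nu> P where b: "b = (\<nu>, P)" "\<nu> \<in> between (Suc l) p" "P \<in> GZ l \<nu>" by auto
      have "P (Suc l) i = \<nu> i" for i
        using b by (cases "i \<in> {1..Suc l}") (auto simp: GZ_def between_def)
      then have r: "P (Suc l) = \<nu>" by blast
      have "P ?n = (\<lambda>_. 0)" using b by (auto simp: GZ_def)
      then have "P(?n := (\<lambda>_. 0)) = P" by auto
      then show "?g (?f b) = b" using b r by simp
    qed
    show "\<forall>P\<in>GZ (Suc l) p. ?f (?g P) = P"
    proof
      fix P assume "P \<in> GZ (Suc l) p"
      then have "P(?n := top_row p ?n) = P" using rest by (metis fun_upd_triv)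
      then show "?f (?g P) = P" by simp
    qed
    show "?f ` Sigma (between (Suc l) p) (GZ l) \<subseteq> GZ (Suc l) p"
    proof
      fix Q assume "Q \<in> ?f ` Sigma (between (Suc l) p) (GZ l)"
      then obtain \<nu> P where "Q = P(?n := top_row p ?n)" "\<nu> \<in> between (Suc l) p" "P \<in> GZ l \<nu>" by auto
      then show "Q \<in> GZ (Suc l) p" using ext by simp
    qed
    show "?g ` GZ (Suc l) p \<subseteq> Sigma (between (Suc l) p) (GZ l)" using rest by blast
  qed
qed

lemma finite_between: "finite (between m (p :: nat \<Rightarrow> int))"
proof (rule finite_subset)
  show "between m p \<subseteq> {f. \<forall>i. (i \<in> {1..m} \<longrightarrow> f i \<in> (\<Union>i\<in>{1..m}. {p (Suc i)..p i})) \<and> (i \<notin> {1..m} \<longrightarrow> f i = 0)}"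
    unfolding between_def interlaced_def by force
qed (rule finite_set_of_finite_funs; simp)

lemma GZ_0: "GZ 0 p = {\<lambda>k i. if k = 1 \<and> i = 1 then p 1 else 0}"
  by (auto simp: GZ_def fun_eq_iff)

lemma finite_GZ: "finite (GZ l p)"
proof (induction l arbitrary: p)
  case (Suc l)
  have "finite (Sigma (between (Suc l) p) (GZ l))" using finite_between Suc by auto
  then show ?case using bij_betw_finite[OF bij_GZ_Suc] by blast
qed (simp add: GZ_0)

lemma sum_GZ_Suc: "(\<Sum>P\<in>GZ (Suc l) p. F P) =
    (\<Sum>\<nu>\<in>between (Suc l) p. \<Sum>P\<in>GZ l \<nu>. F (P(Suc (Suc l) := top_row p (Suc (Suc l)))))"
proof -
  have "(\<Sum>P\<in>GZ (Suc l) p. F P) = (\<Sum>(\<nu>, P)\<in>Sigma (between (Suc l) p) (GZ l). F (P(Suc (Suc l) := top_row p (Suc (Suc l)))))"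
    using sum.reindex_bij_betw[OF bij_GZ_Suc, of F l p, symmetric] by (simp add: case_prod_unfold)
  also have "\<dots> = (\<Sum>\<nu>\<in>between (Suc l) p. \<Sum>P\<in>GZ l \<nu>. F (P(Suc (Suc l) := top_row p (Suc (Suc l)))))"
    by (rule sum.Sigma[symmetric]) (auto simp: finite_between finite_GZ)
  finally show ?thesis .
qed

lemma qfac_eq_qpoch: "qfac q n = qpoch q n"
  by (simp add: qfac_def qpoch_def)

lemma qfac_nonzero:
  assumes "0 < q" "q < 1"
  shows "qfac q n \<noteq> 0"
proof -
  have "q ^ k < 1" if "k \<in> {1..n}" for k using that assms by (simp add: power_less_one_iff)
  then show ?thesis unfolding qfac_def by (simp add: prod_zero_iff) fastforce
qed

definition whittaker_step :: "nat \<Rightarrow> real \<Rightarrow> (nat \<Rightarrow> int) \<Rightarrow> (nat \<Rightarrow> int) \<Rightarrow> real" where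
  "whittaker_step m q p \<nu> = (\<Prod>i = 1..m. qfac q (nat (p i - p (Suc i))) /
     (qfac q (nat (p i - \<nu> i)) * qfac q (nat (\<nu> i - p (Suc i)))))"

text \<open>The numerator factors contributed by the row \<nu> (called N in the proof) are the
  normalizing factors of the function with top row \<nu>. Hence it is the normalized function that
  satisfies a recursion with a weight depending on two adjacent rows only.\<close>

lemma whittaker_normalized_Suc:
  "whittaker_normalized (Suc l) q z p = (\<Sum>\<nu>\<in>between (Suc l) p. complex_of_real (whittaker_step (Suc l) q p \<nu>) *
     (z (Suc (Suc l)) powi ((\<Sum>i = 1..Suc (Suc l). p i) - (\<Sum>i = 1..Suc l. \<nu> i)) * whittaker_normalized l q z \<nu>))"
proof -
  let ?n = "Suc (Suc l)"
  define Z where "Z l P = (\<Prod>k = 1..l + 1. z k powi ((\<Sum>i = 1..k. P k i) - (\<Sum>i = 1..k - 1. P (k - 1) i)))"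
    for l and P :: "nat \<Rightarrow> nat \<Rightarrow> int"
  define A where "A l P = (\<Prod>k = 2..l. \<Prod>i = 1..k - 1. qfac q (nat (P k i - P k (i + 1))))"
    for l and P :: "nat \<Rightarrow> nat \<Rightarrow> int"
  define B where "B l P = (\<Prod>k = 1..l. \<Prod>i = 1..k. qfac q (nat (P (k + 1) i - P k i)) * qfac q (nat (P k i - P (k + 1) (i + 1))))"
    for l and P :: "nat \<Rightarrow> nat \<Rightarrow> int"
  have W: "whittaker l q z p = (\<Sum>P\<in>GZ l p. Z l P * complex_of_real (A l P / B l P))" for l p
    by (simp add: whittaker_def Z_def A_def B_def)
  define D where "D \<nu> = (\<Prod>i = 1..Suc l. qfac q (nat (p i - \<nu> i)) * qfac q (nat (\<nu> i - p (Suc i))))" for \<nu> :: "nat \<Rightarrow> int"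
  define N where "N \<nu> = (\<Prod>i = 1..l. qfac q (nat (\<nu> i - \<nu> (i + 1))))" for \<nu> :: "nat \<Rightarrow> int"
  define M where "M = (\<Prod>i = 1..Suc l. qfac q (nat (p i - p (i + 1))))"
  have tm: "Z (Suc l) (P(?n := top_row p ?n)) * complex_of_real (A (Suc l) (P(?n := top_row p ?n)) / B (Suc l) (P(?n := top_row p ?n))) =
      z ?n powi ((\<Sum>i = 1..?n. p i) - (\<Sum>i = 1..Suc l. \<nu> i)) * complex_of_real (N \<nu> / D \<nu>) * (Z l P * complex_of_real (A l P / B l P))"
    if P: "P \<in> GZ l \<nu>" for \<nu> P
  proof -
    let ?Q = "P(?n := top_row p ?n)"
    have Q: "?Q k = P k" if "k \<le> Suc l" for k using that by simp
    have Pn: "P (Suc l) i = \<nu> i" if "i \<in> {1..Suc l}" for i using P that by (auto simp: GZ_def)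
    have "Z (Suc l) ?Q = (\<Prod>k = 1..Suc l. z k powi ((\<Sum>i = 1..k. ?Q k i) - (\<Sum>i = 1..k - 1. ?Q (k - 1) i))) *
        z ?n powi ((\<Sum>i = 1..?n. ?Q ?n i) - (\<Sum>i = 1..Suc l. ?Q (Suc l) i))"
      unfolding Z_def by simp
    also have "(\<Prod>k = 1..Suc l. z k powi ((\<Sum>i = 1..k. ?Q k i) - (\<Sum>i = 1..k - 1. ?Q (k - 1) i))) = Z l P"
      unfolding Z_def by (rule prod.cong) (auto simp: Q)
    also have "(\<Sum>i = 1..?n. ?Q ?n i) = (\<Sum>i = 1..?n. p i)" by (rule sum.cong) (auto simp: top_row_def)
    also have "(\<Sum>i = 1..Suc l. ?Q (Suc l) i) = (\<Sum>i = 1..Suc l. \<nu> i)" by (rule sum.cong) (auto simp: Q Pn)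
    finally have ZQ: "Z (Suc l) ?Q = Z l P * z ?n powi ((\<Sum>i = 1..?n. p i) - (\<Sum>i = 1..Suc l. \<nu> i))" .
    have AQ: "A (Suc l) ?Q = A l P * N \<nu>"
    proof -
      have "A (Suc l) ?Q = (\<Prod>k = 2..Suc l. \<Prod>i = 1..k - 1. qfac q (nat (P k i - P k (i + 1))))"
        unfolding A_def by (rule prod.cong) (auto simp: Q)
      \<comment> \<open>For l = 0 the range from 2 to \<open>Suc l\<close> has no last term to split
        off, but then the new factor is an empty product.\<close>
      also have "\<dots> = A l P * (\<Prod>i = 1..l. qfac q (nat (P (Suc l) i - P (Suc l) (i + 1))))"
        unfolding A_def by (cases l) simp_all
      also have "(\<Prod>i = 1..l. qfac q (nat (P (Suc l) i - P (Suc l) (i + 1)))) = N \<nu>"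
        unfolding N_def by (rule prod.cong) (auto simp: Pn)
      finally show ?thesis .
    qed
    have BQ: "B (Suc l) ?Q = B l P * D \<nu>"
    proof -
      have "B (Suc l) ?Q = (\<Prod>k = 1..l. \<Prod>i = 1..k. qfac q (nat (?Q (k + 1) i - ?Q k i)) * qfac q (nat (?Q k i - ?Q (k + 1) (i + 1)))) *
          (\<Prod>i = 1..Suc l. qfac q (nat (?Q ?n i - ?Q (Suc l) i)) * qfac q (nat (?Q (Suc l) i - ?Q ?n (i + 1))))"
        unfolding B_def by simp
      also have "(\<Prod>k = 1..l. \<Prod>i = 1..k. qfac q (nat (?Q (k + 1) i - ?Q k i)) * qfac q (nat (?Q k i - ?Q (k + 1) (i + 1)))) = B l P"
        unfolding B_def by (intro prod.cong refl) (auto simp: Q)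
      also have "(\<Prod>i = 1..Suc l. qfac q (nat (?Q ?n i - ?Q (Suc l) i)) * qfac q (nat (?Q (Suc l) i - ?Q ?n (i + 1)))) = D \<nu>"
        unfolding D_def by (rule prod.cong) (auto simp: Q top_row_def Pn)
      finally show ?thesis .
    qed
    show ?thesis unfolding ZQ AQ BQ by (simp add: mult_ac)
  qed
  have st: "whittaker_step (Suc l) q p \<nu> = M / D \<nu>" for \<nu>
    by (simp add: whittaker_step_def M_def D_def prod_dividef)
  have "whittaker_normalized (Suc l) q z p = complex_of_real M * (\<Sum>\<nu>\<in>between (Suc l) p. \<Sum>P\<in>GZ l \<nu>.
      z ?n powi ((\<Sum>i = 1..?n. p i) - (\<Sum>i = 1..Suc l. \<nu> i)) * complex_of_real (N \<nu> / D \<nu>) * (Z l P * complex_of_real (A l P / B l P)))"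
    unfolding whittaker_normalized_def W sum_GZ_Suc M_def by (simp only: tm cong: sum.cong)
  also have "\<dots> = (\<Sum>\<nu>\<in>between (Suc l) p. complex_of_real (whittaker_step (Suc l) q p \<nu>) *
     (z ?n powi ((\<Sum>i = 1..?n. p i) - (\<Sum>i = 1..Suc l. \<nu> i)) * whittaker_normalized l q z \<nu>))"
    unfolding whittaker_normalized_def W st N_def[symmetric]
    by (simp only: sum_distrib_left of_real_divide) (simp add: sum_distrib_left mult_ac)
  finally show ?thesis .
qed


text \<open>All rows are translated by the same integer a. Only differences enter the weights, while
  the exponent of each variable changes by a; this yields the Laurent factor and reduces to
  partitions. The step weight is then the q-binomial coefficient written as a quotient.\<close>

lemma whittaker_normalized_eq_qwp:
  assumes q: "0 < q" "q < 1"
  shows "lam \<in> par (Suc l) d \<Longrightarrow> (\<And>i. i \<in> {1..Suc l} \<Longrightarrow> p i = a + int (lam i)) \<Longrightarrow>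
    (\<And>i. i \<in> {1..Suc l} \<Longrightarrow> z i \<noteq> 0) \<Longrightarrow>
    whittaker_normalized l q z p = (\<Prod>j = 1..Suc l. z j powi a) * qwp (complex_of_real q) (Suc l) d lam z"
proof (induction l arbitrary: lam d p)
  case 0
  have lam: "lam 1 = d" using 0(1) by (simp add: par_def evec_def)
  have "whittaker_normalized 0 q z p = z 1 powi p 1"
    by (simp add: whittaker_normalized_def whittaker_def GZ_0)
  also have "\<dots> = z 1 powi a * z 1 ^ d" using 0(2)[of 1] 0(3)[of 1] lam by (simp add: power_int_add)
  also have "z 1 ^ d = qwp (complex_of_real q) (Suc 0) d lam z"
  proof -
    have b: "between 0 lam = {\<lambda>_. 0}" by (auto simp: between_def interlaced_def)
    have e: "evec 0 0 = {\<lambda>_. 0}" by (auto simp: evec_def)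
    show ?thesis unfolding qwp_Suc_between[OF 0(1)] b
      by (simp add: branch_formula_def interlaced_def qwp_def e mon_def)
  qed
  finally show ?case by simp
next
  case (Suc l)
  let ?m = "Suc l" and ?n = "Suc (Suc l)"
  note lam = Suc.prems(1) and p = Suc.prems(2) and z = Suc.prems(3)
  \<comment> \<open>The translation by a, applied only at indices of the row so that the entries
    pinned to 0 stay 0.\<close>
  let ?lift = "\<lambda>\<nu> i. if i \<in> {1..?m} then a + int (\<nu> i) else 0"
  have tm: "complex_of_real (whittaker_step ?m q p (?lift \<nu>)) *
       (z ?n powi ((\<Sum>i = 1..?n. p i) - (\<Sum>i = 1..?m. ?lift \<nu> i)) * whittaker_normalized l q z (?lift \<nu>)) =
      (\<Prod>j = 1..?n. z j powi a) * (branch_formula (complex_of_real q) ?m lam \<nu> *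
       (z ?n ^ (d - (\<Sum>i = 1..?m. \<nu> i)) * qwp (complex_of_real q) ?m (\<Sum>i = 1..?m. \<nu> i) \<nu> z))"
    if nu: "\<nu> \<in> between ?m lam" for \<nu>
  proof -
    have il: "lam (Suc i) \<le> \<nu> i" "\<nu> i \<le> lam i" if "i \<in> {1..?m}" for i
      using nu that by (auto simp: between_def interlaced_def)
    have 1: "complex_of_real (whittaker_step ?m q p (?lift \<nu>)) = branch_formula (complex_of_real q) ?m lam \<nu>"
    proof -
      have "qfac q (nat (p i - p (Suc i))) / (qfac q (nat (p i - ?lift \<nu> i)) * qfac q (nat (?lift \<nu> i - p (Suc i)))) =
          qbinom q (lam i - lam (Suc i)) (lam i - \<nu> i)" if i: "i \<in> {1..?m}" for i
      proof -
        have "p i = a + int (lam i)" "p (Suc i) = a + int (lam (Suc i))" using p i by auto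
        then have n: "nat (p i - p (Suc i)) = lam i - lam (Suc i)" "nat (p i - ?lift \<nu> i) = lam i - \<nu> i"
          "nat (?lift \<nu> i - p (Suc i)) = \<nu> i - lam (Suc i)" using i by auto
        have "qbinom q (lam i - lam (Suc i)) (lam i - \<nu> i) * qpoch q (lam i - \<nu> i) *
            qpoch q (lam i - lam (Suc i) - (lam i - \<nu> i)) = qpoch q (lam i - lam (Suc i))"
          using il[OF i] by (intro qbinom_qpoch) simp
        moreover have "lam i - lam (Suc i) - (lam i - \<nu> i) = \<nu> i - lam (Suc i)" using il[OF i] by simp
        ultimately have "qfac q (lam i - lam (Suc i)) = qbinom q (lam i - lam (Suc i)) (lam i - \<nu> i) *
            (qfac q (lam i - \<nu> i) * qfac q (\<nu> i - lam (Suc i)))"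
          by (simp add: qfac_eq_qpoch mult.assoc)
        then show ?thesis unfolding n using qfac_nonzero[OF q] by simp
      qed
      then have "whittaker_step ?m q p (?lift \<nu>) = (\<Prod>i = 1..?m. qbinom q (lam i - lam (Suc i)) (lam i - \<nu> i))"
        unfolding whittaker_step_def by (rule prod.cong[OF refl])
      moreover have "complex_of_real (qbinom q n k) = qbinom (complex_of_real q) n k" for n k
        by (induction q n k rule: qbinom.induct) simp_all
      ultimately show ?thesis using nu by (simp add: branch_formula_def between_def)
    qed
    have 2: "z ?n powi ((\<Sum>i = 1..?n. p i) - (\<Sum>i = 1..?m. ?lift \<nu> i)) = z ?n powi a * z ?n ^ (d - (\<Sum>i = 1..?m. \<nu> i))"
    proof -
      have "(\<Sum>i = 1..?n. p i) = (\<Sum>i = 1..?n. a + int (lam i))" by (rule sum.cong) (use p in auto)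
      also have "\<dots> = int ?n * a + int d" using lam by (simp add: sum.distrib par_def evec_def flip: of_nat_sum)
      finally have s1: "(\<Sum>i = 1..?n. p i) = int ?n * a + int d" .
      have "(\<Sum>i = 1..?m. ?lift \<nu> i) = (\<Sum>i = 1..?m. a + int (\<nu> i))" by (rule sum.cong) auto
      also have "\<dots> = int ?m * a + int (\<Sum>i = 1..?m. \<nu> i)" by (simp add: sum.distrib)
      finally have "(\<Sum>i = 1..?n. p i) - (\<Sum>i = 1..?m. ?lift \<nu> i) = a + int (d - (\<Sum>i = 1..?m. \<nu> i))"
        using between_par(2)[OF lam nu] by (simp only: s1 of_nat_diff) (simp add: algebra_simps)
      then show ?thesis using z[of ?n] by (simp only:) (simp add: power_int_add)
    qed
    have 3: "whittaker_normalized l q z (?lift \<nu>) =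
        (\<Prod>j = 1..?m. z j powi a) * qwp (complex_of_real q) ?m (\<Sum>i = 1..?m. \<nu> i) \<nu> z"
      by (rule Suc.IH[OF between_par(1)[OF lam nu]]) (use z in auto)
    show ?thesis unfolding 1 2 3 by simp
  qed
  have "whittaker_normalized ?m q z p = (\<Sum>\<nu>\<in>between ?m p. complex_of_real (whittaker_step ?m q p \<nu>) *
     (z ?n powi ((\<Sum>i = 1..?n. p i) - (\<Sum>i = 1..?m. \<nu> i)) * whittaker_normalized l q z \<nu>))"
    by (rule whittaker_normalized_Suc)
  also have "\<dots> = (\<Sum>\<nu>\<in>between ?m lam. complex_of_real (whittaker_step ?m q p (?lift \<nu>)) *
       (z ?n powi ((\<Sum>i = 1..?n. p i) - (\<Sum>i = 1..?m. ?lift \<nu> i)) * whittaker_normalized l q z (?lift \<nu>)))"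
  proof (rule sum.reindex_bij_witness[of _ ?lift "\<lambda>\<nu> i. if i \<in> {1..?m} then nat (\<nu> i - a) else 0"])
    fix \<nu> assume nu: "\<nu> \<in> between ?m p"
    have il: "a + int (lam (Suc i)) \<le> \<nu> i" "\<nu> i \<le> a + int (lam i)" if "i \<in> {1..?m}" for i
    proof -
      have "p (Suc i) \<le> \<nu> i \<and> \<nu> i \<le> p i" using nu that unfolding between_def interlaced_def by blast
      then show "a + int (lam (Suc i)) \<le> \<nu> i" "\<nu> i \<le> a + int (lam i)" using p[of i] p[of "Suc i"] that by auto
    qed
    have z0: "\<nu> i = 0" if "i \<notin> {1..?m}" for i using nu that by (simp add: between_def)
    let ?u = "\<lambda>i. if i \<in> {1..?m} then nat (\<nu> i - a) else 0"
    show "?lift ?u = \<nu>"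
    proof
      fix i show "?lift ?u i = \<nu> i" using il[of i] z0[of i] by (cases "i \<in> {1..?m}") auto
    qed
    then show "complex_of_real (whittaker_step ?m q p (?lift ?u)) *
       (z ?n powi ((\<Sum>i = 1..?n. p i) - (\<Sum>i = 1..?m. ?lift ?u i)) * whittaker_normalized l q z (?lift ?u)) =
      complex_of_real (whittaker_step ?m q p \<nu>) *
       (z ?n powi ((\<Sum>i = 1..?n. p i) - (\<Sum>i = 1..?m. \<nu> i)) * whittaker_normalized l q z \<nu>)" by (simp only:)
    have "lam (Suc i) \<le> ?u i \<and> ?u i \<le> lam i" if "i \<in> {1..?m}" for i
      using il[OF that] that by auto
    then show "?u \<in> between ?m lam" unfolding between_def interlaced_def by auto
  next
    fix \<nu> assume nu: "\<nu> \<in> between ?m lam"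
    have z0: "\<nu> i = 0" if "i \<notin> {1..?m}" for i using nu that by (simp add: between_def)
    show "(\<lambda>i. if i \<in> {1..?m} then nat (?lift \<nu> i - a) else 0) = \<nu>"
    proof
      fix i show "(if i \<in> {1..?m} then nat (?lift \<nu> i - a) else 0) = \<nu> i"
        using z0[of i] by (cases "i \<in> {1..?m}") auto
    qed
    have "p (Suc i) \<le> ?lift \<nu> i \<and> ?lift \<nu> i \<le> p i" if i: "i \<in> {1..?m}" for i
      using nu i p[of i] p[of "Suc i"] by (auto simp: between_def interlaced_def)
    then show "?lift \<nu> \<in> between ?m p" unfolding between_def interlaced_def by auto
  qed
  also have "\<dots> = (\<Prod>j = 1..?n. z j powi a) * qwp (complex_of_real q) ?n d lam z"
    unfolding qwp_Suc_between[OF lam] sum_distrib_left by (rule sum.cong[OF refl]) (rule tm)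
  finally show ?case .
qed

section \<open>Specialization of the Macdonald polynomial\<close>

text \<open>The formal polynomial whose value at the generic point is \<open>sf\<close>
  (\<open>emb_mac_poly\<close>).\<close>

definition mac_poly :: "nat \<Rightarrow> nat \<Rightarrow> ((nat \<Rightarrow> nat) \<Rightarrow> Qqt) \<Rightarrow> Qqt mpol" where
  "mac_poly n d g = (\<Sum>\<alpha>\<in>evec n d. Poly_Mapping.single (expo \<alpha>) (g (srt n \<alpha>)))"

lemma lookup_expo_evec: "\<alpha> \<in> evec n d \<Longrightarrow> Poly_Mapping.lookup (expo \<alpha>) = \<alpha>"
  by (rule lookup_expo[of n]) (simp add: evec_def)

lemma expo_inj_evec: "inj_on expo (evec n d)"
  by (rule inj_onI) (metis lookup_expo_evec)

lemma expo_lookup: "expo (Poly_Mapping.lookup a) = a"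
  by (simp add: expo_def)

lemma msym_eq:
  assumes mu: "\<mu> \<in> par n d"
  shows "msym n \<mu> = (\<Sum>\<alpha>\<in>orb n \<mu>. Poly_Mapping.single (expo \<alpha>) 1)"
proof -
  have supp: "\<mu> i = 0" if "i \<notin> {1..n}" for i using mu that by (simp add: par_def evec_def)
  have orb: "orb n \<mu> \<subseteq> evec n d" by (rule orb_subset_evec[OF par_evec[OF mu]])
  have "{\<alpha>. Poly_Mapping.keys \<alpha> \<subseteq> {1..n} \<and>
      (\<exists>\<pi>. \<pi> permutes {1..n} \<and> (\<forall>i\<in>{1..n}. Poly_Mapping.lookup \<alpha> i = \<mu> (\<pi> i)))} = expo ` orb n \<mu>"
  proof (intro equalityI subsetI)
    fix a assume "a \<in> {\<alpha>. Poly_Mapping.keys \<alpha> \<subseteq> {1..n} \<and>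
      (\<exists>\<pi>. \<pi> permutes {1..n} \<and> (\<forall>i\<in>{1..n}. Poly_Mapping.lookup \<alpha> i = \<mu> (\<pi> i)))}"
    then obtain \<pi> where a: "Poly_Mapping.keys a \<subseteq> {1..n}" "\<pi> permutes {1..n}"
      "\<And>i. i \<in> {1..n} \<Longrightarrow> Poly_Mapping.lookup a i = \<mu> (\<pi> i)" by blast
    have "Poly_Mapping.lookup a i = \<mu> (\<pi> i)" for i
    proof (cases "i \<in> {1..n}")
      case False
      then have "Poly_Mapping.lookup a i = 0" using a(1) by (auto simp: in_keys_iff)
      then show ?thesis using supp[OF False] permutes_not_in[OF a(2) False] by simp
    qed (rule a(3))
    then have "Poly_Mapping.lookup a = \<mu> \<circ> \<pi>" by (simp add: fun_eq_iff)
    then have "Poly_Mapping.lookup a \<in> orb n \<mu>" using a(2) by (simp add: orb_def)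
    then show "a \<in> expo ` orb n \<mu>" using expo_lookup by (metis imageI)
  next
    fix a assume "a \<in> expo ` orb n \<mu>"
    then obtain \<pi> where a: "a = expo (\<mu> \<circ> \<pi>)" "\<pi> permutes {1..n}" by (auto simp: orb_def)
    then have "\<mu> \<circ> \<pi> \<in> evec n d" using evec_compose[OF par_evec[OF mu]] by blast
    from lookup_expo_evec[OF this] this
    have "Poly_Mapping.lookup a = \<mu> \<circ> \<pi>" "Poly_Mapping.keys a \<subseteq> {1..n}"
      by (auto simp: a in_keys_iff evec_def subset_iff)
    then show "a \<in> {\<alpha>. Poly_Mapping.keys \<alpha> \<subseteq> {1..n} \<and>
      (\<exists>\<pi>. \<pi> permutes {1..n} \<and> (\<forall>i\<in>{1..n}. Poly_Mapping.lookup \<alpha> i = \<mu> (\<pi> i)))}" using a(2) by auto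
  qed
  then show ?thesis unfolding msym_def
    using sum.reindex[OF inj_on_subset[OF expo_inj_evec orb], of "\<lambda>a. Poly_Mapping.single a 1"] by (simp add: o_def)
qed

lemma mac_poly_eq_msym: "mac_poly n d g = (\<Sum>\<mu>\<in>par n d. cst (g \<mu>) * msym n \<mu>)"
proof -
  have "(\<Sum>\<alpha>\<in>orb n \<mu>. Poly_Mapping.single (expo \<alpha>) (g (srt n \<alpha>))) = cst (g \<mu>) * msym n \<mu>" if "\<mu> \<in> par n d" for \<mu>
    unfolding msym_eq[OF that] sum_distrib_left
    by (rule sum.cong) (simp_all add: cst_def mult_single srt_eq[OF that])
  then show ?thesis by (simp add: mac_poly_def sum_evec_orb)
qed

text \<open>\<open>subst\<close> sums over monomials with nonzero coefficient, and
  \<open>h 0 = 0\<close> allows the missing ones to be added. The formula is termwise; this matters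
  because the specialization by reduced fractions is not additive on coefficients with a
  pole.\<close>

lemma subst_mac_poly:
  assumes "h 0 = 0"
  shows "subst h v (mac_poly n d g) = (\<Sum>\<alpha>\<in>evec n d. h (g (srt n \<alpha>)) * (\<Prod>i = 1..n. v i ^ \<alpha> i))"
proof -
  let ?f = "mac_poly n d g"
  let ?t = "\<lambda>a. h (Poly_Mapping.lookup ?f a) * (\<Prod>i\<in>Poly_Mapping.keys a. v i ^ Poly_Mapping.lookup a i)"
  have lk: "Poly_Mapping.lookup ?f (expo \<beta>) = g (srt n \<beta>)" if b: "\<beta> \<in> evec n d" for \<beta>
  proof -
    have "Poly_Mapping.lookup ?f (expo \<beta>) = (\<Sum>\<alpha>\<in>evec n d. if \<alpha> = \<beta> then g (srt n \<alpha>) else 0)"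
      unfolding mac_poly_def lookup_sum
      by (rule sum.cong) (use inj_onD[OF expo_inj_evec _ _ b] in \<open>auto simp: lookup_single when_def\<close>)
    then show ?thesis using b by simp
  qed
  have keys: "Poly_Mapping.keys ?f \<subseteq> expo ` evec n d"
  proof
    fix a assume "a \<in> Poly_Mapping.keys ?f"
    then have "(\<Sum>\<alpha>\<in>evec n d. Poly_Mapping.lookup (Poly_Mapping.single (expo \<alpha>) (g (srt n \<alpha>))) a) \<noteq> 0"
      by (simp add: mac_poly_def in_keys_iff lookup_sum)
    then obtain \<alpha> where "\<alpha> \<in> evec n d" "Poly_Mapping.lookup (Poly_Mapping.single (expo \<alpha>) (g (srt n \<alpha>))) a \<noteq> 0"
      by (rule sum.not_neutral_contains_not_neutral)
    then show "a \<in> expo ` evec n d" by (auto simp: lookup_single when_def split: if_splits)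
  qed
  have "subst h v ?f = (\<Sum>a\<in>expo ` evec n d. ?t a)"
    unfolding subst_def by (rule sum.mono_neutral_left) (use keys assms in \<open>auto simp: in_keys_iff\<close>)
  also have "\<dots> = (\<Sum>\<alpha>\<in>evec n d. ?t (expo \<alpha>))" using sum.reindex[OF expo_inj_evec, of ?t] by (simp add: o_def)
  also have "\<dots> = (\<Sum>\<alpha>\<in>evec n d. h (g (srt n \<alpha>)) * (\<Prod>i = 1..n. v i ^ \<alpha> i))"
  proof (rule sum.cong[OF refl])
    fix \<alpha> assume a: "\<alpha> \<in> evec n d"
    have "(\<Prod>i\<in>Poly_Mapping.keys (expo \<alpha>). v i ^ \<alpha> i) = (\<Prod>i = 1..n. v i ^ \<alpha> i)"
      by (rule prod.mono_neutral_left)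
        (use a in \<open>auto simp: in_keys_iff lookup_expo_evec[OF a] evec_def\<close>)
    then show "?t (expo \<alpha>) = h (g (srt n \<alpha>)) * (\<Prod>i = 1..n. v i ^ \<alpha> i)"
      by (simp add: lk[OF a] lookup_expo_evec[OF a])
  qed
  finally show ?thesis .
qed

lemma emb_power: "emb (a ^ k) = emb a ^ k"
  by (induction k) (simp_all add: emb_mult)

lemma emb_prod: "emb (prod f A) = (\<Prod>i\<in>A. emb (f i))"
  by (induction A rule: infinite_finite_induct) (simp_all add: emb_mult)

lemma emb_mac_poly: "emb (mac_poly n d g) = sf n d g xgen"
  unfolding mac_poly_def sf_eq_sum_evec emb_sum
proof (rule sum.cong[OF refl])
  fix \<alpha> assume "\<alpha> \<in> evec n d"
  then have "mon n \<alpha> xgen = emb (Poly_Mapping.single (expo \<alpha>) 1)" by (intro mon_xgen) (simp add: evec_def)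
  then show "emb (Poly_Mapping.single (expo \<alpha>) (g (srt n \<alpha>))) = embK (g (srt n \<alpha>)) * mon n \<alpha> xgen"
    by (simp add: embK_def cst_def emb_mult[symmetric] mult_single)
qed

lemma emb_qshift_mac_poly: "emb (qshift I (mac_poly n d g)) = sf n d g (scale (embK qK) I xgen)"
proof -
  have "emb (if i \<in> I then cst qK * X i else X i) = scale (embK qK) I xgen i" for i
    by (simp add: scale_def embK_def xgen_def emb_mult)
  then show ?thesis
    by (simp add: qshift_def subst_mac_poly sf_eq_sum_evec emb_sum emb_mult emb_prod emb_power embK_def[symmetric] mon_def)
qed

lemma Hop_mac_poly:
  "Hop n r (mac_poly n d g) = embK (tK ^ choose_two r) * sf n d (mac_act n r qK tK d g) xgen"
proof -
  have "Hop n r (mac_poly n d g) = (\<Sum>I\<in>rsets n r. embK (tK ^ choose_two r) *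
      (mac_coeff n (embK tK) I xgen * sf n d g (scale (embK qK) I xgen)))"
    unfolding Hop_def rsets_def emb_qshift_mac_poly
    by (rule sum.cong) (simp_all add: choose_two_def embK_def mac_coeff_def xgen_def emb_diff emb_mult mult.assoc)
  also have "\<dots> = embK (tK ^ choose_two r) * mac_op n r (embK qK) (embK tK) (sf n d g) xgen"
    by (simp add: mac_op_def sum_distrib_left)
  finally show ?thesis by (simp only: mac_op_sf[OF inj_xgen])
qed

lemma eigval_eq: "eigval n r lam = tK ^ choose_two r * eig n r qK tK lam"
  unfolding eigval_def eig_def sum_distrib_left rsets_def[symmetric]
proof (rule sum.cong)
  fix I assume "I \<in> rsets n r"
  then have "choose_two r \<le> sum (stair n) I" using choose_two_le_sum_stair[of I n] by (auto simp: rsets_def)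
  then have "tK ^ sum (stair n) I = tK ^ choose_two r * tK ^ (sum (stair n) I - choose_two r)"
    by (simp flip: power_add)
  then show "(\<Prod>i\<in>I. qK ^ lam i * tK ^ (n - i)) =
      tK ^ choose_two r * (qK ^ sum lam I * tK ^ (sum (stair n) I - choose_two r))"
    by (simp add: prod.distrib power_sum[symmetric] stair_def[abs_def] mult_ac)
qed (simp add: rsets_def)

text \<open>The power of t common to both sides of the eigenvalue equation cancels, and equality at
  the generic point is equality of coefficient vectors.\<close>

lemma is_macdonald_iff:
  assumes lam: "lam \<in> par n d"
  shows "is_macdonald n lam P \<longleftrightarrow> (\<exists>g. P = mac_poly n d g \<and> g lam = 1 \<and>
    (\<forall>\<mu>. g \<mu> \<noteq> 0 \<longrightarrow> \<mu> \<in> par n d \<and> dom_le n \<mu> lam) \<and>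
    (\<forall>r\<in>{1..n}. \<forall>\<nu>\<in>par n d. mac_act n r qK tK d g \<nu> = eig n r qK tK lam * g \<nu>))"
proof -
  let ?L = "{\<mu>. is_partition n \<mu> \<and> dom_less n \<mu> lam}"
  have L: "?L = {\<mu>\<in>par n d. dom_less n \<mu> lam}"
    using lam by (auto simp: is_partition_def par_def evec_def dom_less_def)
  have ev: "Hop n r (mac_poly n d g) = emb (cst (eigval n r lam)) * emb (mac_poly n d g) \<longleftrightarrow>
      (\<forall>\<nu>\<in>par n d. mac_act n r qK tK d g \<nu> = eig n r qK tK lam * g \<nu>)" for r g
  proof -
    have "Hop n r (mac_poly n d g) = emb (cst (eigval n r lam)) * emb (mac_poly n d g) \<longleftrightarrow>
        sf n d (mac_act n r qK tK d g) xgen = sf n d (\<lambda>\<nu>. eig n r qK tK lam * g \<nu>) xgen"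
      unfolding Hop_mac_poly emb_mac_poly eigval_eq embK_def[symmetric] sf_smult embK_mult
      using tK_nonzero by (simp add: mult.assoc embK_power)
    also have "\<dots> \<longleftrightarrow> (\<forall>\<nu>\<in>par n d. mac_act n r qK tK d g \<nu> = eig n r qK tK lam * g \<nu>)"
      using sf_xgen_eqD[of n d "mac_act n r qK tK d g" "\<lambda>\<nu>. eig n r qK tK lam * g \<nu>"]
      by (auto simp: sf_def)
    finally show ?thesis .
  qed
  have expand: "mac_poly n d g = msym n lam + (\<Sum>\<mu>\<in>?L. cst (g \<mu>) * msym n \<mu>)"
    if g: "g lam = 1" "\<And>\<mu>. g \<mu> \<noteq> 0 \<Longrightarrow> \<mu> \<in> par n d \<and> dom_le n \<mu> lam" for g
  proof -
    have "mac_poly n d g = (\<Sum>\<mu>\<in>insert lam {\<mu>\<in>par n d. dom_less n \<mu> lam}. cst (g \<mu>) * msym n \<mu>)"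
      unfolding mac_poly_eq_msym
    proof (rule sum.mono_neutral_right)
      show "\<forall>\<mu>\<in>par n d - insert lam {\<mu>\<in>par n d. dom_less n \<mu> lam}. cst (g \<mu>) * msym n \<mu> = 0"
      proof
        fix \<mu> assume m: "\<mu> \<in> par n d - insert lam {\<mu>\<in>par n d. dom_less n \<mu> lam}"
        have "g \<mu> = 0" using g(2)[of \<mu>] m by (auto simp: dom_le_def)
        then show "cst (g \<mu>) * msym n \<mu> = 0" by simp
      qed
    qed (use lam in auto)
    also have "\<dots> = msym n lam + (\<Sum>\<mu>\<in>?L. cst (g \<mu>) * msym n \<mu>)"
      unfolding L by (subst sum.insert) (simp_all add: g(1))
    finally show ?thesis .
  qed
  show ?thesis
  proof
    assume "is_macdonald n lam P"
    then obtain u where P: "P = msym n lam + (\<Sum>\<mu>\<in>?L. cst (u \<mu>) * msym n \<mu>)"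
      and H: "\<forall>r\<in>{1..n}. Hop n r P = emb (cst (eigval n r lam)) * emb P"
      unfolding is_macdonald_def by blast
    define g where "g \<mu> = (if \<mu> = lam then 1 else if \<mu> \<in> ?L then u \<mu> else 0)" for \<mu>
    have g: "g lam = 1" "\<And>\<mu>. g \<mu> \<noteq> 0 \<Longrightarrow> \<mu> \<in> par n d \<and> dom_le n \<mu> lam"
      using lam by (auto simp: g_def L dom_le_def split: if_splits)
    have "mac_poly n d g = msym n lam + (\<Sum>\<mu>\<in>?L. cst (g \<mu>) * msym n \<mu>)"
      by (rule expand) (use g in blast)+
    also have "(\<Sum>\<mu>\<in>?L. cst (g \<mu>) * msym n \<mu>) = (\<Sum>\<mu>\<in>?L. cst (u \<mu>) * msym n \<mu>)"
      by (rule sum.cong) (auto simp: g_def)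
    finally have "P = mac_poly n d g" by (simp only: P)
    then show "\<exists>g. P = mac_poly n d g \<and> g lam = 1 \<and>
      (\<forall>\<mu>. g \<mu> \<noteq> 0 \<longrightarrow> \<mu> \<in> par n d \<and> dom_le n \<mu> lam) \<and>
      (\<forall>r\<in>{1..n}. \<forall>\<nu>\<in>par n d. mac_act n r qK tK d g \<nu> = eig n r qK tK lam * g \<nu>)"
      using g H ev by blast
  next
    assume "\<exists>g. P = mac_poly n d g \<and> g lam = 1 \<and>
      (\<forall>\<mu>. g \<mu> \<noteq> 0 \<longrightarrow> \<mu> \<in> par n d \<and> dom_le n \<mu> lam) \<and>
      (\<forall>r\<in>{1..n}. \<forall>\<nu>\<in>par n d. mac_act n r qK tK d g \<nu> = eig n r qK tK lam * g \<nu>)"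
    then obtain g where g: "P = mac_poly n d g" "g lam = 1"
      "\<And>\<mu>. g \<mu> \<noteq> 0 \<Longrightarrow> \<mu> \<in> par n d \<and> dom_le n \<mu> lam"
      "\<forall>r\<in>{1..n}. \<forall>\<nu>\<in>par n d. mac_act n r qK tK d g \<nu> = eig n r qK tK lam * g \<nu>" by blast
    have "P = msym n lam + (\<Sum>\<mu>\<in>?L. cst (g \<mu>) * msym n \<mu>)"
      unfolding g(1) by (rule expand) (use g(2,3) in blast)+
    moreover have "\<forall>r\<in>{1..n}. Hop n r P = emb (cst (eigval n r lam)) * emb P"
      unfolding g(1) ev by (rule g(4))
    ultimately show "is_macdonald n lam P" unfolding is_macdonald_def by blast
  qed
qed

text \<open>The difference of two solutions is an eigenvector of H_1 whose coefficient at
  \<open>lam\<close> is 0; if it were nonzero, \<open>ex_top_support\<close> and the injectivity of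
  the eigenvalues would make that coefficient nonzero.\<close>

lemma macdonald_eq:
  assumes lam: "lam \<in> par n d" and n: "1 \<le> n" and g1: "g lam = 1"
    and gs: "\<And>\<mu>. g \<mu> \<noteq> 0 \<Longrightarrow> \<mu> \<in> par n d \<and> dom_le n \<mu> lam"
    and ev: "\<And>r \<nu>. \<nu> \<in> par n d \<Longrightarrow> mac_act n r qK tK d g \<nu> = eig n r qK tK lam * g \<nu>"
  shows "macdonald n lam = mac_poly n d g"
  unfolding macdonald_def
proof (rule the_equality)
  show "is_macdonald n lam (mac_poly n d g)" unfolding is_macdonald_iff[OF lam] using g1 gs ev by blast
  fix P assume "is_macdonald n lam P"
  then obtain g' where P: "P = mac_poly n d g'" and g1': "g' lam = 1"
    and ev': "\<And>r \<nu>. r \<in> {1..n} \<Longrightarrow> \<nu> \<in> par n d \<Longrightarrow> mac_act n r qK tK d g' \<nu> = eig n r qK tK lam * g' \<nu>"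
    unfolding is_macdonald_iff[OF lam] by blast
  have "g' \<mu> = g \<mu>" if mu: "\<mu> \<in> par n d" for \<mu>
  proof (rule ccontr)
    define h where "h \<mu> = g' \<mu> - g \<mu>" for \<mu>
    assume "\<not> ?thesis"
    then have "h \<mu> \<noteq> 0" by (simp add: h_def)
    from this mu obtain \<rho> where rho: "\<rho> \<in> par n d" "h \<rho> \<noteq> 0"
      and top: "\<And>r q t e. (\<And>\<nu>. \<nu> \<in> par n d \<Longrightarrow> mac_act n r q t d h \<nu> = e * h \<nu>) \<Longrightarrow> eig n r q t \<rho> = e"
      using ex_top_support[of h \<mu> n d] by metis
    have "mac_act n 1 qK tK d h \<nu> = eig n 1 qK tK lam * h \<nu>" if nu: "\<nu> \<in> par n d" for \<nu>
    proof -
      have "mac_act n 1 qK tK d h \<nu> = mac_act n 1 qK tK d g' \<nu> - mac_act n 1 qK tK d g \<nu>"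
        by (simp add: mac_act_def h_def left_diff_distrib sum_subtractf)
      then show ?thesis using ev[OF nu, of 1] ev'[OF _ nu, of 1] n by (simp add: h_def right_diff_distrib)
    qed
    then have "eig n 1 qK tK \<rho> = eig n 1 qK tK lam" by (rule top)
    then have "\<rho> = lam" using eig_1_inj par_evec[OF lam] par_evec[OF rho(1)] by (metis One_nat_def)
    then show False using rho(2) g1 g1' by (simp add: h_def)
  qed
  then show "P = mac_poly n d g" unfolding P mac_poly_def by (intro sum.cong refl) (simp add: srt_evec)
qed

section \<open>Evaluation of reduced fractions\<close>

lemma at_t0_eq:
  assumes "t0_lim c (to_fract [:w:])"
  shows "at_t0 c = to_fract w"
proof -
  obtain a b where ab: "poly b 0 \<noteq> 0" "to_fract [:poly b 0:] \<noteq> 0" "c = to_fract a / to_fract b"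
    "to_fract [:w:] = to_fract [:poly a 0:] / to_fract [:poly b 0:]"
    using assms by (rule t0_limE)
  have "to_fract ([:w:] * [:poly b 0:]) = to_fract [:poly a 0:]"
    by (simp only: to_fract_mult ab(4) times_divide_eq_left nonzero_mult_div_cancel_right[OF ab(2)])
  then have "[:w:] * [:poly b 0:] = [:poly a 0:]" by (simp only: to_fract_eq_iff)
  then have w: "w * poly b 0 = poly a 0" by (simp add: mult.commute)
  \<comment> \<open>The denominator of the reduced fraction divides every denominator of c, in
    particular b, and so it does not vanish at t = 0 either.\<close>
  obtain x y where xy: "quot_of_fract c = (x, y)" by fastforce
  have y0: "y \<noteq> 0" and c: "c = to_fract x / to_fract y" and cop: "coprime x y"
    using snd_quot_of_fract_nonzero[of c] Fract_quot_of_fract[of c] coprime_quot_of_fract[of c]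
    by (simp_all add: xy Fract_conv_to_fract)
  have "b \<noteq> 0" using ab(1) by auto
  moreover have "to_fract a / to_fract b = to_fract x / to_fract y" using c ab(3) by simp
  ultimately have "to_fract a * to_fract y = to_fract x * to_fract b" using y0 by (simp add: frac_eq_eq)
  then have "to_fract (x * b) = to_fract (a * y)" by simp
  then have e: "x * b = a * y" by (simp only: to_fract_eq_iff)
  then have "y dvd x * b" by simp
  then have "y dvd b" using cop by (simp add: coprime_commute coprime_dvd_mult_right_iff)
  then obtain s where s: "b = y * s" by (elim dvdE)
  have "a = x * s" using e y0 unfolding s by (simp add: mult_ac)
  then have "w * poly y 0 * poly s 0 = poly x 0 * poly s 0" using w s by (simp add: mult_ac)
  moreover have "poly y 0 \<noteq> 0" "poly s 0 \<noteq> 0" using ab(1) s by auto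
  ultimately have "poly x 0 = w * poly y 0" by simp
  then have "Fract (poly x 0) (poly y 0) = to_fract w"
    using \<open>poly y 0 \<noteq> 0\<close> by (simp add: Fract_conv_to_fract)
  then show ?thesis by (simp add: at_t0_def xy)
qed

lemma at_q_to_fract: "at_q q (to_fract w) = poly (map_poly of_rat w) q"
  by (simp add: at_q_def)

lemma map_poly_of_rat_add: "map_poly of_rat (a + b) = map_poly of_rat a + (map_poly of_rat b :: real poly)"
  by (rule poly_eqI) (simp add: coeff_map_poly of_rat_add)

lemma map_poly_of_rat_mult: "map_poly of_rat (a * b) = map_poly of_rat a * (map_poly of_rat b :: real poly)"
  by (rule poly_eqI) (simp add: coeff_map_poly coeff_mult of_rat_sum of_rat_mult)

text \<open>The coefficients at t = 0 are polynomials in q, so the later evaluation at a real q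
  meets no denominator.\<close>

lemma qw_coeff_qK: "qw_coeff qK n lam \<alpha> = to_fract [:qw_coeff [:0, 1:] n lam \<alpha>:]"
proof -
  have "to_fract [:qw_coeff [:0, 1:] n lam \<alpha>:] = qw_coeff (to_fract [:[:0, 1 :: rat:]:]) n lam \<alpha>"
    by (rule qw_coeff_hom) (simp_all add: one_pCons[symmetric] flip: to_fract_add to_fract_mult)
  then show ?thesis by (simp only: qK_def to_fract_def)
qed

lemma qw_coeff_real: "poly (map_poly of_rat (qw_coeff [:0, 1:] n lam \<alpha>)) q = qw_coeff q n lam \<alpha>"
  for q :: real
proof -
  have "poly (map_poly of_rat (qw_coeff [:0, 1:] n lam \<alpha>)) q = qw_coeff (poly (map_poly of_rat [:0, 1:]) q) n lam \<alpha>"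
    by (rule qw_coeff_hom) (simp_all add: map_poly_of_rat_add map_poly_of_rat_mult)
  then show ?thesis by (simp add: map_poly_pCons del: qw_coeff.simps)
qed

theorem mainTheorem1:
  fixes l :: nat and q :: real and p :: "nat \<Rightarrow> int" and z :: "nat \<Rightarrow> complex"
  assumes "l \<ge> 1"
    and "0 < q" and "q < 1"
    and "\<forall>i\<in>{1..l}. p i \<ge> p (i + 1)"
    and "\<forall>i\<in>{1..l + 1}. z i \<noteq> 0"
  shows "whittaker_normalized l q z p = macdonald_t0 (l + 1) q p z"
proof -
  let ?n = "Suc l"
  define lam where "lam = (\<lambda>i. if i \<in> {1..?n} then nat (p i - p ?n) else 0)"
  define d where "d = (\<Sum>i = 1..?n. lam i)"
  have p_ge: "p ?n \<le> p i" if "i \<le> ?n" "1 \<le> i" for i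
    using that
  proof (induction i rule: inc_induct)
    case (step i)
    then have "p (i + 1) \<le> p i" using assms(4) by auto
    then show ?case using step by simp
  qed simp
  have p_eq: "p i = p ?n + int (lam i)" if "i \<in> {1..?n}" for i
    using p_ge[of i] that by (simp add: lam_def)
  have lam: "lam \<in> par ?n d"
  proof -
    have "lam (i + 1) \<le> lam i" if "i \<in> {1..<?n}" for i
      using that assms(4) by (auto simp: lam_def intro!: nat_mono)
    then show ?thesis by (auto simp: par_def evec_def d_def lam_def)
  qed
  obtain g where g: "g lam = 1" "\<And>\<mu>. g \<mu> \<noteq> 0 \<Longrightarrow> \<mu> \<in> par ?n d \<and> dom_le ?n \<mu> lam"
    "\<And>r \<nu>. \<nu> \<in> par ?n d \<Longrightarrow> mac_act ?n r qK tK d g \<nu> = eig ?n r qK tK lam * g \<nu>"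
    using ex_macdonald_coeffs[OF lam] by metis
  obtain h where h: "\<And>\<mu>. t0_lim (g \<mu>) (h \<mu>)" "h lam = 1"
    "\<And>\<mu>. h \<mu> \<noteq> 0 \<Longrightarrow> \<mu> \<in> par ?n d \<and> dom_le ?n \<mu> lam"
    "\<And>r \<nu>. \<nu> \<in> par ?n d \<Longrightarrow> mac_act ?n r qK 0 d h \<nu> = eig ?n r qK 0 lam * h \<nu>"
    using ex_macdonald_t0_coeffs[OF lam g] by metis
  have h0: "is_qw ?n d lam h" using h(2-4) by (simp add: is_qw_def eig_t0)
  have coeff: "complex_of_real (at_q q (at_t0 (g (srt ?n \<alpha>)))) = qw_coeff (complex_of_real q) ?n lam \<alpha>"
    if al: "\<alpha> \<in> evec ?n d" for \<alpha>
  proof -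
    let ?w = "qw_coeff [:0, 1:] ?n lam \<alpha> :: rat poly"
    have "h (srt ?n \<alpha>) = qw_mon ?n lam \<alpha>" unfolding qw_mon_def by (rule qw_eqI[OF lam h0 srt_evec(1)[OF al]])
    also have "\<dots> = qw_coeff qK ?n lam \<alpha>" by (rule qw_mon_eq_coeff[OF lam al])
    also have "\<dots> = to_fract [:?w:]" by (rule qw_coeff_qK)
    finally have "at_t0 (g (srt ?n \<alpha>)) = to_fract ?w" using at_t0_eq h(1) by metis
    then have "at_q q (at_t0 (g (srt ?n \<alpha>))) = qw_coeff q ?n lam \<alpha>"
      by (simp only: at_q_to_fract qw_coeff_real)
    moreover have "complex_of_real (qw_coeff q ?n lam \<alpha>) = qw_coeff (complex_of_real q) ?n lam \<alpha>"
      by (rule qw_coeff_hom) simp_all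
    ultimately show ?thesis by (simp only:)
  qed
  \<comment> \<open>The hypothesis \<open>h 0 = 0\<close> of \<open>subst_mac_poly\<close> for the
    combined specialization.\<close>
  have "at_q q (at_t0 0) = 0"
    by (simp add: at_t0_def at_q_def flip: to_fract_0) (simp add: at_q_def to_fract_def[symmetric])
  then have "subst (\<lambda>c. complex_of_real (at_q q (at_t0 c))) z (macdonald ?n lam) =
      qwp (complex_of_real q) ?n d lam z"
    unfolding macdonald_eq[OF lam _ g, simplified]
    by (subst subst_mac_poly) (simp_all add: coeff qwp_def mon_def)
  moreover have "whittaker_normalized l q z p =
      (\<Prod>j = 1..?n. z j powi p ?n) * qwp (complex_of_real q) ?n d lam z"
    by (rule whittaker_normalized_eq_qwp[OF assms(2,3) lam p_eq]) (use assms(5) in auto)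
  ultimately show ?thesis by (simp only: macdonald_t0_def Suc_eq_plus1[symmetric] lam_def[symmetric])
qed

end
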